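(* Let $d\ge1$ and let $I_d\subset\mathbb{K}[x_0,\dots,x_d]$ be the ideal of $2\times2$ minors of the generic Hankel matrix $X_1$. Then $I_d$ is differentially perfect. In particular, for all integers $r,s\ge1$ the set $$\Big\{\prod_{i=1}^{l}f_{j_i}^{r_i}\ \Big|\ f_{j_i}^{r_i}\in\mathcal{M}_{r_i+1}(X_{r_i}),\ r_i\ge r,\ \sum_{i=1}^{l}(\deg f_{j_i}^{r_i}-r)=s\Big\}$$ forms a Gröbner basis for the symbolic power $(I_d^{\{r\}})^{(s)}$ with respect to any diagonal term order.
   Context: $\mathbb{K}$ is an algebraically closed field and $R=\mathbb{K}[\mathbf{x}]=\mathbb{K}[x_0,\dots,x_d]$. For $1\le r\le d$, $X_r$ is the $(r+1)\times(d-r+1)$ Hankel matrix whose entry in row $a$ and column $b$ ($0\le a\le r$, $0\le b\le d-r$) is $x_{a+b}$. $\mathcal{M}_k(X)$ is the set of all $t\times t$ minors of $X$ for all $t\ge k$ (possibly empty). In $f_{j_i}^{r_i}$ the superscript is an index, not a power, and $l\ge1$ is arbitrary; the $r_i$ range over values for which $X_{r_i}$ is defined. A diagonal term order here is any term order that selects the product of the main diagonal entries as leading monomial of every maximal minor of the matrices $X_r$ (for instance lexicographic with $x_0\succ\cdots\succ x_d$). Symbolic power: $I^{(r)}=(R_I^{-1}I^r)\cap R$, where $R_I$ is the complement of the union of the minimal primes of $I$. Join and secant ideals: $I\ast J=\big(I(\mathbf{y})+J(\mathbf{z})+\langle x_i-y_i-z_i\mid i\rangle\big)\cap\mathbb{K}[\mathbf{x}]$,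 where $I(\mathbf{y})$ is $I$ with $y_i$ substituted for $x_i$; the $r$-th secant ideal is the $r$-fold join $I^{\{r\}}=I\ast\cdots\ast I$ (so $I^{\{1\}}=I$). An ideal $I$ is $r$-differentially perfect if for all $s\ge1$, $(I^{\{r\}})^{(s)}=I^{\{r+s-1\}}+\sum_{i=1}^{s-1}(I^{\{r\}})^{(i)}(I^{\{r\}})^{(s-i)}$; it is differentially perfect if it is $r$-differentially perfect for all $r\ge1$. *)

theory Defs
  imports
    "HOL-Library.Poly_Mapping"
    "HOL-Computational_Algebra.Polynomial"
    "HOL-Computational_Algebra.Fraction_Field"
    "HOL-Algebra.Ideal_Product"
    "Jordan_Normal_Form.Determinant"
    "Jordan_Normal_Form.DL_Submatrix"
begin

section \<open>Polynomial rings\<close>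

text \<open>Exponent vectors are finitely supported maps from variables to naturals. The variable set
  \<open>V\<close> is a carrier condition, so that \<open>\<bbbK>[x\<^sub>0, \<dots>, x\<^sub>d]\<close> is available for every \<open>d\<close>.\<close>

type_synonym ('v, 'k) mpol = "('v \<Rightarrow>\<^sub>0 nat) \<Rightarrow>\<^sub>0 'k"

definition pvar :: "'v \<Rightarrow> ('v, 'k::comm_ring_1) mpol" where
  "pvar v = Poly_Mapping.single (Poly_Mapping.single v 1) 1"

definition monom_poly :: "('v \<Rightarrow>\<^sub>0 nat) \<Rightarrow> ('v, 'k::comm_ring_1) mpol" where
  "monom_poly m = Poly_Mapping.single m 1"

definition monomials :: "'v set \<Rightarrow> ('v \<Rightarrow>\<^sub>0 nat) set" where
  "monomials V = {m. Poly_Mapping.keys m \<subseteq> V}"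

definition mpol_ring :: "'v set \<Rightarrow> ('v, 'k::comm_ring_1) mpol ring" where
  "mpol_ring V = \<lparr> carrier = {p. Poly_Mapping.keys p \<subseteq> monomials V},
     monoid.mult = (*), one = 1, zero = 0, add = (+) \<rparr>"

definition subst_poly :: "('v \<Rightarrow> ('w, 'k) mpol) \<Rightarrow> ('v, 'k::comm_ring_1) mpol \<Rightarrow> ('w, 'k) mpol" where
  "subst_poly \<sigma> p = (\<Sum>m\<in>Poly_Mapping.keys p. Poly_Mapping.single 0 (Poly_Mapping.lookup p m) *
     (\<Prod>v\<in>Poly_Mapping.keys m. \<sigma> v ^ Poly_Mapping.lookup m v))"

definition total_degree :: "('v, 'k::comm_ring_1) mpol \<Rightarrow> nat" where
  "total_degree p = Max (insert 0
     ((\<lambda>m. \<Sum>v\<in>Poly_Mapping.keys m. Poly_Mapping.lookup m v) ` Poly_Mapping.keys p))"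

text \<open>\<open>R = \<bbbK>[x\<^sub>0, \<dots>, x\<^sub>d]\<close>, the variable \<open>x\<^sub>i\<close> being \<open>pvar i\<close>.\<close>

abbreviation poly_ring :: "nat \<Rightarrow> (nat, 'k::comm_ring_1) mpol ring" where
  "poly_ring d \<equiv> mpol_ring {..d}"

section \<open>Symbolic powers\<close>

definition minimal_primes :: "('a, 'b) ring_scheme \<Rightarrow> 'a set \<Rightarrow> 'a set set" where
  "minimal_primes R I = {P. primeideal P R \<and> I \<subseteq> P \<and>
     (\<forall>Q. primeideal Q R \<longrightarrow> I \<subseteq> Q \<longrightarrow> Q \<subseteq> P \<longrightarrow> Q = P)}"

definition outside_minimal_primes :: "('a, 'b) ring_scheme \<Rightarrow> 'a set \<Rightarrow> 'a set" where
  "outside_minimal_primes R I = carrier R - \<Union>(minimal_primes R I)"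

definition ideal_power :: "('a, 'b) ring_scheme \<Rightarrow> 'a set \<Rightarrow> nat \<Rightarrow> 'a set" where
  "ideal_power R I n = I [^]\<^bsub>ideals_set R\<^esub> n"

text \<open>Since \<open>R\<close> is a domain, the localization \<open>R\<^sub>I\<^sup>-\<^sup>1 I\<^sup>n\<close> is taken inside a field of fractions. The
  denominator \<open>0\<close> occurs only if \<open>I = R\<close>; as \<open>Fract a 0 = 0\<close>, it contributes nothing then.\<close>

definition localized_power :: "nat \<Rightarrow> (nat, 'k::field) mpol set \<Rightarrow> nat \<Rightarrow> (nat, 'k) mpol fract set" where
  "localized_power d I n = {Fraction_Field.Fract a u | a u.
     a \<in> ideal_power (poly_ring d) I n \<and> u \<in> outside_minimal_primes (poly_ring d) I}"

definition symbolic_power :: "nat \<Rightarrow> (nat, 'k::field) mpol set \<Rightarrow> nat \<Rightarrow> (nat, 'k) mpol set" where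
  "symbolic_power d I n =
     {f \<in> carrier (poly_ring d). Fraction_Field.Fract f 1 \<in> localized_power d I n}"

section \<open>Joins and secant ideals\<close>

datatype xyz = X nat | Y nat | Z nat

definition xyz_ring :: "nat \<Rightarrow> (xyz, 'k::field) mpol ring" where
  "xyz_ring d = mpol_ring (X ` {..d} \<union> Y ` {..d} \<union> Z ` {..d})"

definition join_ideal ::
  "nat \<Rightarrow> (nat, 'k::field) mpol set \<Rightarrow> (nat, 'k) mpol set \<Rightarrow> (nat, 'k) mpol set" where
  "join_ideal d I J = {f \<in> carrier (poly_ring d).
     subst_poly (\<lambda>i. pvar (X i)) f \<in> genideal (xyz_ring d)
       (subst_poly (\<lambda>i. pvar (Y i)) ` I \<union> subst_poly (\<lambda>i. pvar (Z i)) ` J \<union>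
        {pvar (X i) - pvar (Y i) - pvar (Z i) | i. i \<le> d})}"

text \<open>The \<open>r\<close>-fold join, meaningful for \<open>r \<ge> 1\<close> only.\<close>

definition secant_ideal :: "nat \<Rightarrow> (nat, 'k::field) mpol set \<Rightarrow> nat \<Rightarrow> (nat, 'k) mpol set" where
  "secant_ideal d I r = (join_ideal d I ^^ (r - 1)) I"

section \<open>Differential perfection\<close>

definition r_differentially_perfect :: "nat \<Rightarrow> nat \<Rightarrow> (nat, 'k::field) mpol set \<Rightarrow> bool" where
  "r_differentially_perfect d r I \<longleftrightarrow> (\<forall>s\<ge>1.
     symbolic_power d (secant_ideal d I r) s =
       secant_ideal d I (r + s - 1) <+>\<^bsub>poly_ring d\<^esub>
       (\<Oplus>\<^bsub>ideals_set (poly_ring d)\<^esub> i \<in> {1..s - 1}.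
          ideal_prod (poly_ring d) (symbolic_power d (secant_ideal d I r) i)
            (symbolic_power d (secant_ideal d I r) (s - i))))"

definition differentially_perfect :: "nat \<Rightarrow> (nat, 'k::field) mpol set \<Rightarrow> bool" where
  "differentially_perfect d I \<longleftrightarrow> (\<forall>r\<ge>1. r_differentially_perfect d r I)"

section \<open>Minors of Hankel matrices\<close>

definition hankel :: "nat \<Rightarrow> nat \<Rightarrow> (nat, 'k::comm_ring_1) mpol mat" where
  "hankel d r = mat (r + 1) (d - r + 1) (\<lambda>(a, b). pvar (a + b))"

definition square_submatrices :: "nat \<Rightarrow> 'a mat \<Rightarrow> 'a mat set" where
  "square_submatrices t A = {submatrix A I J | I J.
     I \<subseteq> {..<dim_row A} \<and> J \<subseteq> {..<dim_col A} \<and> card I = t \<and> card J = t}"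

definition minors :: "nat \<Rightarrow> 'a::comm_ring_1 mat \<Rightarrow> 'a set" where
  "minors t A = det ` square_submatrices t A"

definition minors_ge :: "nat \<Rightarrow> 'a::comm_ring_1 mat \<Rightarrow> 'a set" where
  "minors_ge k A = (\<Union>t\<in>{k..}. minors t A)"

definition hankel_ideal :: "nat \<Rightarrow> (nat, 'k::field) mpol set" where
  "hankel_ideal d = genideal (poly_ring d) (minors 2 (hankel d 1))"

section \<open>Term orders and Groebner bases\<close>

text \<open>A pair \<open>(m, n)\<close> in the relation means that \<open>m\<close> is at most \<open>n\<close>.\<close>

definition term_order :: "nat \<Rightarrow> (nat \<Rightarrow>\<^sub>0 nat) rel \<Rightarrow> bool" where
  "term_order d ord \<longleftrightarrow> linear_order_on (monomials {..d}) ord \<and>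
     (\<forall>m\<in>monomials {..d}. (0, m) \<in> ord) \<and>
     (\<forall>m n. (m, n) \<in> ord \<longrightarrow> (\<forall>k\<in>monomials {..d}. (m + k, n + k) \<in> ord))"

definition leading_monomial :: "(nat \<Rightarrow>\<^sub>0 nat) rel \<Rightarrow> (nat, 'k::comm_ring_1) mpol \<Rightarrow> (nat, 'k) mpol" where
  "leading_monomial ord f = monom_poly (THE m. m \<in> Poly_Mapping.keys f \<and>
     (\<forall>n\<in>Poly_Mapping.keys f. (n, m) \<in> ord))"

definition groebner_basis ::
  "nat \<Rightarrow> (nat \<Rightarrow>\<^sub>0 nat) rel \<Rightarrow> (nat, 'k::field) mpol set \<Rightarrow> (nat, 'k) mpol set \<Rightarrow> bool" where
  "groebner_basis d ord G I \<longleftrightarrow> finite G \<and> G \<subseteq> I \<and>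
     genideal (poly_ring d) (leading_monomial ord ` (G - {0})) =
     genideal (poly_ring d) (leading_monomial ord ` (I - {0}))"

text \<open>The type argument fixes the coefficient field of the minors. A matrix with \<open>r + 1\<close> rows and
  \<open>d - r + 1\<close> columns has maximal minors of size \<open>min (r + 1) (d - r + 1)\<close>.\<close>

definition diagonal_term_order :: "'k::field itself \<Rightarrow> nat \<Rightarrow> (nat \<Rightarrow>\<^sub>0 nat) rel \<Rightarrow> bool" where
  "diagonal_term_order _ d ord \<longleftrightarrow> term_order d ord \<and>
     (\<forall>r\<in>{1..d}. \<forall>S\<in>square_submatrices (min (r + 1) (d - r + 1)) (hankel d r :: (nat, 'k) mpol mat).
        leading_monomial ord (det S) = (\<Prod>i<dim_row S. S $$ (i, i)))"

text \<open>Products \<open>f\<^sub>1 \<dots> f\<^sub>l\<close> of minors, where \<open>f i\<close> is taken from \<open>X\<^sub>\<rho>\<^sub>i\<close> with \<open>\<rho> i\<close> playing the role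
  of the upper index \<open>r\<^sub>i\<close>.\<close>

definition minor_products :: "nat \<Rightarrow> nat \<Rightarrow> nat \<Rightarrow> (nat, 'k::field) mpol set" where
  "minor_products d r s = {(\<Prod>i\<in>{1..l}. f i) | (l::nat) f \<rho>. l \<ge> 1 \<and>
     (\<forall>i\<in>{1..l}. r \<le> \<rho> i \<and> 1 \<le> \<rho> i \<and> \<rho> i \<le> d \<and> f i \<in> minors_ge (\<rho> i + 1) (hankel d (\<rho> i))) \<and>
     (\<Sum>i\<in>{1..l}. int (total_degree (f i)) - int r) = int s}"

end

theory Submission
  imports Defs
begin

text \<open>
  Let \<open>P\<^sub>r\<close> be the kernel of the substitution of a general point on the span of \<open>r\<close> points of the moment
  curve, \<open>x\<^sub>i \<mapsto> b\<^sub>1 u\<^sub>1\<^sup>i + \<dots> + b\<^sub>r u\<^sub>r\<^sup>i\<close>; it will turn out to be the \<open>r\<close>-th secant ideal.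

  Upper bound. If \<open>f\<close> lies in the \<open>s\<close>-th symbolic power of \<open>P\<^sub>r\<close>, then adding \<open>t z\<^sub>i\<close> to the coordinates
  of that point makes \<open>f\<close> divisible by \<open>t\<^sup>s\<close>. Choose \<open>r\<close> disjoint blocks, each a pair of neighbours or
  \<open>{0}\<close>. In the leading monomial \<open>m\<close> of \<open>f\<close> replace \<open>x\<^sub>i\<close> by \<open>b\<^sub>j u\<^sub>j\<^sup>i\<close> if \<open>i\<close> is in the \<open>j\<close>-th block and by
  \<open>t z\<^sub>i\<close> otherwise. The \<open>2\<close>-minors of \<open>X\<^sub>1\<close> make diagonal orders convex, so no other monomial of \<open>f\<close>
  produces the resulting term; hence \<open>m\<close> has degree at least \<open>s\<close> outside the blocks. Since this holds
  for all choices of blocks, the greedy algorithm extracts from \<open>m\<close> chains without neighbouring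
  indices, of sizes \<open>n\<^sub>k > r\<close> with \<open>\<Sum>(n\<^sub>k - r) = s\<close>. A chain of size \<open>n\<close> is the diagonal of an
  \<open>n\<close>-minor of \<open>X\<^sub>n\<^sub>-\<^sub>1\<close>.

  Lower bound. By a Schur complement, an \<open>n\<close>-minor of \<open>X\<^sub>n\<^sub>-\<^sub>1\<close> times a power of an \<open>r\<close>-minor that does
  not vanish on the secant variety is a sum of products of \<open>n - r\<close> minors of size \<open>r + 1\<close>, which
  vanish there. So the \<open>n\<close>-minor lies in the symbolic power of exponent \<open>n - r\<close>.

  Both bounds give the Groebner basis, hence generators of the symbolic powers, from which
  differential perfection is read off. For \<open>s = 1\<close> they show that \<open>P\<^sub>r\<close> is generated by minors, and the
  expansion of \<open>det (A + B)\<close> along rows identifies \<open>P\<^sub>r\<close> with the \<open>r\<close>-fold join of \<open>P\<^sub>1\<close>.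
\<close>

section \<open>Polynomial rings and substitutions\<close>

abbreviation lookup :: "('a \<Rightarrow>\<^sub>0 'b::zero) \<Rightarrow> 'a \<Rightarrow> 'b" where
  "lookup \<equiv> Poly_Mapping.lookup"

lemma poly_mapping_sum_single: "p = (\<Sum>m\<in>Poly_Mapping.keys p. Poly_Mapping.single m (lookup p m))"
  by (rule poly_mapping_eqI)
    (auto simp: lookup_sum lookup_single when_def in_keys_iff if_distrib sum.If_cases
      sum.delta intro!: sum.neutral)

lemma mpol_induct [case_names single add]:
  assumes "\<And>m c. P (Poly_Mapping.single m c)" and "\<And>p q. P p \<Longrightarrow> P q \<Longrightarrow> P (p + q)"
  shows "P (p :: 'a \<Rightarrow>\<^sub>0 'b::comm_monoid_add)"
proof -
  have "P (\<Sum>m\<in>A. Poly_Mapping.single m (lookup p m))" if "finite A" for A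
    using that
  proof induction
    case empty
    then show ?case using assms(1)[of undefined 0] by simp
  qed (simp add: assms)
  then show ?thesis using poly_mapping_sum_single[of p] by (metis finite_keys)
qed

section \<open>Evaluation of polynomials along a coefficient map\<close>

definition monom_eval :: "('v \<Rightarrow> 'r::comm_ring_1) \<Rightarrow> ('v \<Rightarrow>\<^sub>0 nat) \<Rightarrow> 'r" where
  "monom_eval h m = (\<Prod>v\<in>Poly_Mapping.keys m. h v ^ lookup m v)"

text \<open>The coefficient map \<open>c\<close> is a parameter because values are taken both in
  polynomial rings (\<open>subst_poly\<close>) and in univariate polynomials over such a ring
  (\<open>perturb_eval\<close>).\<close>

definition mpol_eval :: "('k \<Rightarrow> 'r) \<Rightarrow> ('v \<Rightarrow> 'r) \<Rightarrow> ('v, 'k::comm_ring_1) mpol \<Rightarrow> 'r::comm_ring_1" where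
  "mpol_eval c h p = (\<Sum>m\<in>Poly_Mapping.keys p. c (lookup p m) * monom_eval h m)"

lemma subst_poly_eq_eval: "subst_poly h = mpol_eval (Poly_Mapping.single 0) h"
  by (rule ext) (simp add: subst_poly_def mpol_eval_def monom_eval_def)

lemma monom_eval_superset:
  assumes "finite A" "Poly_Mapping.keys m \<subseteq> A"
  shows "monom_eval h m = (\<Prod>v\<in>A. h v ^ lookup m v)"
  unfolding monom_eval_def using assms
  by (intro prod.mono_neutral_left) (auto simp: in_keys_iff)

lemma monom_eval_0 [simp]: "monom_eval h 0 = 1"
  by (simp add: monom_eval_def)

lemma monom_eval_single [simp]: "monom_eval h (Poly_Mapping.single v k) = h v ^ k"
  by (simp add: monom_eval_def)

lemma monom_eval_add: "monom_eval h (m + n) = monom_eval h m * monom_eval h n"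
proof -
  let ?A = "Poly_Mapping.keys m \<union> Poly_Mapping.keys n"
  have "Poly_Mapping.keys (m + n) \<subseteq> ?A" by (rule Poly_Mapping.keys_add)
  then show ?thesis
    by (simp add: monom_eval_superset[of ?A] lookup_add power_add prod.distrib)
qed

lemma comm_ring_hom_single: "comm_ring_hom (Poly_Mapping.single 0 :: 'k::comm_ring_1 \<Rightarrow> ('v::comm_monoid_add \<Rightarrow>\<^sub>0 'k))"
  by unfold_locales (simp_all add: Poly_Mapping.single_add mult_single)

context
  fixes c :: "'k::comm_ring_1 \<Rightarrow> 'r::comm_ring_1"
  assumes c: "comm_ring_hom c"
begin

interpretation c: comm_ring_hom c by (rule c)

lemma mpol_eval_single: "mpol_eval c h (Poly_Mapping.single m a) = c a * monom_eval h m"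
  by (simp add: mpol_eval_def)

lemma mpol_eval_add: "mpol_eval c h (p + q) = mpol_eval c h p + mpol_eval c h q"
  unfolding mpol_eval_def
  by (rule setsum_keys_plus_distrib) (simp_all add: c.hom_add algebra_simps)

lemma mpol_eval_mult: "mpol_eval c h (p * q) = mpol_eval c h p * mpol_eval c h q"
proof (induction p rule: mpol_induct)
  case (single m a)
  show ?case
    by (induction q rule: mpol_induct)
      (simp_all add: mult_single mpol_eval_single mpol_eval_add c.hom_mult monom_eval_add algebra_simps)
qed (simp add: mpol_eval_add algebra_simps)

lemma mpol_eval_hom: "comm_ring_hom (mpol_eval c h)"
proof
  show "mpol_eval c h 1 = 1"
    by (simp add: mpol_eval_def)
  show "mpol_eval c h 0 = 0"
    by (simp add: mpol_eval_def)
qed (simp_all add: mpol_eval_add mpol_eval_mult)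

lemma mpol_eval_pvar [simp]: "mpol_eval c h (pvar v) = h v"
  unfolding pvar_def mpol_eval_single by simp

lemma mpol_eval_comp:
  assumes "comm_ring_hom g"
  shows "g (mpol_eval c h p) = mpol_eval (\<lambda>a. g (c a)) (\<lambda>v. g (h v)) p"
proof -
  interpret g: comm_ring_hom g by fact
  show ?thesis
    by (simp add: mpol_eval_def monom_eval_def g.hom_sum g.hom_mult g.hom_prod g.hom_power)
qed

end

section \<open>Closure properties of polynomial rings and of their ideals\<close>

lemma mpol_ring_simps [simp]:
  "monoid.mult (mpol_ring V) = (*)" "monoid.one (mpol_ring V) = 1"
  "ring.zero (mpol_ring V) = 0" "ring.add (mpol_ring V) = (+)"
  by (simp_all add: mpol_ring_def)

lemma mem_mpol_ring: "p \<in> carrier (mpol_ring V) \<longleftrightarrow> Poly_Mapping.keys p \<subseteq> monomials V"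
  by (simp add: mpol_ring_def)

lemma zero_monomials [simp]: "0 \<in> monomials V"
  by (simp add: monomials_def)

lemma add_monomials: "m \<in> monomials V \<Longrightarrow> n \<in> monomials V \<Longrightarrow> m + n \<in> monomials V"
  using Poly_Mapping.keys_add[of m n] by (auto simp: monomials_def)

lemma single_monomials [simp]: "v \<in> V \<Longrightarrow> Poly_Mapping.single v k \<in> monomials V"
  by (auto simp: monomials_def)

lemma sum_monomials: "(\<And>i. i \<in> A \<Longrightarrow> f i \<in> monomials V) \<Longrightarrow> sum f A \<in> monomials V"
  by (induction A rule: infinite_finite_induct) (auto intro: add_monomials)

lemma mpol_ring_closed [simp, intro]:
  "0 \<in> carrier (mpol_ring V)" "1 \<in> carrier (mpol_ring V)"
  "m \<in> monomials V \<Longrightarrow> Poly_Mapping.single m a \<in> carrier (mpol_ring V)"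
  "v \<in> V \<Longrightarrow> pvar v \<in> carrier (mpol_ring V)"
  "m \<in> monomials V \<Longrightarrow> monom_poly m \<in> carrier (mpol_ring V)"
  by (auto simp: mem_mpol_ring pvar_def monom_poly_def)

lemma mpol_ring_add: "p \<in> carrier (mpol_ring V) \<Longrightarrow> q \<in> carrier (mpol_ring V) \<Longrightarrow> p + q \<in> carrier (mpol_ring V)"
  using Poly_Mapping.keys_add[of p q] by (auto simp: mem_mpol_ring)

lemma mpol_ring_uminus: "p \<in> carrier (mpol_ring V) \<Longrightarrow> - p \<in> carrier (mpol_ring V)"
  by (auto simp: mem_mpol_ring in_keys_iff)

lemma mpol_ring_diff: "p \<in> carrier (mpol_ring V) \<Longrightarrow> q \<in> carrier (mpol_ring V) \<Longrightarrow> p - q \<in> carrier (mpol_ring V)"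
  using mpol_ring_add[OF _ mpol_ring_uminus, of p V q] by simp

lemma mpol_ring_mult: "p \<in> carrier (mpol_ring V) \<Longrightarrow> q \<in> carrier (mpol_ring V) \<Longrightarrow> p * q \<in> carrier (mpol_ring V)"
  using Poly_Mapping.keys_mult[of p q] add_monomials[of _ V] by (fastforce simp: mem_mpol_ring)

lemma mpol_ring_sum: "(\<And>i. i \<in> A \<Longrightarrow> f i \<in> carrier (mpol_ring V)) \<Longrightarrow> sum f A \<in> carrier (mpol_ring V)"
  by (induction A rule: infinite_finite_induct) (auto intro: mpol_ring_add)

lemma mpol_ring_prod: "(\<And>i. i \<in> A \<Longrightarrow> f i \<in> carrier (mpol_ring V)) \<Longrightarrow> prod f A \<in> carrier (mpol_ring V)"
  by (induction A rule: infinite_finite_induct) (auto intro: mpol_ring_mult)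

lemma mpol_ring_power: "p \<in> carrier (mpol_ring V) \<Longrightarrow> p ^ n \<in> carrier (mpol_ring V)"
  by (induction n) (auto intro: mpol_ring_mult)

lemmas mpol_ring_intros = mpol_ring_add mpol_ring_uminus mpol_ring_diff mpol_ring_mult
  mpol_ring_sum mpol_ring_prod mpol_ring_power

lemma cring_mpol_ring: "cring (mpol_ring V)"
proof (rule cringI)
  show "abelian_group (mpol_ring V)"
  proof (rule abelian_groupI)
    fix x assume "x \<in> carrier (mpol_ring V)"
    then show "\<exists>y\<in>carrier (mpol_ring V). y \<oplus>\<^bsub>mpol_ring V\<^esub> x = \<zero>\<^bsub>mpol_ring V\<^esub>"
      by (intro bexI[of _ "- x"]) (auto intro: mpol_ring_uminus)
  qed (auto simp: mpol_ring_add algebra_simps)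
  show "Group.comm_monoid (mpol_ring V)"
    by (rule comm_monoidI) (auto simp: mpol_ring_mult algebra_simps)
qed (simp add: algebra_simps)

lemma mpol_ring_a_inv: "(p :: ('v, 'k::comm_ring_1) mpol) \<in> carrier (mpol_ring V) \<Longrightarrow> \<ominus>\<^bsub>mpol_ring V\<^esub> p = - p"
proof -
  assume p: "p \<in> carrier (mpol_ring V)"
  interpret cring "mpol_ring V :: ('v, 'k) mpol ring" by (rule cring_mpol_ring)
  show ?thesis
    using p by (intro minus_equality) (auto intro: mpol_ring_uminus)
qed

lemma mpol_idealI:
  fixes I :: "('v, 'k::comm_ring_1) mpol set"
  assumes "I \<subseteq> carrier (mpol_ring V)" "0 \<in> I" "\<And>a b. a \<in> I \<Longrightarrow> b \<in> I \<Longrightarrow> a + b \<in> I"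
    and mult: "\<And>a x. a \<in> I \<Longrightarrow> x \<in> carrier (mpol_ring V) \<Longrightarrow> x * a \<in> I"
  shows "ideal I (mpol_ring V)"
proof (rule idealI)
  interpret cring "mpol_ring V :: ('v, 'k) mpol ring" by (rule cring_mpol_ring)
  show "Ring.ring (mpol_ring V :: ('v, 'k) mpol ring)" by (rule ring_axioms)
  show "subgroup I (add_monoid (mpol_ring V))"
  proof (rule add.subgroupI)
    fix a assume "a \<in> I"
    then have "(- 1) * a \<in> I"
      by (intro mult mpol_ring_uminus mpol_ring_closed)
    then show "\<ominus>\<^bsub>mpol_ring V\<^esub> a \<in> I"
      using \<open>a \<in> I\<close> assms(1) by (simp add: mpol_ring_a_inv subset_iff)
  qed (use assms in auto)
next
  fix a x :: "('v, 'k) mpol"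
  assume a: "a \<in> I" "x \<in> carrier (mpol_ring V)"
  show "x \<otimes>\<^bsub>mpol_ring V\<^esub> a \<in> I" "a \<otimes>\<^bsub>mpol_ring V\<^esub> x \<in> I"
    using mult[OF a] by (simp_all add: mult.commute)
qed

lemma mpol_idealD:
  fixes I :: "('v, 'k::comm_ring_1) mpol set"
  assumes "ideal I (mpol_ring V)"
  shows "I \<subseteq> carrier (mpol_ring V)" "0 \<in> I" "a \<in> I \<Longrightarrow> b \<in> I \<Longrightarrow> a + b \<in> I"
    "a \<in> I \<Longrightarrow> x \<in> carrier (mpol_ring V) \<Longrightarrow> x * a \<in> I" "a \<in> I \<Longrightarrow> - a \<in> I"
proof -
  interpret ideal I "mpol_ring V :: ('v, 'k) mpol ring" by fact
  show I: "I \<subseteq> carrier (mpol_ring V)" using a_subset by simp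
  show "0 \<in> I" using additive_subgroup.zero_closed[OF is_additive_subgroup] by simp
  show "a \<in> I \<Longrightarrow> b \<in> I \<Longrightarrow> a + b \<in> I" using additive_subgroup.a_closed[OF is_additive_subgroup] by simp
  show "a \<in> I \<Longrightarrow> x \<in> carrier (mpol_ring V) \<Longrightarrow> x * a \<in> I" using I_l_closed[of a x] by simp
  show "a \<in> I \<Longrightarrow> - a \<in> I"
    using I_l_closed[of a "- 1"] by (simp add: mpol_ring_uminus)
qed

lemma mpol_ideal_sum:
  assumes "ideal I (mpol_ring V)" "\<And>i. i \<in> A \<Longrightarrow> f i \<in> I"
  shows "sum f A \<in> I"
  using assms(2) mpol_idealD(2,3)[OF assms(1)]
  by (induction A rule: infinite_finite_induct) auto

lemma mpol_ideal_diff: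
  assumes "ideal I (mpol_ring V)" "a \<in> I" "b \<in> I" shows "a - b \<in> I"
  using mpol_idealD(3,5)[OF assms(1)] assms(2,3) by fastforce

lemma genideal_mpol:
  fixes S :: "('v, 'k::comm_ring_1) mpol set"
  assumes "S \<subseteq> carrier (mpol_ring V)"
  shows "ideal (genideal (mpol_ring V) S) (mpol_ring V)" "S \<subseteq> genideal (mpol_ring V) S"
    "ideal I (mpol_ring V) \<Longrightarrow> S \<subseteq> I \<Longrightarrow> genideal (mpol_ring V) S \<subseteq> I"
proof -
  interpret cring "mpol_ring V :: ('v, 'k) mpol ring" by (rule cring_mpol_ring)
  show "ideal (genideal (mpol_ring V) S) (mpol_ring V)" "S \<subseteq> genideal (mpol_ring V) S"
    "ideal I (mpol_ring V) \<Longrightarrow> S \<subseteq> I \<Longrightarrow> genideal (mpol_ring V) S \<subseteq> I"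
    using genideal_ideal[OF assms] genideal_self[OF assms] genideal_minimal[of I S] by auto
qed

lemma monom_eval_mem:
  assumes "m \<in> monomials V" "\<And>v. v \<in> V \<Longrightarrow> h v \<in> carrier (mpol_ring W)"
  shows "monom_eval h m \<in> carrier (mpol_ring W)"
  unfolding monom_eval_def using assms
  by (intro mpol_ring_prod mpol_ring_power) (auto simp: monomials_def)

lemma subst_poly_mem:
  assumes "p \<in> carrier (mpol_ring V)" "\<And>v. v \<in> V \<Longrightarrow> h v \<in> carrier (mpol_ring W)"
  shows "subst_poly h p \<in> carrier (mpol_ring W)"
  unfolding subst_poly_eq_eval mpol_eval_def using assms
  by (intro mpol_ring_sum mpol_ring_mult monom_eval_mem[of _ V]) (auto simp: mem_mpol_ring)

lemma kernel_ideal: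
  assumes "comm_ring_hom g"
  shows "ideal {f \<in> carrier (mpol_ring V). g f = 0} (mpol_ring V)"
proof -
  interpret g: comm_ring_hom g by fact
  show ?thesis
    by (rule mpol_idealI) (auto simp: g.hom_add g.hom_mult intro: mpol_ring_intros)
qed

section \<open>Symbolic powers of kernels\<close>

lemma ideals_set_monoid: "Group.comm_monoid (ideals_set (mpol_ring V :: ('v, 'k::comm_ring_1) mpol ring))"
  by (rule cring.ideals_set_is_comm_monoid[OF cring_mpol_ring])

lemma ideals_set_simps [simp]:
  "carrier (ideals_set R) = {I. ideal I R}" "monoid.mult (ideals_set R) = ideal_prod R"
  "monoid.one (ideals_set R) = carrier R" "ring.zero (ideals_set R) = {ring.zero R}"
  "ring.add (ideals_set R) = set_add R"
  by (simp_all add: ideals_set_def)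

lemma ideal_power_0 [simp]: "ideal_power R I 0 = carrier R"
  by (simp add: ideal_power_def nat_pow_def)

lemma ideal_power_Suc: "ideal_power R I (Suc n) = ideal_prod R (ideal_power R I n) I"
  by (simp add: ideal_power_def nat_pow_def)

lemma ideal_power_ideal:
  assumes "ideal I (mpol_ring V :: ('v, 'k::comm_ring_1) mpol ring)"
  shows "ideal (ideal_power (mpol_ring V) I n) (mpol_ring V)"
proof -
  interpret Group.comm_monoid "ideals_set (mpol_ring V :: ('v, 'k) mpol ring)" by (rule ideals_set_monoid)
  show ?thesis using nat_pow_closed[of I n] assms by (simp add: ideal_power_def)
qed

lemma ideal_power_mult:
  assumes "ideal I (mpol_ring V :: ('v, 'k::comm_ring_1) mpol ring)"
    and "a \<in> ideal_power (mpol_ring V) I m" "b \<in> ideal_power (mpol_ring V) I n"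
  shows "a * b \<in> ideal_power (mpol_ring V) I (m + n)"
proof -
  interpret Group.comm_monoid "ideals_set (mpol_ring V :: ('v, 'k) mpol ring)" by (rule ideals_set_monoid)
  have "ideal_prod (mpol_ring V) (ideal_power (mpol_ring V) I m) (ideal_power (mpol_ring V) I n) =
      ideal_power (mpol_ring V) I (m + n)"
    using nat_pow_mult[of I m n] assms(1) by (simp add: ideal_power_def)
  then show ?thesis
    using ideal_prod.prod[OF assms(2,3), of "mpol_ring V"] by simp
qed

lemma ideal_power_prod:
  assumes "ideal I (mpol_ring V :: ('v, 'k::comm_ring_1) mpol ring)"
    and "finite A" "\<And>i. i \<in> A \<Longrightarrow> f i \<in> I"
  shows "prod f A \<in> ideal_power (mpol_ring V) I (card A)"
  using assms(2,3)
proof (induction rule: finite_induct)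
  case (insert i A)
  then have "prod f A * f i \<in> ideal_power (mpol_ring V) I (Suc (card A))"
    unfolding ideal_power_Suc using ideal_prod.prod[of "prod f A" _ "f i" I "mpol_ring V"] by simp
  then show ?case using insert by (simp add: mult.commute)
qed simp

text \<open>Translates membership in a power of an ideal into an order of vanishing. It is applied
  with \<open>g\<close> the evaluation at the moving point and \<open>t\<close> the time
  variable.\<close>

lemma ideal_power_dvd:
  fixes g :: "('v, 'k::comm_ring_1) mpol \<Rightarrow> 'b::comm_ring_1"
  assumes "comm_ring_hom g" "\<And>f. f \<in> I \<Longrightarrow> t dvd g f" "f \<in> ideal_power (mpol_ring V) I n"
  shows "t ^ n dvd g f"
  using assms(3)
proof (induction n arbitrary: f)
  case (Suc n)
  interpret g: comm_ring_hom g by fact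
  from Suc.prems show ?case unfolding ideal_power_Suc
  proof induction
    case (prod i j)
    then have "t ^ n * t dvd g i * g j" using Suc.IH assms(2) by (intro mult_dvd_mono) auto
    then show ?case by (simp add: g.hom_mult mult.commute)
  qed (simp add: g.hom_add)
qed simp

text \<open>Primes are represented as kernels of homomorphisms into domains. A denominator is then
  an element with nonzero image, and products of denominators are denominators again.\<close>

definition hom_kernel :: "'v set \<Rightarrow> (('v, 'k::comm_ring_1) mpol \<Rightarrow> 'b::comm_ring_1) \<Rightarrow> ('v, 'k) mpol set" where
  "hom_kernel V g = {f \<in> carrier (mpol_ring V). g f = 0}"

lemma ideal_hom_kernel: "comm_ring_hom g \<Longrightarrow> ideal (hom_kernel V g) (mpol_ring V)"
  unfolding hom_kernel_def by (rule kernel_ideal)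

lemma primeideal_hom_kernel:
  fixes g :: "('v, 'k::comm_ring_1) mpol \<Rightarrow> 'b::idom"
  assumes "comm_ring_hom g"
  shows "primeideal (hom_kernel V g) (mpol_ring V)"
proof -
  interpret g: comm_ring_hom g by fact
  show ?thesis
  proof (rule primeidealI)
    have "1 \<in> carrier (mpol_ring V :: ('v, 'k) mpol ring)" "1 \<notin> hom_kernel V g"
      by (simp_all add: hom_kernel_def)
    then show "carrier (mpol_ring V) \<noteq> hom_kernel V g" by blast
  qed (auto simp: hom_kernel_def g.hom_mult cring_mpol_ring kernel_ideal[OF assms])
qed

text \<open>A prime is its own only minimal prime, so the denominators are the elements outside
  \<open>P\<close>. They are nonzero because \<open>0\<close> lies in \<open>P\<close>, and equality
  of fractions becomes an equation after multiplication by \<open>u\<close>.\<close>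

lemma symbolic_power_prime:
  fixes P :: "(nat, 'k::field) mpol set"
  assumes "primeideal P (poly_ring d)"
  shows "symbolic_power d P s =
    {f \<in> carrier (poly_ring d). \<exists>u\<in>carrier (poly_ring d) - P. u * f \<in> ideal_power (poly_ring d) P s}"
proof -
  interpret primeideal P "poly_ring d :: (nat, 'k) mpol ring" by fact
  have "minimal_primes (poly_ring d) P = {P}"
    using assms by (auto simp: minimal_primes_def)
  then have out: "outside_minimal_primes (poly_ring d) P = carrier (poly_ring d) - P"
    by (simp add: outside_minimal_primes_def)
  have "0 \<in> P" using mpol_idealD(2)[OF is_ideal] .
  then have nz: "u \<noteq> 0" if "u \<in> carrier (poly_ring d) - P" for u using that by auto
  have "Fraction_Field.Fract f 1 = Fraction_Field.Fract a u \<longleftrightarrow> u * f = a" if "u \<noteq> 0" for f a u :: "(nat, 'k) mpol"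
    using that eq_fract(1)[of 1 u f a] by (simp add: mult.commute)
  note eq = this
  have "Fraction_Field.Fract f 1 \<in> localized_power d P s \<longleftrightarrow>
      (\<exists>u\<in>carrier (poly_ring d) - P. u * f \<in> ideal_power (poly_ring d) P s)" for f
  proof
    assume "Fraction_Field.Fract f 1 \<in> localized_power d P s"
    then obtain a u where au: "Fraction_Field.Fract f 1 = Fraction_Field.Fract a u"
        "a \<in> ideal_power (poly_ring d) P s" "u \<in> carrier (poly_ring d) - P"
      unfolding localized_power_def out by blast
    with eq[OF nz[OF au(3)], of f a]
    show "\<exists>u\<in>carrier (poly_ring d) - P. u * f \<in> ideal_power (poly_ring d) P s" by blast
  next
    assume "\<exists>u\<in>carrier (poly_ring d) - P. u * f \<in> ideal_power (poly_ring d) P s"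
    then obtain u where u: "u \<in> carrier (poly_ring d) - P" "u * f \<in> ideal_power (poly_ring d) P s" by blast
    with eq[OF nz[OF u(1)], of f "u * f"]
    show "Fraction_Field.Fract f 1 \<in> localized_power d P s"
      unfolding localized_power_def out by blast
  qed
  then show ?thesis by (auto simp: symbolic_power_def)
qed

lemma symbolic_power_kernel:
  fixes g :: "(nat, 'k::field) mpol \<Rightarrow> 'b::idom"
  assumes "comm_ring_hom g"
  shows "f \<in> symbolic_power d (hom_kernel {..d} g) s \<longleftrightarrow> f \<in> carrier (poly_ring d) \<and>
    (\<exists>u\<in>carrier (poly_ring d). g u \<noteq> 0 \<and> u * f \<in> ideal_power (poly_ring d) (hom_kernel {..d} g) s)"
  unfolding symbolic_power_prime[OF primeideal_hom_kernel[OF assms]]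
  by (auto simp: hom_kernel_def)

lemma symbolic_power_mult:
  fixes g :: "(nat, 'k::field) mpol \<Rightarrow> 'b::idom"
  assumes g: "comm_ring_hom g"
    and "f1 \<in> symbolic_power d (hom_kernel {..d} g) s1" "f2 \<in> symbolic_power d (hom_kernel {..d} g) s2"
  shows "f1 * f2 \<in> symbolic_power d (hom_kernel {..d} g) (s1 + s2)"
proof -
  interpret g: comm_ring_hom g by fact
  from assms(2,3) obtain u1 u2 where u: "u1 \<in> carrier (poly_ring d)" "g u1 \<noteq> 0"
      "u1 * f1 \<in> ideal_power (poly_ring d) (hom_kernel {..d} g) s1"
      "u2 \<in> carrier (poly_ring d)" "g u2 \<noteq> 0"
      "u2 * f2 \<in> ideal_power (poly_ring d) (hom_kernel {..d} g) s2"
    and f: "f1 \<in> carrier (poly_ring d)" "f2 \<in> carrier (poly_ring d)"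
    unfolding symbolic_power_kernel[OF g] by blast
  have "(u1 * f1) * (u2 * f2) \<in> ideal_power (poly_ring d) (hom_kernel {..d} g) (s1 + s2)"
    by (rule ideal_power_mult[OF ideal_hom_kernel[OF g] u(3,6)])
  then have "(u1 * u2) * (f1 * f2) \<in> ideal_power (poly_ring d) (hom_kernel {..d} g) (s1 + s2)"
    by (simp add: algebra_simps)
  with u f show ?thesis
    unfolding symbolic_power_kernel[OF g]
    by (intro conjI bexI[of _ "u1 * u2"]) (auto simp: g.hom_mult intro: mpol_ring_intros)
qed

lemma symbolic_power_ideal:
  fixes g :: "(nat, 'k::field) mpol \<Rightarrow> 'b::idom"
  assumes g: "comm_ring_hom g"
  shows "ideal (symbolic_power d (hom_kernel {..d} g) s) (poly_ring d)"
proof -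
  interpret g: comm_ring_hom g by fact
  note P = ideal_power_ideal[OF ideal_hom_kernel[OF g], of "{..d}" s]
  show ?thesis
  proof (rule mpol_idealI)
    show "0 \<in> symbolic_power d (hom_kernel {..d} g) s"
      unfolding symbolic_power_kernel[OF g] using mpol_idealD(2)[OF P]
      by (auto intro!: bexI[of _ 1])
  next
    fix a b :: "(nat, 'k) mpol"
    assume "a \<in> symbolic_power d (hom_kernel {..d} g) s" "b \<in> symbolic_power d (hom_kernel {..d} g) s"
    then obtain u1 u2 where u: "u1 \<in> carrier (poly_ring d)" "g u1 \<noteq> 0"
        "u1 * a \<in> ideal_power (poly_ring d) (hom_kernel {..d} g) s"
        "u2 \<in> carrier (poly_ring d)" "g u2 \<noteq> 0"
        "u2 * b \<in> ideal_power (poly_ring d) (hom_kernel {..d} g) s"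
      and ab: "a \<in> carrier (poly_ring d)" "b \<in> carrier (poly_ring d)"
      unfolding symbolic_power_kernel[OF g] by blast
    have "u2 * (u1 * a) + u1 * (u2 * b) \<in> ideal_power (poly_ring d) (hom_kernel {..d} g) s"
      using mpol_idealD(3)[OF P mpol_idealD(4)[OF P u(3) u(4)] mpol_idealD(4)[OF P u(6) u(1)]] .
    then have "(u1 * u2) * (a + b) \<in> ideal_power (poly_ring d) (hom_kernel {..d} g) s"
      by (simp add: algebra_simps)
    with u ab show "a + b \<in> symbolic_power d (hom_kernel {..d} g) s"
      unfolding symbolic_power_kernel[OF g]
      by (intro conjI bexI[of _ "u1 * u2"]) (auto simp: g.hom_mult intro: mpol_ring_intros)
  next
    fix a x :: "(nat, 'k) mpol"
    assume "a \<in> symbolic_power d (hom_kernel {..d} g) s" and x: "x \<in> carrier (poly_ring d)"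
    then obtain u where u: "u \<in> carrier (poly_ring d)" "g u \<noteq> 0"
        "u * a \<in> ideal_power (poly_ring d) (hom_kernel {..d} g) s" "a \<in> carrier (poly_ring d)"
      unfolding symbolic_power_kernel[OF g] by blast
    have "u * (x * a) \<in> ideal_power (poly_ring d) (hom_kernel {..d} g) s"
      using mpol_idealD(4)[OF P u(3) x] by (simp add: algebra_simps)
    with u x show "x * a \<in> symbolic_power d (hom_kernel {..d} g) s"
      unfolding symbolic_power_kernel[OF g] by (auto intro: mpol_ring_intros)
  qed (auto simp: symbolic_power_def)
qed

text \<open>The values lie in a domain, so \<open>g u * g f = 0\<close> with
  \<open>g u \<noteq> 0\<close> forces \<open>g f = 0\<close>: denominators add nothing to the prime
  itself.\<close>

lemma symbolic_power_1:
  fixes g :: "(nat, 'k::field) mpol \<Rightarrow> 'b::idom"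
  assumes g: "comm_ring_hom g"
  shows "symbolic_power d (hom_kernel {..d} g) (Suc 0) = hom_kernel {..d} g"
proof -
  interpret g: comm_ring_hom g by fact
  interpret Group.comm_monoid "ideals_set (poly_ring d :: (nat, 'k) mpol ring)" by (rule ideals_set_monoid)
  have "ideal_power (poly_ring d) (hom_kernel {..d} g) (Suc 0) = hom_kernel {..d} g"
    using l_one[of "hom_kernel {..d} g"] ideal_hom_kernel[OF g, of "{..d}"] by (simp add: ideal_power_Suc)
  then have "f \<in> symbolic_power d (hom_kernel {..d} g) (Suc 0) \<longleftrightarrow> f \<in> carrier (poly_ring d) \<and>
      (\<exists>u\<in>carrier (poly_ring d). g u \<noteq> 0 \<and> u * f \<in> hom_kernel {..d} g)" for f :: "(nat, 'k) mpol"
    by (simp only: symbolic_power_kernel[OF g])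
  moreover have "(\<exists>u\<in>carrier (poly_ring d). g u \<noteq> 0 \<and> u * f \<in> hom_kernel {..d} g) \<longleftrightarrow> g f = 0"
    if "f \<in> carrier (poly_ring d)" for f :: "(nat, 'k) mpol"
  proof
    assume "g f = 0"
    then show "\<exists>u\<in>carrier (poly_ring d). g u \<noteq> 0 \<and> u * f \<in> hom_kernel {..d} g"
      using that by (intro bexI[of _ 1]) (simp_all add: hom_kernel_def)
  qed (auto simp: hom_kernel_def g.hom_mult)
  ultimately show ?thesis by (auto simp: hom_kernel_def)
qed

section \<open>Points of secant varieties and their perturbations\<close>

text \<open>The coordinates of a general point on the span of \<open>r\<close> points of the moment curve; the
  \<open>j\<close>-th weight and node are \<open>pvar (3 * j)\<close> and \<open>pvar (3 * j + 1)\<close>.\<close>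

definition secant_point :: "nat \<Rightarrow> nat \<Rightarrow> (nat, 'k::comm_ring_1) mpol" where
  "secant_point r i = (\<Sum>j<r. pvar (3 * j) * pvar (3 * j + 1) ^ i)"

definition secant_eval :: "nat \<Rightarrow> (nat, 'k::comm_ring_1) mpol \<Rightarrow> (nat, 'k) mpol" where
  "secant_eval r = subst_poly (secant_point r)"

text \<open>The coordinates \<open>pvar (3 * i + 2)\<close> form an independent generic direction in which the point
  moves with time.\<close>

definition perturb_eval :: "nat \<Rightarrow> (nat, 'k::comm_ring_1) mpol \<Rightarrow> (nat, 'k) mpol poly" where
  "perturb_eval r = mpol_eval (\<lambda>a. [:Poly_Mapping.single 0 a:])
     (\<lambda>i. [:secant_point r i, pvar (3 * i + 2):])"

lemma secant_eval_hom: "comm_ring_hom (secant_eval r)"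
  unfolding secant_eval_def subst_poly_eq_eval by (rule mpol_eval_hom[OF comm_ring_hom_single])

lemma comm_ring_hom_const_single:
  "comm_ring_hom (\<lambda>a. [:Poly_Mapping.single 0 a:] :: (nat, 'k::comm_ring_1) mpol poly)"
  by unfold_locales (simp_all add: Poly_Mapping.single_add mult_single mult.commute flip: one_pCons)

lemma perturb_eval_hom: "comm_ring_hom (perturb_eval r)"
  unfolding perturb_eval_def by (rule mpol_eval_hom[OF comm_ring_hom_const_single])

lemma poly_perturb_eval:
  fixes f :: "(nat, 'k::comm_ring_1) mpol"
  shows "poly (perturb_eval r f) 0 = secant_eval r f"
proof -
  have "comm_ring_hom (\<lambda>p :: (nat, 'k) mpol poly. poly p 0)"
    by unfold_locales simp_all
  note comp = mpol_eval_comp[OF comm_ring_hom_const_single this]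
  show ?thesis
    unfolding perturb_eval_def secant_eval_def subst_poly_eq_eval comp by simp
qed

abbreviation secant_kernel :: "nat \<Rightarrow> nat \<Rightarrow> (nat, 'k::comm_ring_1) mpol set" where
  "secant_kernel d r \<equiv> hom_kernel {..d} (secant_eval r)"

text \<open>Elements of the kernel vanish at time 0, so the evaluation of \<open>u * f\<close> is
  divisible by the \<open>s\<close>-th power of the time variable. The denominator \<open>u\<close>
  does not vanish at time 0, has order 0 there, and can be cancelled.\<close>

lemma perturb_eval_symbolic_power:
  fixes f :: "(nat, 'k::field) mpol"
  assumes "f \<in> symbolic_power d (secant_kernel d r) s"
  shows "[:0, 1:] ^ s dvd perturb_eval r f"
proof (cases "perturb_eval r f = 0")
  case False
  interpret g: comm_ring_hom "perturb_eval r" by (rule perturb_eval_hom)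
  from assms obtain u where u: "secant_eval r u \<noteq> 0" "u * f \<in> ideal_power (poly_ring d) (secant_kernel d r) s"
    unfolding symbolic_power_kernel[OF secant_eval_hom] by blast
  have "[:0, 1:] ^ s dvd perturb_eval r (u * f)"
  proof (rule ideal_power_dvd[OF perturb_eval_hom _ u(2)])
    fix h :: "(nat, 'k) mpol" assume "h \<in> secant_kernel d r"
    then have "poly (perturb_eval r h) 0 = 0" by (simp add: poly_perturb_eval hom_kernel_def)
    then show "[:0, 1:] dvd perturb_eval r h" by (simp add: poly_eq_0_iff_dvd)
  qed
  \<comment> \<open>The minus sign matches the linear factor in
    \<open>order_divides\<close>.\<close>
  then have dvd: "[:- 0, 1:] ^ s dvd perturb_eval r u * perturb_eval r f" by (simp add: g.hom_mult)
  have u0: "poly (perturb_eval r u) 0 \<noteq> 0" using u by (simp add: poly_perturb_eval)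
  then have nz: "perturb_eval r u * perturb_eval r f \<noteq> 0" using False by auto
  have "s \<le> order 0 (perturb_eval r u * perturb_eval r f)"
    using dvd nz unfolding order_divides by simp
  also have "\<dots> = order 0 (perturb_eval r f)"
    using order_mult[OF nz, of 0] u0 by (simp add: order_root)
  finally show ?thesis
    using order_divides[of 0 s "perturb_eval r f"] by simp
qed simp

section \<open>Blocks and chains\<close>

text \<open>\<open>block_weight m r n\<close> is the largest weight under \<open>m\<close> of a union of at most \<open>r\<close> disjoint
  blocks inside \<open>{..<n}\<close>, a block being \<open>{0}\<close> or a pair of neighbours.\<close>

fun block_weight :: "(nat \<Rightarrow> nat) \<Rightarrow> nat \<Rightarrow> nat \<Rightarrow> nat" where
  "block_weight m 0 n = 0"
| "block_weight m (Suc r) 0 = 0"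
| "block_weight m (Suc r) (Suc 0) = m 0"
| "block_weight m (Suc r) (Suc (Suc n)) =
     max (block_weight m (Suc r) (Suc n)) (block_weight m r n + m n + m (Suc n))"

lemma block_weight_0 [simp]: "block_weight m r 0 = 0"
  by (cases r) auto

lemma block_weight_Suc: "block_weight m r n \<le> block_weight m r (Suc n)"
  by (cases r; cases n) auto

lemma block_weight_mono: "block_weight m r n \<le> block_weight m (Suc r) n"
proof (induction m r n rule: block_weight.induct)
  case (4 m r n)
  then show ?case by (auto simp: max_def)
qed auto

text \<open>The chain that is split off from the monomial with exponents \<open>m\<close>. Choosing
  it from left to right makes every block meet it at most once, while each index of the support is
  in the chain or directly follows it.\<close>

fun greedy :: "(nat \<Rightarrow> nat) \<Rightarrow> nat \<Rightarrow> bool" where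
  "greedy m 0 \<longleftrightarrow> m 0 > 0"
| "greedy m (Suc i) \<longleftrightarrow> m (Suc i) > 0 \<and> \<not> greedy m i"

text \<open>Exponents after division by the product of the chain. The subtraction is never
  truncated, as chain elements have positive exponent.\<close>

definition greedy_rest :: "(nat \<Rightarrow> nat) \<Rightarrow> nat \<Rightarrow> nat" where
  "greedy_rest m i = m i - of_bool (greedy m i)"

fun greedy_count :: "(nat \<Rightarrow> nat) \<Rightarrow> nat \<Rightarrow> nat" where
  "greedy_count m 0 = 0"
| "greedy_count m (Suc n) = greedy_count m n + of_bool (greedy m n)"

lemma greedy_pos: "greedy m i \<Longrightarrow> m i > 0"
  by (cases i) auto

lemmas greedy_unfold = greedy.simps

lemma greedy_gap: "greedy m (Suc i) \<Longrightarrow> \<not> greedy m i"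
  by simp

lemma greedy_skip: "\<not> greedy m i \<Longrightarrow> \<not> greedy m (Suc i) \<Longrightarrow> m (Suc i) = 0"
  by simp

declare greedy.simps [simp del]

lemma greedy_restI: "greedy m i \<Longrightarrow> m i = Suc (greedy_rest m i)" "\<not> greedy m i \<Longrightarrow> m i = greedy_rest m i"
  using greedy_pos[of m i] by (auto simp: greedy_rest_def)

lemma sum_greedy_rest: "(\<Sum>i<n. m i) = (\<Sum>i<n. greedy_rest m i) + greedy_count m n"
proof (induction n)
  case (Suc n)
  then show ?case using greedy_restI[of m n] by (cases "greedy m n") auto
qed simp

lemma block_weight_le: "block_weight m r n \<le> (\<Sum>i<n. m i)"
  by (induction m r n rule: block_weight.induct) (auto simp: max_def)

text \<open>Every element of the support belongs to the greedy chain or follows one of its elements.\<close>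

lemma block_weight_full: "greedy_count m n \<le> r \<Longrightarrow> (\<Sum>i<n. m i) \<le> block_weight m r n"
proof (induction n arbitrary: r rule: less_induct)
  case (less n)
  consider "n = 0" | "n = 1" | k where "n = Suc (Suc k)" by (metis One_nat_def not0_implies_Suc)
  then show ?case
  proof cases
    case 2 with less.prems show ?thesis by (cases r) (auto simp: greedy_unfold)
  next
    case (3 k)
    show ?thesis
    proof (cases "greedy m k \<or> greedy m (Suc k)")
      case True
      \<comment> \<open>The pair contains exactly one chain element, so using it as a block costs
        one block and removes one chain element.\<close>
      then have "greedy_count m n = Suc (greedy_count m k)" using 3 by (auto simp: greedy_unfold)
      with less.prems obtain q where "r = Suc q" "greedy_count m k \<le> q" by (cases r) auto
      with less.IH[of k q] 3 show ?thesis by auto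
    next
      case False
      then have "m (Suc k) = 0" "greedy_count m n = greedy_count m (Suc k)" using 3 by (auto simp: greedy_unfold)
      with less.IH[of "Suc k" r] less.prems 3 block_weight_Suc[of m r "Suc k"] show ?thesis by simp
    qed
  qed simp
qed

text \<open>The second part strengthens the induction: if \<open>n - 1\<close> is in the greedy chain, then blocks of the
  remainder inside \<open>{..<n}\<close> can be shifted so that one more block makes room for \<open>n\<close> as well.\<close>

lemma block_weight_greedy_aux:
  "(\<forall>r. block_weight (greedy_rest m) r n + min (greedy_count m n) r \<le> block_weight m r n) \<and>
   (n \<ge> 1 \<longrightarrow> greedy m (n - 1) \<longrightarrow>
     (\<forall>r. block_weight (greedy_rest m) r n + m n + min (greedy_count m n) (Suc r) \<le> block_weight m (Suc r) (Suc n)))"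
proof (induction n rule: less_induct)
  case (less n)
  let ?m = "greedy_rest m"
  have P: "block_weight ?m r k + min (greedy_count m k) r \<le> block_weight m r k" if "k < n" for k r
    using less.IH[OF that] by blast
  have Q: "block_weight ?m r (Suc k) + m (Suc k) + min (greedy_count m (Suc k)) (Suc r) \<le> block_weight m (Suc r) (Suc (Suc k))"
    if "Suc k < n" "greedy m k" for k r
    using less.IH[OF that(1)] that(2) by simp
  have 1: "block_weight ?m r n + min (greedy_count m n) r \<le> block_weight m r n" for r
  proof (cases r)
    case (Suc q)
    consider "n = 0" | "n = 1" | k where "n = Suc (Suc k)" by (metis One_nat_def not0_implies_Suc)
    then show ?thesis
    proof cases
      case 1 then show ?thesis by simp
    next
      case 2 then show ?thesis using Suc greedy_restI[of m 0] by auto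
    next
      case 3
      \<comment> \<open>\<open>a\<close> and \<open>c\<close> treat an optimum for the remainder
        that leaves out the last index, \<open>b\<close> one that uses the last pair as a
        block.\<close>
      have a: "block_weight ?m r (Suc k) + min (greedy_count m n) r \<le> block_weight m r n"
        if "\<not> greedy m (Suc k)"
      proof -
        have "greedy_count m n = greedy_count m (Suc k)" using that 3 by simp
        with P[of "Suc k" r] 3 that block_weight_Suc[of m r "Suc k"] show ?thesis by simp
      qed
      have b: "block_weight ?m q k + ?m k + ?m (Suc k) + min (greedy_count m n) r \<le> block_weight m r n"
      proof (cases "greedy m k \<or> greedy m (Suc k)")
        case True
        then have "greedy m (Suc k) \<longleftrightarrow> \<not> greedy m k" using greedy_gap[of m k] by blast
        then have "m k + m (Suc k) = Suc (?m k + ?m (Suc k))" "greedy_count m n = Suc (greedy_count m k)"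
          using greedy_restI[of m k] greedy_restI[of m "Suc k"] 3
          by (cases "greedy m k"; simp)+
        with P[of k q] 3 Suc show ?thesis by auto
      next
        case False
        then have z: "m (Suc k) = 0" "?m (Suc k) = 0" "?m k = m k" "greedy_count m n = greedy_count m k"
          using greedy_restI[of m "Suc k"] greedy_restI[of m k] 3 greedy_skip[of m k] by auto
        show ?thesis
        proof (cases "m k = 0")
          case True
          with P[of k r] z 3 Suc block_weight_mono[of ?m q k] block_weight_Suc[of m r k]
            block_weight_Suc[of m r "Suc k"]
          show ?thesis by simp
        next
          case mk: False
          \<comment> \<open>Now \<open>k\<close> is in the support but not in the chain, so it
            follows a chain element \<open>j\<close>. The second part of the induction hypothesis
            fits \<open>k\<close> and the blocks below it into \<open>{..<Suc k}\<close>.\<close>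
          with False obtain j where j: "k = Suc j" "greedy m j" by (cases k) (auto simp: greedy_unfold)
          with Q[of j q] z 3 Suc block_weight_Suc[of m r "Suc k"] show ?thesis by simp
        qed
      qed
      have c: "block_weight ?m r (Suc k) + min (greedy_count m n) r \<le> block_weight m r n" if "greedy m (Suc k)"
      \<comment> \<open>Either \<open>r\<close> blocks cover all of \<open>m\<close>, or the minimum
        is \<open>r\<close> even without the last chain element.\<close>
      proof (cases "greedy_count m n \<le> r")
        case True
        have "block_weight ?m r (Suc k) \<le> (\<Sum>i<n. ?m i)"
          using block_weight_le[of ?m r "Suc k"] 3 by simp
        with block_weight_full[OF True] sum_greedy_rest[of m n] show ?thesis by simp
      next
        case False
        with P[of "Suc k" r] that 3 block_weight_Suc[of m r "Suc k"] show ?thesis by simp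
      qed
      show ?thesis using a b c 3 Suc by (auto simp: max_def)
    qed
  qed simp
  have 2: "block_weight ?m r n + m n + min (greedy_count m n) (Suc r) \<le> block_weight m (Suc r) (Suc n)"
    if n: "n \<ge> 1" "greedy m (n - 1)" for r
  proof -
    from n obtain k where k: "n = Suc k" "greedy m k" by (cases n) auto
    have mk: "m k = Suc (?m k)" "greedy_count m n = Suc (greedy_count m k)"
      using k greedy_restI[of m k] by auto
    have a: "block_weight ?m r k + ?m k + m n + min (greedy_count m n) (Suc r) \<le> block_weight m (Suc r) (Suc n)"
      using P[of k r] k mk by auto
    show ?thesis
    proof (cases "r = 0 \<or> k = 0")
      case True
      then show ?thesis using a k by (cases r) auto
    next
      case False
      then obtain q j where qj: "r = Suc q" "k = Suc j" by (metis not0_implies_Suc)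
      have j: "\<not> greedy m j" using k qj by (auto simp: greedy_unfold)
      \<comment> \<open>This is an optimum that uses the block \<open>{j, k}\<close>. The new block
        \<open>{k, n}\<close> takes over \<open>k\<close>; if \<open>j\<close> carries weight, it is
        absorbed by the induction hypothesis at its predecessor \<open>i\<close> in the
        chain.\<close>
      have b: "block_weight ?m q j + ?m j + ?m k + m n + min (greedy_count m n) (Suc r) \<le> block_weight m (Suc r) (Suc n)"
      proof (cases "m j = 0")
        case True
        have "block_weight ?m q j \<le> block_weight ?m r k"
          using block_weight_mono[of ?m q j] block_weight_Suc[of ?m r j] qj by simp
        with a True show ?thesis by (simp add: greedy_rest_def)
      next
        case mj: False
        with j obtain i where i: "j = Suc i" "greedy m i" by (cases j) (auto simp: greedy_unfold)
        have "?m j = m j" "greedy_count m k = greedy_count m j"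
          using j greedy_restI[of m j] qj by auto
        with Q[of i q] i mk k qj show ?thesis by simp
      qed
      show ?thesis using a b k qj by (auto simp: max_def)
    qed
  qed
  show ?case using 1 2 by blast
qed

text \<open>Balances the recursion in \<open>chain_decomposition\<close>: of the \<open>n\<close>
  elements of a split-off chain, \<open>n - r\<close> count towards \<open>s\<close> and
  \<open>min n r\<close> are paid for by the drop of the block weight.\<close>

corollary block_weight_greedy:
  "block_weight (greedy_rest m) r n + min (greedy_count m n) r \<le> block_weight m r n"
  using block_weight_greedy_aux by blast

text \<open>\<open>\<beta> j\<close> is the upper end of the \<open>j\<close>-th block; \<open>\<beta> j \<ge> n\<close> means that this block is not used.\<close>

definition separated :: "nat \<Rightarrow> nat \<Rightarrow> (nat \<Rightarrow> nat) \<Rightarrow> bool" where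
  "separated n r \<beta> \<longleftrightarrow> (\<forall>i<r. \<forall>j<r. i \<noteq> j \<longrightarrow> \<beta> i < n \<longrightarrow> \<beta> j < n \<longrightarrow> \<beta> i + 2 \<le> \<beta> j \<or> \<beta> j + 2 \<le> \<beta> i)"

definition covered :: "nat \<Rightarrow> nat \<Rightarrow> (nat \<Rightarrow> nat) \<Rightarrow> nat \<Rightarrow> bool" where
  "covered n r \<beta> i \<longleftrightarrow> (\<exists>j<r. \<beta> j < n \<and> (i = \<beta> j \<or> Suc i = \<beta> j))"

lemma block_weight_witness:
  assumes "n \<le> N"
  shows "\<exists>\<beta>. (\<forall>j<r. \<beta> j < n \<or> \<beta> j = N) \<and> separated n r \<beta> \<and>
    block_weight m r n = (\<Sum>i | i < n \<and> covered n r \<beta> i. m i)"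
  using assms
proof (induction m r n rule: block_weight.induct)
  case (1 m n)
  show ?case by (auto simp: separated_def covered_def)
next
  case (2 m r)
  show ?case by (auto simp: separated_def)
next
  case (3 m r)
  have "{i. i < Suc 0 \<and> covered (Suc 0) (Suc r) (\<lambda>j. if j = 0 then 0 else N) i} = {0}"
    using 3 by (auto simp: covered_def)
  then show ?case
    using 3 by (intro exI[of _ "\<lambda>j. if j = 0 then 0 else N"]) (auto simp: separated_def)
next
  case (4 m r n)
  from 4 obtain \<beta> where \<beta>: "\<forall>j<Suc r. \<beta> j < Suc n \<or> \<beta> j = N" "separated (Suc n) (Suc r) \<beta>"
      "block_weight m (Suc r) (Suc n) = (\<Sum>i | i < Suc n \<and> covered (Suc n) (Suc r) \<beta> i. m i)"
    by auto
  from 4 obtain \<gamma> where \<gamma>: "\<forall>j<r. \<gamma> j < n \<or> \<gamma> j = N" "separated n r \<gamma>"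
      "block_weight m r n = (\<Sum>i | i < n \<and> covered n r \<gamma> i. m i)"
    by auto
  show ?case
  proof (cases "block_weight m (Suc r) (Suc n) \<ge> block_weight m r n + m n + m (Suc n)")
    case True
    have "{i. i < Suc n \<and> covered (Suc n) (Suc r) \<beta> i} =
        {i. i < Suc (Suc n) \<and> covered (Suc (Suc n)) (Suc r) \<beta> i}"
      using \<beta>(1) 4(3) by (fastforce simp: covered_def)
    moreover have "separated (Suc (Suc n)) (Suc r) \<beta>"
      using \<beta>(1,2) 4(3) unfolding separated_def by (metis less_SucI not_less)
    ultimately show ?thesis
      using True \<beta> by (intro exI[of _ \<beta>]) auto
  next
    case False
    \<comment> \<open>The second term of the maximum wins, and the additional block number
      \<open>r\<close> becomes the pair \<open>{n, Suc n}\<close>.\<close>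
    define \<gamma>' where "\<gamma>' = \<gamma>(r := Suc n)"
    have \<gamma>': "\<gamma>' r = Suc n" "\<And>j. j < r \<Longrightarrow> \<gamma>' j = \<gamma> j" by (simp_all add: \<gamma>'_def)
    have tops: "\<forall>j<Suc r. \<gamma>' j < Suc (Suc n) \<or> \<gamma>' j = N"
      using \<gamma>(1) \<gamma>' by (fastforce simp: less_Suc_eq)
    have "{i. i < Suc (Suc n) \<and> covered (Suc (Suc n)) (Suc r) \<gamma>' i} =
        insert n (insert (Suc n) {i. i < n \<and> covered n r \<gamma> i})"
      using \<gamma>(1) \<gamma>' 4(3) by (fastforce simp: covered_def less_Suc_eq)
    then have "(\<Sum>i | i < Suc (Suc n) \<and> covered (Suc (Suc n)) (Suc r) \<gamma>' i. m i) =
        block_weight m r n + m n + m (Suc n)"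
      by (simp add: \<gamma>(3))
    moreover have "separated (Suc (Suc n)) (Suc r) \<gamma>'"
      unfolding separated_def
    proof (intro allI impI)
      have *: "i = r \<and> \<gamma>' i = Suc n \<or> i < r \<and> \<gamma>' i = \<gamma> i \<and> \<gamma> i < n"
        if "i < Suc r" "\<gamma>' i < Suc (Suc n)" for i
        using that \<gamma>' \<gamma>(1)[rule_format, of i] 4(3) by (cases "i = r") auto
      fix i j assume ij: "i < Suc r" "j < Suc r" "i \<noteq> j" "\<gamma>' i < Suc (Suc n)" "\<gamma>' j < Suc (Suc n)"
      from *[OF ij(1,4)] *[OF ij(2,5)] ij(3) \<gamma>(2)
      show "\<gamma>' i + 2 \<le> \<gamma>' j \<or> \<gamma>' j + 2 \<le> \<gamma>' i"
        unfolding separated_def by (elim disjE conjE) auto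
    qed
    ultimately show ?thesis
      using False tops by (intro exI[of _ \<gamma>']) (auto simp: max_def)
  qed
qed

corollary block_weight_blocks:
  obtains \<beta> where "separated (Suc d) r \<beta>"
    "(\<Sum>i\<le>d. m i) = block_weight m r (Suc d) + (\<Sum>i | i \<le> d \<and> \<not> covered (Suc d) r \<beta> i. m i)"
proof -
  obtain \<beta> where \<beta>: "separated (Suc d) r \<beta>"
      "block_weight m r (Suc d) = (\<Sum>i | i < Suc d \<and> covered (Suc d) r \<beta> i. m i)"
    using block_weight_witness[of "Suc d" "Suc d" r m] by auto
  have "{..d} = {i. i < Suc d \<and> covered (Suc d) r \<beta> i} \<union> {i. i \<le> d \<and> \<not> covered (Suc d) r \<beta> i}"
    by auto
  then have "(\<Sum>i\<le>d. m i) = (\<Sum>i\<in>{i. i < Suc d \<and> covered (Suc d) r \<beta> i} \<union> {i. i \<le> d \<and> \<not> covered (Suc d) r \<beta> i}. m i)"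
    by simp
  also have "\<dots> = block_weight m r (Suc d) + (\<Sum>i | i \<le> d \<and> \<not> covered (Suc d) r \<beta> i. m i)"
    unfolding \<beta>(2) by (rule sum.union_disjoint) auto
  finally show ?thesis using that \<beta>(1) by blast
qed

section \<open>Decomposition of exponent vectors into chains\<close>

lemma greedy_count_card: "greedy_count m n = card {i. i < n \<and> greedy m i}"
proof (induction n)
  case (Suc n)
  have "{i. i < Suc n \<and> greedy m i} = {i. i < n \<and> greedy m i} \<union> (if greedy m n then {n} else {})"
    by (auto simp: less_Suc_eq)
  then show ?case using Suc by simp
qed simp

definition is_chain :: "nat \<Rightarrow> nat set \<Rightarrow> bool" where
  "is_chain d C \<longleftrightarrow> C \<subseteq> {..d} \<and> (\<forall>i\<in>C. Suc i \<notin> C)"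

text \<open>Induction on the degree, splitting off the greedy chain each time. A chain with at most
  \<open>r\<close> elements is discarded, which loses nothing from \<open>s\<close>; by
  \<open>block_weight_greedy\<close> the hypothesis passes to the remainder.\<close>

lemma chain_decomposition:
  assumes "s + block_weight m r (Suc d) \<le> (\<Sum>i\<le>d. m i)"
  shows "\<exists>Cs. (\<forall>C\<in>set Cs. is_chain d C \<and> r < card C) \<and> (\<Sum>C\<leftarrow>Cs. card C - r) = s \<and>
    (\<forall>i. (\<Sum>C\<leftarrow>Cs. of_bool (i \<in> C)) \<le> m i)"
  using assms
proof (induction "\<Sum>i\<le>d. m i" arbitrary: m s rule: less_induct)
  case less
  show ?case
  proof (cases "s = 0")
    case True
    then show ?thesis by (intro exI[of _ "[]"]) auto
  next
    case False
    let ?m = "greedy_rest m" and ?c = "greedy_count m (Suc d)" and ?C = "{i. i < Suc d \<and> greedy m i}"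
    have cnt: "?c > 0"
    proof (rule ccontr)
      assume "\<not> ?c > 0"
      then have "(\<Sum>i<Suc d. m i) \<le> block_weight m r (Suc d)" by (intro block_weight_full) simp
      with False less.prems show False by (simp add: lessThan_Suc_atMost)
    qed
    have sum: "(\<Sum>i\<le>d. m i) = (\<Sum>i\<le>d. ?m i) + ?c"
      using sum_greedy_rest[of m "Suc d"] by (simp only: lessThan_Suc_atMost)
    have chain: "is_chain d D" if "D \<subseteq> ?C" for D
      using that greedy_gap[of m] by (fastforce simp: is_chain_def)
    have card: "card ?C = ?c" by (simp add: greedy_count_card)
    have le: "of_bool (i \<in> ?C) + ?m i \<le> m i" for i
      using greedy_restI[of m i] by (cases "greedy m i") auto
    show ?thesis
    proof (cases "s \<le> ?c - r")
      case True
      with False card have "r + s \<le> card ?C" by linarith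
      \<comment> \<open>The last chain is cut down so that the surplus is exactly \<open>s\<close>;
        subsets of chains are chains.\<close>
      then obtain D where D: "D \<subseteq> ?C" "card D = r + s"
        by (rule obtain_subset_with_card_n)
      have "of_bool (i \<in> D) \<le> m i" for i
        using D(1) greedy_pos[of m i] by (auto simp: Suc_le_eq)
      then show ?thesis using D chain[OF D(1)] False by (intro exI[of _ "[D]"]) auto
    next
      case s: False
      have "s - (?c - r) + block_weight ?m r (Suc d) \<le> (\<Sum>i\<le>d. ?m i)"
        using block_weight_greedy[of m r "Suc d"] less.prems sum s by linarith
      from less.hyps[OF _ this] sum cnt obtain Cs where Cs:
        "\<forall>C\<in>set Cs. is_chain d C \<and> r < card C" "(\<Sum>C\<leftarrow>Cs. card C - r) = s - (?c - r)"
        "\<forall>i. (\<Sum>C\<leftarrow>Cs. of_bool (i \<in> C)) \<le> ?m i" by auto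
      show ?thesis
      proof (cases "r < ?c")
        case True
        have "(\<Sum>C\<leftarrow>?C # Cs. of_bool (i \<in> C)) \<le> m i" for i
          using le[of i] Cs(3)[rule_format, of i] by simp
        then show ?thesis
          using Cs chain[of ?C] card True s by (intro exI[of _ "?C # Cs"]) auto
      next
        case False
        have "(\<Sum>C\<leftarrow>Cs. of_bool (i \<in> C)) \<le> m i" for i
          using le[of i] Cs(3)[rule_format, of i] by linarith
        then show ?thesis using Cs False by (intro exI[of _ Cs]) auto
      qed
    qed
  qed
qed

section \<open>Leading monomials of symbolic powers\<close>

lemma single_Suc: "Poly_Mapping.single v (Suc n) = Poly_Mapping.single v n + Poly_Mapping.single v 1"
  by (simp flip: Poly_Mapping.single_add)

text \<open>A term order is extended to all monomials by ignoring variables outside \<open>{..d}\<close>, which leaves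
  only a preorder. The last condition compares the two products in a \<open>2\<close>-minor of \<open>X\<^sub>1\<close>.\<close>

locale diagonal_preorder =
  fixes d :: nat and le :: "(nat \<Rightarrow>\<^sub>0 nat) \<Rightarrow> (nat \<Rightarrow>\<^sub>0 nat) \<Rightarrow> bool"
  assumes leq_total: "le m n \<or> le n m"
    and leq_trans: "le m n \<Longrightarrow> le n k \<Longrightarrow> le m k"
    and add_iff: "le (m + k) (n + k) \<longleftrightarrow> le m n"
    and pos: "i \<le> d \<Longrightarrow> \<not> le (Poly_Mapping.single i 1) 0"
    and convex: "c < i \<Longrightarrow> i < d \<Longrightarrow> \<not> le (Poly_Mapping.single c 1 + Poly_Mapping.single (Suc i) 1)
      (Poly_Mapping.single i 1 + Poly_Mapping.single (Suc c) 1)"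
begin

abbreviation lt where "lt m n \<equiv> \<not> le n m"

lemma leq_refl: "le m m"
  using leq_total by blast

lemma add_iff': "le (k + m) (k + n) \<longleftrightarrow> le m n"
  using add_iff[of m k n] by (simp add: add.commute)

lemma leq_add_mono: "le m n \<Longrightarrow> le m' n' \<Longrightarrow> le (m + m') (n + n')"
  by (rule leq_trans[of _ "n + m'"]) (simp_all add: add_iff add_iff')

lemma leq_add_strict:
  assumes "le m n" "lt m' n'" shows "lt (m + m') (n + n')"
proof
  assume "le (n + n') (m + m')"
  moreover have "le (m + n') (n + n')" using assms(1) by (simp add: add_iff)
  ultimately have "le (m + n') (m + m')" by (rule leq_trans[rotated])
  then show False using assms(2) by (simp add: add_iff')
qed

text \<open>For the block \<open>{c, Suc c}\<close>, the left side is the upper weight of the term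
  with node exponent \<open>i\<close>, and the right side is its lower weight times
  \<open>x\<^sub>i\<close>. They agree at \<open>i = c\<close>, and convexity makes the gap strict
  when descending from there.\<close>

lemma convex_lower:
  assumes "Suc c \<le> d" "i < c"
  shows "lt (Poly_Mapping.single c (Suc c) + Poly_Mapping.single (Suc c) i)
    (Poly_Mapping.single i 1 + Poly_Mapping.single c i + Poly_Mapping.single (Suc c) c)"
proof -
  define A where "A i = Poly_Mapping.single c (Suc c) + Poly_Mapping.single (Suc c) i" for i
  define B where "B i = Poly_Mapping.single i 1 + Poly_Mapping.single c i + Poly_Mapping.single (Suc c) c" for i
  have eq: "le (A c) (B c)"
    unfolding A_def B_def by (simp add: single_Suc[of _ c] leq_refl add_ac)
  have step: "lt (A i) (B i)" if "le (A (Suc i)) (B (Suc i))" "i < c" for i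
  proof -
    from that(2) have "lt (Poly_Mapping.single c 1 + Poly_Mapping.single (Suc i) 1)
      (Poly_Mapping.single i 1 + Poly_Mapping.single (Suc c) 1)"
      using convex[of i c] assms by simp
    \<comment> \<open>The sum of the two comparisons is the desired one up to a common monomial,
      which cancels.\<close>
    from leq_add_strict[OF that(1) this]
    have "lt (A i + (Poly_Mapping.single c 1 + Poly_Mapping.single (Suc i) 1 + Poly_Mapping.single (Suc c) 1))
       (B i + (Poly_Mapping.single c 1 + Poly_Mapping.single (Suc i) 1 + Poly_Mapping.single (Suc c) 1))"
      by (simp add: A_def B_def single_Suc[of _ i] add_ac)
    then show ?thesis unfolding add_iff .
  qed
  have "le (A (c - k)) (B (c - k)) \<and> (k > 0 \<longrightarrow> lt (A (c - k)) (B (c - k)))" if "k \<le> c" for k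
    using that
  proof (induction k)
    case (Suc k)
    then have "lt (A (c - Suc k)) (B (c - Suc k))"
      by (intro step) (auto simp: Suc_diff_Suc)
    then show ?case using leq_total by blast
  qed (simp add: eq)
  from this[of "c - i"] assms show ?thesis by (simp add: A_def B_def)
qed

text \<open>The mirror image for indices above the block: both sides agree at \<open>Suc c\<close>,
  and the induction ascends.\<close>

lemma convex_upper:
  assumes "Suc c < i" "i \<le> d"
  shows "lt (Poly_Mapping.single c (Suc c) + Poly_Mapping.single (Suc c) i)
    (Poly_Mapping.single i 1 + Poly_Mapping.single c i + Poly_Mapping.single (Suc c) c)"
proof -
  define A where "A i = Poly_Mapping.single c (Suc c) + Poly_Mapping.single (Suc c) i" for i
  define B where "B i = Poly_Mapping.single i 1 + Poly_Mapping.single c i + Poly_Mapping.single (Suc c) c" for i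
  have eq: "le (A (Suc c)) (B (Suc c))"
    unfolding A_def B_def by (simp add: single_Suc[of _ c] leq_refl add_ac)
  have step: "lt (A (Suc i)) (B (Suc i))" if "le (A i) (B i)" "c < i" "i < d" for i
  proof -
    from leq_add_strict[OF that(1) convex[OF that(2,3)]]
    have "lt (A (Suc i) + Poly_Mapping.single i 1) (B (Suc i) + Poly_Mapping.single i 1)"
      by (simp add: A_def B_def single_Suc[of _ i] add_ac)
    then show ?thesis unfolding add_iff .
  qed
  have "le (A (Suc c + k)) (B (Suc c + k)) \<and> (k > 0 \<longrightarrow> lt (A (Suc c + k)) (B (Suc c + k)))"
    if "Suc c + k \<le> d" for k
    using that
  proof (induction k)
    case (Suc k)
    then have "lt (A (Suc c + Suc k)) (B (Suc c + Suc k))"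
      using step[of "Suc c + k"] by simp
    then show ?case using leq_total by blast
  qed (use eq in simp)
  from this[of "i - Suc c"] assms show ?thesis by (simp add: A_def B_def)
qed

end

text \<open>Only one pair of terms can contribute, since fixing \<open>a\<close> fixes
  \<open>b\<close> by cancellation. This serves both leading monomials and dominating
  weights.\<close>

lemma lookup_mult_unique:
  fixes f g :: "('v::cancel_comm_monoid_add \<Rightarrow>\<^sub>0 'k::semiring_0)"
  assumes "\<And>a b. lookup f a \<noteq> 0 \<Longrightarrow> lookup g b \<noteq> 0 \<Longrightarrow> a + b = m + n \<Longrightarrow> a = m"
  shows "lookup (f * g) (m + n) = lookup f m * lookup g n"
proof -
  have ab: "a = m \<and> b = n" if "lookup f a \<noteq> 0" "lookup g b \<noteq> 0" "a + b = m + n" for a b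
    using assms[OF that] that(3) by auto
  have "lookup (f * g) (m + n) =
      (\<Sum>a\<in>Poly_Mapping.keys f. \<Sum>b\<in>Poly_Mapping.keys g.
        (lookup f a * lookup g b) when a + b = m + n)"
    apply (subst poly_mapping_sum_single[of f])
    apply (subst poly_mapping_sum_single[of g])
    apply (simp add: sum_product mult_single lookup_sum lookup_single)
    done
  also have "\<dots> = (\<Sum>a\<in>Poly_Mapping.keys f. \<Sum>b\<in>Poly_Mapping.keys g.
        if a = m \<and> b = n then lookup f m * lookup g n else 0)"
    by (intro sum.cong refl) (auto simp: in_keys_iff when_def dest: ab)
  also have "\<dots> = (\<Sum>a\<in>Poly_Mapping.keys f. if a = m then
      (\<Sum>b\<in>Poly_Mapping.keys g. if b = n then lookup f m * lookup g n else 0) else 0)"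
    by (intro sum.cong) auto
  also have "\<dots> = lookup f m * lookup g n"
    by (simp add: in_keys_iff)
  finally show ?thesis .
qed

locale secant_blocks = diagonal_preorder +
  fixes r :: nat and \<beta> :: "nat \<Rightarrow> nat"
  assumes separated: "separated (Suc d) r \<beta>"
begin

text \<open>If the factors of \<open>x\<^sup>m\<close> with index in the \<open>j\<close>-th block \<open>{c, c + 1}\<close> are mapped to the \<open>j\<close>-th
  summand of the secant point, the exponents \<open>A\<close> of the weight and \<open>B\<close> of the node determine them:
  \<open>m\<^sub>c = (c + 1) A - B\<close> and \<open>m\<^sub>c\<^sub>+\<^sub>1 = B - c A\<close>. The positive and negative terms are collected in the
  upper and the lower weight; by convexity, other indices only make the difference smaller.\<close>

definition upper_block :: "nat \<Rightarrow> (nat \<Rightarrow>\<^sub>0 nat) \<Rightarrow> (nat \<Rightarrow>\<^sub>0 nat)" where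
  "upper_block j N = (if \<beta> j > d then 0 else case \<beta> j of
      0 \<Rightarrow> Poly_Mapping.single 0 (lookup N (3 * j))
    | Suc c \<Rightarrow> Poly_Mapping.single c (Suc c * lookup N (3 * j)) +
        Poly_Mapping.single (Suc c) (lookup N (3 * j + 1)))"

definition lower_block :: "nat \<Rightarrow> (nat \<Rightarrow>\<^sub>0 nat) \<Rightarrow> (nat \<Rightarrow>\<^sub>0 nat)" where
  "lower_block j N = (if \<beta> j > d then 0 else case \<beta> j of
      0 \<Rightarrow> Poly_Mapping.single 0 (lookup N (3 * j + 1))
    | Suc c \<Rightarrow> Poly_Mapping.single c (lookup N (3 * j + 1)) +
        Poly_Mapping.single (Suc c) (c * lookup N (3 * j)))"

text \<open>A variable of the moving direction counts as \<open>x\<^sub>i\<close> outside the blocks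
  and as \<open>1\<close> inside them, which is strictly below \<open>x\<^sub>i\<close>.\<close>

definition upper :: "(nat \<Rightarrow>\<^sub>0 nat) \<Rightarrow> (nat \<Rightarrow>\<^sub>0 nat)" where
  "upper N = (\<Sum>j<r. upper_block j N) +
    (\<Sum>i | i \<le> d \<and> \<not> covered (Suc d) r \<beta> i. Poly_Mapping.single i (lookup N (3 * i + 2)))"

definition lower :: "(nat \<Rightarrow>\<^sub>0 nat) \<Rightarrow> (nat \<Rightarrow>\<^sub>0 nat)" where
  "lower N = (\<Sum>j<r. lower_block j N)"

lemma upper_add: "upper (M + N) = upper M + upper N"
proof -
  have "upper_block j (M + N) = upper_block j M + upper_block j N" for j
    by (simp add: upper_block_def lookup_add Poly_Mapping.single_add algebra_simps split: nat.split)
  then show ?thesis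
    by (simp add: upper_def sum.distrib lookup_add Poly_Mapping.single_add add_ac)
qed

lemma lower_add: "lower (M + N) = lower M + lower N"
proof -
  have "lower_block j (M + N) = lower_block j M + lower_block j N" for j
    by (simp add: lower_block_def lookup_add Poly_Mapping.single_add algebra_simps split: nat.split)
  then show ?thesis
    by (simp add: lower_def sum.distrib)
qed

lemma upper_0 [simp]: "upper 0 = 0" and lower_0 [simp]: "lower 0 = 0"
  using upper_add[of 0 0] lower_add[of 0 0] by simp_all

text \<open>\<open>dominated g m k N\<close>: among the terms of \<open>g\<close>, the term with monomial \<open>N\<close> at \<open>t\<^sup>k\<close> is the unique
  one whose weight reaches \<open>m\<close>.\<close>

definition dominated :: "(nat, 'k::comm_ring_1) mpol poly \<Rightarrow> (nat \<Rightarrow>\<^sub>0 nat) \<Rightarrow> nat \<Rightarrow> (nat \<Rightarrow>\<^sub>0 nat) \<Rightarrow> bool" where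
  "dominated g m k N \<longleftrightarrow> lookup (coeff g k) N = 1 \<and> le (m + lower N) (upper N) \<and>
    (\<forall>k' N'. lookup (coeff g k') N' \<noteq> 0 \<longrightarrow>
      le (upper N') (m + lower N') \<and> (le (m + lower N') (upper N') \<longrightarrow> k' = k \<and> N' = N))"

lemma dominatedD:
  assumes "dominated g m k N"
  shows "lookup (coeff g k) N = 1" "le (m + lower N) (upper N)"
    "lookup (coeff g k') N' \<noteq> 0 \<Longrightarrow> le (upper N') (m + lower N')"
    "lookup (coeff g k') N' \<noteq> 0 \<Longrightarrow> le (m + lower N') (upper N') \<Longrightarrow> k' = k \<and> N' = N"
  using assms by (auto simp: dominated_def)

lemma dominated_1: "dominated 1 0 0 0"
  by (auto simp: dominated_def lookup_one coeff_pCons leq_refl when_def simp flip: one_pCons split: nat.splits if_splits)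

text \<open>Weights are additive, and a sum of two weak comparisons reaches equality only if both
  do. So only the product of the two distinguished terms reaches \<open>m + m'\<close>, and its
  coefficient gets no other contribution.\<close>

lemma dominated_mult:
  assumes "dominated g m k N" "dominated g' m' k' N'"
  shows "dominated (g * g') (m + m') (k + k') (N + N')"
proof -
  note g = dominatedD[OF assms(1)] and g' = dominatedD[OF assms(2)]
  have both: "le (upper (A + B)) (m + m' + lower (A + B))"
    "le (m + m' + lower (A + B)) (upper (A + B)) \<Longrightarrow> i = k \<and> A = N \<and> j = k' \<and> B = N'"
    if "lookup (coeff g i) A \<noteq> 0" "lookup (coeff g' j) B \<noteq> 0" for A B i j
  proof -
    note A = g(3)[OF that(1)] and B = g'(3)[OF that(2)]
    show "le (upper (A + B)) (m + m' + lower (A + B))"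
      using leq_add_mono[OF A B] by (simp add: upper_add lower_add add_ac)
    assume "le (m + m' + lower (A + B)) (upper (A + B))"
    then have le: "le ((m + lower A) + (m' + lower B)) (upper A + upper B)"
      by (simp add: upper_add lower_add add_ac)
    then have le': "le ((m' + lower B) + (m + lower A)) (upper B + upper A)"
      by (simp add: add_ac)
    have "le (m' + lower B) (upper B)"
      using leq_add_strict[OF A, where m' = "upper B" and n' = "m' + lower B"] le by blast
    moreover have "le (m + lower A) (upper A)"
      using leq_add_strict[OF B, where m' = "upper A" and n' = "m + lower A"] le' by blast
    ultimately show "i = k \<and> A = N \<and> j = k' \<and> B = N'"
      using g(4)[OF that(1)] g'(4)[OF that(2)] by blast
  qed
  have top: "le (m + m' + lower (N + N')) (upper (N + N'))"
    using leq_add_mono[OF g(2) g'(2)] by (simp add: upper_add lower_add add_ac)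
  have nz: "\<exists>A B. lookup f A \<noteq> 0 \<and> lookup h B \<noteq> 0 \<and> M = A + B"
    if "lookup (f * h) M \<noteq> 0" for f h :: "(nat, 'a) mpol" and M
  proof -
    from that have "M \<in> Poly_Mapping.keys (f * h)" by (simp add: in_keys_iff)
    then obtain A B where "A \<in> Poly_Mapping.keys f" "B \<in> Poly_Mapping.keys h" "M = A + B"
      using Poly_Mapping.keys_mult[of f h] by blast
    then show ?thesis by (auto simp: in_keys_iff)
  qed
  have ex: "\<exists>i A B. i \<le> q \<and> lookup (coeff g i) A \<noteq> 0 \<and> lookup (coeff g' (q - i)) B \<noteq> 0 \<and> M = A + B"
    if "lookup (coeff (g * g') q) M \<noteq> 0" for q M
  proof -
    from that obtain i where "i \<in> {..q}" "lookup (coeff g i * coeff g' (q - i)) M \<noteq> 0"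
      unfolding coeff_mult lookup_sum by (rule sum.not_neutral_contains_not_neutral)
    with nz[OF this(2)] show ?thesis by auto
  qed
  have "lookup (coeff (g * g') (k + k')) (N + N') =
      (\<Sum>i\<le>k + k'. lookup (coeff g i * coeff g' (k + k' - i)) (N + N'))"
    by (simp add: coeff_mult lookup_sum)
  \<comment> \<open>A pair of terms that splits the exponent of \<open>t\<close> differently would
    also reach \<open>m + m'\<close>, against \<open>both\<close>.\<close>
  also have "\<dots> = (\<Sum>i\<in>{k}. lookup (coeff g i * coeff g' (k + k' - i)) (N + N'))"
  proof (intro sum.mono_neutral_right ballI)
    fix i assume i: "i \<in> {..k + k'} - {k}"
    show "lookup (coeff g i * coeff g' (k + k' - i)) (N + N') = 0"
    proof (rule ccontr)
      assume "lookup (coeff g i * coeff g' (k + k' - i)) (N + N') \<noteq> 0"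
      from nz[OF this] obtain A B where AB: "lookup (coeff g i) A \<noteq> 0"
        "lookup (coeff g' (k + k' - i)) B \<noteq> 0" "N + N' = A + B" by blast
      from both(2)[OF AB(1,2)] AB(3) top i show False by auto
    qed
  qed auto
  also have "\<dots> = lookup (coeff g k * coeff g' k') (N + N')" by simp
  also have "\<dots> = lookup (coeff g k) N * lookup (coeff g' k') N'"
  proof (rule lookup_mult_unique)
    fix A B assume AB: "lookup (coeff g k) A \<noteq> 0"
        "lookup (coeff g' k') B \<noteq> 0" "A + B = N + N'"
    from both(2)[OF AB(1,2)] AB(3) top show "A = N" by simp
  qed
  finally have 1: "lookup (coeff (g * g') (k + k')) (N + N') = 1"
    using g(1) g'(1) by simp
  show ?thesis
    unfolding dominated_def
  proof (intro conjI allI impI)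
    fix q M assume "lookup (coeff (g * g') q) M \<noteq> 0"
    from ex[OF this] obtain i A B where *: "i \<le> q" "lookup (coeff g i) A \<noteq> 0"
      "lookup (coeff g' (q - i)) B \<noteq> 0" "M = A + B" by blast
    show "le (upper M) (m + m' + lower M)" using both(1)[OF *(2,3)] *(4) by simp
    assume "le (m + m' + lower M) (upper M)"
    with both(2)[OF *(2,3)] * show "q = k + k'" "M = N + N'" by auto
  qed (use 1 top in auto)
qed

lemma dominated_power:
  assumes "dominated g (Poly_Mapping.single i 1) k N"
  shows "\<exists>N. dominated (g ^ a) (Poly_Mapping.single i a) (a * k) N"
proof (induction a)
  case 0
  then show ?case using dominated_1 by auto
next
  case (Suc a)
  then obtain M where "dominated (g ^ a) (Poly_Mapping.single i a) (a * k) M" by blast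
  from dominated_mult[OF assms this] show ?case
    by (auto simp: add.commute simp flip: Poly_Mapping.single_add)
qed

lemma dominated_prod:
  assumes "finite A" "\<And>i. i \<in> A \<Longrightarrow> \<exists>N. dominated (g i) (m i) (k i) N"
  shows "\<exists>N. dominated (prod g A) (sum m A) (sum k A) N"
  using assms
proof (induction rule: finite_induct)
  case empty
  then show ?case using dominated_1 by auto
next
  case (insert i A)
  from insert.IH insert.prems obtain M N where "dominated (prod g A) (sum m A) (sum k A) M"
    "dominated (g i) (m i) (k i) N" by blast
  from dominated_mult[OF this(2,1)] insert show ?case by auto
qed

text \<open>The key estimate for a single variable: only the block containing \<open>i\<close>, or the moving direction
  if there is none, attains the weight of \<open>x\<^sub>i\<close>.\<close>

lemma block_weights:
  assumes "j < r" "i \<le> d"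
  defines "N \<equiv> Poly_Mapping.single (3 * j) 1 + Poly_Mapping.single (3 * j + 1) i"
  shows "le (upper N) (Poly_Mapping.single i 1 + lower N)"
    "le (Poly_Mapping.single i 1 + lower N) (upper N) \<longleftrightarrow> \<beta> j \<le> d \<and> (i = \<beta> j \<or> Suc i = \<beta> j)"
proof -
  \<comment> \<open>Weights, nodes and directions sit at the residues 0, 1 and 2 modulo 3, so only
    the weight and the node of summand \<open>j\<close> can occur in \<open>N\<close>.\<close>
  have lk: "lookup N (3 * l) = of_bool (l = j)" "lookup N (3 * l + 1) = (if l = j then i else 0)"
    "lookup N (3 * l + 2) = 0" for l
    unfolding N_def by (simp_all add: lookup_add lookup_single when_def) presburger+
  have lk': "lookup N (Suc (3 * l)) = (if l = j then i else 0)" for l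
    using lk(2)[of l] by simp
  have "upper N = upper_block j N + (\<Sum>l\<in>{..<r} - {j}. upper_block l N)"
    using assms(1) by (simp add: upper_def lk sum.remove[of "{..<r}" j] del: add_2_eq_Suc')
  also have "(\<Sum>l\<in>{..<r} - {j}. upper_block l N) = 0"
    by (rule sum.neutral) (auto simp: upper_block_def lk lk' split: nat.split)
  finally have up: "upper N = upper_block j N" by simp
  have "lower N = lower_block j N + (\<Sum>l\<in>{..<r} - {j}. lower_block l N)"
    using assms(1) by (simp add: lower_def sum.remove[of "{..<r}" j])
  also have "(\<Sum>l\<in>{..<r} - {j}. lower_block l N) = 0"
    by (rule sum.neutral) (auto simp: lower_block_def lk lk' split: nat.split)
  finally have lo: "lower N = lower_block j N" by simp
  have *: "le (upper N) (Poly_Mapping.single i 1 + lower N) \<and>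
    (le (Poly_Mapping.single i 1 + lower N) (upper N) \<longleftrightarrow> \<beta> j \<le> d \<and> (i = \<beta> j \<or> Suc i = \<beta> j))"
  proof (cases "\<beta> j > d")
    case True
    then show ?thesis
      using pos[OF assms(2)] leq_total by (auto simp: up lo upper_block_def lower_block_def)
  next
    case bj: False
    show ?thesis
    proof (cases "\<beta> j")
      case 0
      then have eq: "upper N = Poly_Mapping.single 0 1" "lower N = Poly_Mapping.single 0 i"
        by (simp_all add: up lo upper_block_def lower_block_def lk lk' del: One_nat_def)
      show ?thesis
      proof (cases i)
        case 0
        with eq show ?thesis using \<open>\<beta> j = 0\<close> leq_refl by simp
      next
        case (Suc q)
        \<comment> \<open>A factor \<open>x\<^sub>0\<close> is common to both sides; what remains is
          that \<open>1\<close> lies strictly below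
          \<open>x\<^sub>0 ^ q * x\<^sub>i\<close>.\<close>
        have "lt (0 + Poly_Mapping.single 0 1) (Poly_Mapping.single 0 q + Poly_Mapping.single i 1 + Poly_Mapping.single 0 1)"
        proof -
          have "le 0 (Poly_Mapping.single 0 q)"
          proof (induction q)
            case (Suc q)
            have "le 0 (Poly_Mapping.single 0 1)" using pos[of 0] leq_total by blast
            from leq_add_mono[OF Suc this] show ?case by (simp add: single_Suc[of _ q])
          qed (simp add: leq_refl)
          from leq_add_strict[OF this pos[OF assms(2)]]
          have "lt 0 (Poly_Mapping.single 0 q + Poly_Mapping.single i 1)" by simp
          then show ?thesis unfolding add_iff .
        qed
        then have "lt (upper N) (Poly_Mapping.single i 1 + lower N)"
          unfolding eq Suc single_Suc[of 0 q] by (simp add: add_ac)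
        then show ?thesis using 0 Suc leq_total by auto
      qed
    next
      case (Suc c)
      with bj have c: "Suc c \<le> d" by simp
      have eq: "upper N = Poly_Mapping.single c (Suc c) + Poly_Mapping.single (Suc c) i"
        "lower N = Poly_Mapping.single c i + Poly_Mapping.single (Suc c) c"
        using Suc bj lk[of j] lk'[of j] by (simp_all add: up lo upper_block_def lower_block_def)
      consider "i < c" | "i = c" | "i = Suc c" | "Suc c < i" by linarith
      then show ?thesis
      proof cases
        case 1
        then have "lt (upper N) (Poly_Mapping.single i 1 + lower N)"
          using convex_lower[OF c] by (simp add: eq add_ac)
        then show ?thesis using 1 Suc leq_total by auto
      next
        case 2
        then have "upper N = Poly_Mapping.single i 1 + lower N"
          by (simp add: eq single_Suc[of _ c] add_ac)
        then show ?thesis using 2 Suc bj leq_refl by auto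
      next
        case 3
        then have "upper N = Poly_Mapping.single i 1 + lower N"
          by (simp add: eq single_Suc[of "Suc c" c] add_ac)
        then show ?thesis using 3 Suc bj leq_refl by auto
      next
        case 4
        then have "lt (upper N) (Poly_Mapping.single i 1 + lower N)"
          using convex_upper[OF 4 assms(2)] by (simp add: eq add_ac)
        then show ?thesis using 4 Suc leq_total by auto
      qed
    qed
  qed
  then show "le (upper N) (Poly_Mapping.single i 1 + lower N)"
    "le (Poly_Mapping.single i 1 + lower N) (upper N) \<longleftrightarrow> \<beta> j \<le> d \<and> (i = \<beta> j \<or> Suc i = \<beta> j)"
    by blast+
qed

end

section \<open>Terms of the secant point\<close>

lemma pvar_power: "pvar v ^ n = (Poly_Mapping.single (Poly_Mapping.single v n) 1 :: ('v, 'k::comm_ring_1) mpol)"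
  by (induction n) (simp_all add: pvar_def mult_single flip: Poly_Mapping.single_add)

abbreviation curve_key :: "nat \<Rightarrow> nat \<Rightarrow> (nat \<Rightarrow>\<^sub>0 nat)" where
  "curve_key j i \<equiv> Poly_Mapping.single (3 * j) 1 + Poly_Mapping.single (3 * j + 1) i"

lemma curve_key_eq_iff: "curve_key j i = curve_key j' i \<longleftrightarrow> j = j'"
proof
  assume "curve_key j i = curve_key j' i"
  then have "lookup (curve_key j i) (3 * j) = lookup (curve_key j' i) (3 * j)" by simp
  then show "j = j'" by (simp add: lookup_add lookup_single when_def split: if_splits)
qed simp

lemma lookup_secant_point:
  "lookup (secant_point r i :: (nat, 'k::comm_ring_1) mpol) N = (\<Sum>j<r. 1 when curve_key j i = N)"
  unfolding secant_point_def pvar_power unfolding pvar_def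
  by (simp add: mult_single lookup_sum lookup_single)

lemma lookup_secant_point_curve_key:
  assumes "j < r"
  shows "lookup (secant_point r i :: (nat, 'k::comm_ring_1) mpol) (curve_key j i) = 1"
  unfolding lookup_secant_point curve_key_eq_iff using assms by (simp add: when_def)

lemma lookup_secant_point_nonzero:
  "lookup (secant_point r i) N \<noteq> 0 \<Longrightarrow> \<exists>j<r. N = curve_key j i"
  unfolding lookup_secant_point by (erule sum.not_neutral_contains_not_neutral) (auto simp: when_def simp del: One_nat_def split: if_splits)

context secant_blocks
begin

lemma direct_weights:
  assumes "i \<le> d"
  shows "upper (Poly_Mapping.single (3 * i + 2) 1) = (if covered (Suc d) r \<beta> i then 0 else Poly_Mapping.single i 1)"
    "lower (Poly_Mapping.single (3 * i + 2) 1) = 0"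
proof -
  let ?N = "Poly_Mapping.single (3 * i + 2) 1 :: nat \<Rightarrow>\<^sub>0 nat"
  have lk: "lookup ?N (3 * l) = 0" "lookup ?N (3 * l + 1) = 0"
    "lookup ?N (3 * l + 2) = of_bool (l = i)" for l
    unfolding lookup_single when_def of_bool_def by presburger+
  have "upper_block j ?N = 0" "lower_block j ?N = 0" for j
    unfolding upper_block_def lower_block_def lk by (auto split: nat.split)
  then show "lower ?N = 0" "upper ?N = (if covered (Suc d) r \<beta> i then 0 else Poly_Mapping.single i 1)"
    unfolding upper_def lower_def lk using assms
    by (auto simp: of_bool_def if_distrib[of "Poly_Mapping.single _"] sum.If_cases simp del: One_nat_def intro!: sum.neutral)
qed

text \<open>For a covered index the distinguished term is the summand of its block, at time exponent
  0; otherwise it is the moving direction, at exponent 1. Uniqueness comes from the separation of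
  the blocks.\<close>

lemma dominated_variable:
  assumes i: "i \<le> d"
  shows "\<exists>N. dominated [:secant_point r i, pvar (3 * i + 2):] (Poly_Mapping.single i 1)
    (of_bool (\<not> covered (Suc d) r \<beta> i)) N"
proof -
  let ?g = "[:secant_point r i, pvar (3 * i + 2):] :: (nat, 'a::comm_ring_1) mpol poly"
  let ?D = "Poly_Mapping.single (3 * i + 2) 1"
  have cases: "(k = 0 \<and> (\<exists>j<r. N = curve_key j i)) \<or> (k = 1 \<and> N = ?D)"
    if "lookup (coeff ?g k) N \<noteq> 0" for k N
    using that lookup_secant_point_nonzero[of r i N]
    by (auto simp: coeff_pCons pvar_def lookup_single when_def split: nat.splits if_splits)
  have le0: "le 0 (Poly_Mapping.single i 1)" using pos[OF i] leq_total by blast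
  have le: "le (upper N) (Poly_Mapping.single i 1 + lower N)"
    if "lookup (coeff ?g k) N \<noteq> 0" for k N
    using cases[OF that] block_weights(1)[OF _ i] direct_weights[OF i] leq_refl le0
    by (auto simp del: One_nat_def)
  show ?thesis
  proof (cases "covered (Suc d) r \<beta> i")
    case True
    then obtain j where j: "j < r" "\<beta> j \<le> d" "i = \<beta> j \<or> Suc i = \<beta> j"
      by (auto simp: covered_def)
    have "dominated ?g (Poly_Mapping.single i 1) 0 (curve_key j i)"
      unfolding dominated_def
    proof (intro conjI allI impI)
      fix k N assume N: "lookup (coeff ?g k) N \<noteq> 0"
      show "le (upper N) (Poly_Mapping.single i 1 + lower N)" by (rule le[OF N])
      assume top: "le (Poly_Mapping.single i 1 + lower N) (upper N)"
      have "k = 0 \<and> N = curve_key j i"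
        using cases[OF N]
      proof (elim disjE conjE exE)
        fix l assume l: "k = 0" "l < r" "N = curve_key l i"
        with top block_weights(2)[OF l(2) i] have "\<beta> l \<le> d" "i = \<beta> l \<or> Suc i = \<beta> l" by auto
        \<comment> \<open>Two used blocks that both contain \<open>i\<close> would have upper ends
          at distance at most 1.\<close>
        with j l(2) separated have "l = j" unfolding separated_def by fastforce
        with l show ?thesis by simp
      next
        assume "N = ?D"
        with top direct_weights[OF i] True pos[OF i] show ?thesis by (simp del: One_nat_def)
      qed
      then show "k = 0" "N = curve_key j i" by blast+
    qed (use lookup_secant_point_curve_key[OF j(1), of i] block_weights(2)[OF j(1) i] j in auto)
    then show ?thesis using True by auto
  next
    case False
    have "dominated ?g (Poly_Mapping.single i 1) 1 ?D"
      unfolding dominated_def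
    proof (intro conjI allI impI)
      fix k N assume N: "lookup (coeff ?g k) N \<noteq> 0"
      show "le (upper N) (Poly_Mapping.single i 1 + lower N)" by (rule le[OF N])
      assume top: "le (Poly_Mapping.single i 1 + lower N) (upper N)"
      have "k = 1 \<and> N = ?D"
        using cases[OF N]
      proof (elim disjE conjE exE)
        fix l assume l: "k = 0" "l < r" "N = curve_key l i"
        with top block_weights(2)[OF l(2) i] have "\<beta> l \<le> d" "i = \<beta> l \<or> Suc i = \<beta> l" by auto
        with l(2) False show ?thesis by (auto simp: covered_def)
      qed simp
      then show "k = 1" "N = ?D" by blast+
    qed (use direct_weights[OF i] False leq_refl in \<open>auto simp: pvar_def\<close>)
    then show ?thesis using False by auto
  qed
qed

text \<open>Multiplying the estimates for the variables, the time exponent counts the factors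
  outside the blocks.\<close>

lemma dominated_monomial:
  assumes "m \<in> monomials {..d}"
  shows "\<exists>N. dominated (monom_eval (\<lambda>i. [:secant_point r i, pvar (3 * i + 2):]) m) m
    (\<Sum>i | i \<le> d \<and> \<not> covered (Suc d) r \<beta> i. lookup m i) N"
proof -
  let ?g = "\<lambda>i. [:secant_point r i, pvar (3 * i + 2):] :: (nat, 'a) mpol poly"
  have "\<exists>N. dominated (\<Prod>i\<in>{..d}. ?g i ^ lookup m i)
      (\<Sum>i\<in>{..d}. Poly_Mapping.single i (lookup m i))
      (\<Sum>i\<in>{..d}. lookup m i * of_bool (\<not> covered (Suc d) r \<beta> i)) N"
    by (rule dominated_prod) (use dominated_variable dominated_power in \<open>fastforce simp del: One_nat_def\<close>)+
  moreover have keys: "Poly_Mapping.keys m \<subseteq> {..d}" using assms by (simp add: monomials_def)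
  then have "(\<Sum>i\<in>{..d}. Poly_Mapping.single i (lookup m i)) = m"
    by (subst (2) poly_mapping_sum_single, intro sum.mono_neutral_right) (auto simp: in_keys_iff)
  moreover have "(\<Sum>i\<in>{..d}. lookup m i * of_bool (\<not> covered (Suc d) r \<beta> i)) =
      (\<Sum>i | i \<le> d \<and> \<not> covered (Suc d) r \<beta> i. lookup m i)"
    by (rule sum.mono_neutral_cong_right) auto
  ultimately show ?thesis
    using keys by (simp add: monom_eval_superset[of "{..d}"])
qed

text \<open>No monomial of \<open>f\<close> other than \<open>m\<close> reaches the distinguished
  term of \<open>m\<close>, so its coefficient in the evaluation is that of \<open>m\<close> in
  \<open>f\<close> and does not vanish. Divisibility by the \<open>s\<close>-th power of time then
  bounds its time exponent from below.\<close>

theorem degree_outside_blocks: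
  fixes f :: "(nat, 'k::comm_ring_1) mpol"
  assumes f: "f \<in> carrier (poly_ring d)" and m: "m \<in> Poly_Mapping.keys f"
    and max: "\<And>n. n \<in> Poly_Mapping.keys f \<Longrightarrow> le m n \<Longrightarrow> n = m"
    and dvd: "[:0, 1:] ^ s dvd perturb_eval r f"
  shows "s \<le> (\<Sum>i | i \<le> d \<and> \<not> covered (Suc d) r \<beta> i. lookup m i)" (is "_ \<le> ?k m")
proof -
  let ?E = "monom_eval (\<lambda>i. [:secant_point r i, pvar (3 * i + 2):]) :: _ \<Rightarrow> (nat, 'k) mpol poly"
  have mon: "n \<in> monomials {..d}" if "n \<in> Poly_Mapping.keys f" for n
    using f that by (auto simp: mem_mpol_ring)
  from dominated_monomial[OF mon[OF m]] obtain N where N: "dominated (?E m) m (?k m) N" by blast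
  have "lookup (coeff (perturb_eval r f) (?k m)) N =
      (\<Sum>n\<in>Poly_Mapping.keys f. lookup f n * lookup (coeff (?E n) (?k m)) N)"
    by (simp add: perturb_eval_def mpol_eval_def coeff_sum lookup_sum flip: mult_map_scale_conv_mult)
      (auto simp: Poly_Mapping.map.rep_eq when_def intro: sum.cong)
  also have "\<dots> = (\<Sum>n\<in>Poly_Mapping.keys f. if n = m then lookup f m else 0)"
  proof (intro sum.cong refl)
    fix n assume n: "n \<in> Poly_Mapping.keys f"
    show "lookup f n * lookup (coeff (?E n) (?k m)) N = (if n = m then lookup f m else 0)"
    proof (cases "lookup (coeff (?E n) (?k m)) N = 0")
      case True
      then show ?thesis using dominatedD(1)[OF N] by auto
    next
      case False
      from dominated_monomial[OF mon[OF n]] obtain M where M: "dominated (?E n) n (?k n) M" by blast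
      \<comment> \<open>The weight \<open>upper N\<close> lies in between: it reaches
        \<open>m\<close> by domination for \<open>m\<close> and does not exceed \<open>n\<close> by
        domination for \<open>n\<close>.\<close>
      have "le (m + lower N) (n + lower N)"
        using leq_trans[OF dominatedD(2)[OF N] dominatedD(3)[OF M False]] .
      then have "n = m" using max[OF n] by (simp add: add_iff)
      then show ?thesis using dominatedD(1)[OF N] by simp
    qed
  qed
  also have "\<dots> \<noteq> 0" using m by (simp add: in_keys_iff)
  finally have nz: "coeff (perturb_eval r f) (?k m) \<noteq> 0" by auto
  from dvd obtain q where "perturb_eval r f = [:0, 1:] ^ s * q" by (auto simp: dvd_def)
  then have "perturb_eval r f = monom 1 s * q" by (simp add: monom_altdef)
  with nz show ?thesis by (auto simp: coeff_monom_mult not_less[symmetric])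
qed

end

section \<open>Term orders\<close>

definition restrict_monom :: "nat \<Rightarrow> (nat \<Rightarrow>\<^sub>0 nat) \<Rightarrow> (nat \<Rightarrow>\<^sub>0 nat)" where
  "restrict_monom d m = (\<Sum>i\<le>d. Poly_Mapping.single i (lookup m i))"

lemma restrict_monom_add: "restrict_monom d (m + n) = restrict_monom d m + restrict_monom d n"
  by (simp add: restrict_monom_def lookup_add Poly_Mapping.single_add sum.distrib)

lemma restrict_monom_mem: "restrict_monom d m \<in> monomials {..d}"
  unfolding restrict_monom_def by (intro sum_monomials) simp

lemma restrict_monom_id: "m \<in> monomials {..d} \<Longrightarrow> restrict_monom d m = m"
  unfolding restrict_monom_def
  by (subst (2) poly_mapping_sum_single, intro sum.mono_neutral_right) (auto simp: in_keys_iff monomials_def)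

text \<open>The relational form of \<open>leading_monomial\<close>: it works with exponent vectors
  and asserts existence, which the definite description there does not.\<close>

definition is_leading :: "(nat \<Rightarrow>\<^sub>0 nat) rel \<Rightarrow> (nat, 'k::comm_ring_1) mpol \<Rightarrow> (nat \<Rightarrow>\<^sub>0 nat) \<Rightarrow> bool" where
  "is_leading ord f m \<longleftrightarrow> m \<in> Poly_Mapping.keys f \<and> (\<forall>n\<in>Poly_Mapping.keys f. (n, m) \<in> ord)"

lemma monom_poly_inj: "monom_poly m = (monom_poly n :: ('v, 'k::comm_ring_1) mpol) \<Longrightarrow> m = n"
proof -
  assume "monom_poly m = (monom_poly n :: ('v, 'k) mpol)"
  then have "Poly_Mapping.keys (monom_poly m :: ('v, 'k) mpol) = Poly_Mapping.keys (monom_poly n :: ('v, 'k) mpol)" by simp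
  then show ?thesis by (simp add: monom_poly_def)
qed

lemma monom_poly_add: "monom_poly (m + n) = (monom_poly m * monom_poly n :: ('v, 'k::comm_ring_1) mpol)"
  by (simp add: monom_poly_def mult_single)

lemma prod_pvar: "(\<Prod>i\<in>A. pvar (g i)) = (monom_poly (\<Sum>i\<in>A. Poly_Mapping.single (g i) 1) :: ('v, 'k::comm_ring_1) mpol)"
proof (induction A rule: infinite_finite_induct)
  case (insert x A)
  then show ?case by (simp add: monom_poly_add) (simp add: monom_poly_def pvar_def)
qed (simp_all add: monom_poly_def)

context
  fixes d :: nat and ord
  assumes ord: "term_order d ord"
begin

lemma term_order_facts:
  shows ord_total: "m \<in> monomials {..d} \<Longrightarrow> n \<in> monomials {..d} \<Longrightarrow> (m, n) \<in> ord \<or> (n, m) \<in> ord"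
    and ord_trans: "(m, n) \<in> ord \<Longrightarrow> (n, k) \<in> ord \<Longrightarrow> (m, k) \<in> ord"
    and ord_antisym: "(m, n) \<in> ord \<Longrightarrow> (n, m) \<in> ord \<Longrightarrow> m = n"
    and ord_add: "(m, n) \<in> ord \<Longrightarrow> k \<in> monomials {..d} \<Longrightarrow> (m + k, n + k) \<in> ord"
    and ord_zero: "m \<in> monomials {..d} \<Longrightarrow> (0, m) \<in> ord"
proof -
  have lin: "linear_order_on (monomials {..d}) ord"
    and z: "\<forall>m\<in>monomials {..d}. (0, m) \<in> ord"
    and a: "\<forall>m n. (m, n) \<in> ord \<longrightarrow> (\<forall>k\<in>monomials {..d}. (m + k, n + k) \<in> ord)"
    using ord by (auto simp: term_order_def)
  from lin have t: "total_on (monomials {..d}) ord" "trans ord" "antisym ord" "refl_on (monomials {..d}) ord"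
    by (auto simp: linear_order_on_def partial_order_on_def preorder_on_def)
  show "m \<in> monomials {..d} \<Longrightarrow> n \<in> monomials {..d} \<Longrightarrow> (m, n) \<in> ord \<or> (n, m) \<in> ord"
    using t(1,4) by (metis refl_onD total_on_def)
  show "(m, n) \<in> ord \<Longrightarrow> (n, k) \<in> ord \<Longrightarrow> (m, k) \<in> ord" using t(2) by (blast dest: transD)
  show "(m, n) \<in> ord \<Longrightarrow> (n, m) \<in> ord \<Longrightarrow> m = n" using t(3) by (blast dest: antisymD)
  show "(m, n) \<in> ord \<Longrightarrow> k \<in> monomials {..d} \<Longrightarrow> (m + k, n + k) \<in> ord" using a by blast
  show "m \<in> monomials {..d} \<Longrightarrow> (0, m) \<in> ord" using z by blast
qed

lemma ord_add_iff:
  assumes "m \<in> monomials {..d}" "n \<in> monomials {..d}" "k \<in> monomials {..d}"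
  shows "(m + k, n + k) \<in> ord \<longleftrightarrow> (m, n) \<in> ord"
proof
  assume *: "(m + k, n + k) \<in> ord"
  show "(m, n) \<in> ord"
  proof (rule ccontr)
    assume "(m, n) \<notin> ord"
    then have nm: "(n, m) \<in> ord" using ord_total assms by blast
    from ord_antisym[OF * ord_add[OF nm assms(3)]] have "m = n" by simp
    with nm \<open>(m, n) \<notin> ord\<close> show False by simp
  qed
qed (rule ord_add[OF _ assms(3)])

lemma ex_is_leading:
  assumes "f \<in> carrier (poly_ring d)" "f \<noteq> 0"
  shows "\<exists>m. is_leading ord f m"
proof -
  have "\<exists>m\<in>A. \<forall>n\<in>A. (n, m) \<in> ord" if "finite A" "A \<noteq> {}" "A \<subseteq> monomials {..d}" for A
    using that
  proof (induction rule: finite_ne_induct)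
    case (singleton x)
    then show ?case using ord_total by auto
  next
    case (insert x A)
    then obtain m where m: "m \<in> A" "\<forall>n\<in>A. (n, m) \<in> ord" by auto
    from insert.prems m(1) have "(x, m) \<in> ord \<or> (m, x) \<in> ord" "(x, x) \<in> ord" using ord_total[of x] by auto
    then show ?case using m ord_trans by blast
  qed
  from this[of "Poly_Mapping.keys f"] show ?thesis
    using assms by (auto simp: is_leading_def mem_mpol_ring keys_eq_empty)
qed

lemma leading_monomial_eq: "is_leading ord f m \<Longrightarrow> leading_monomial ord f = monom_poly m"
  unfolding leading_monomial_def is_leading_def
  by (intro arg_cong[of _ _ monom_poly] the_equality) (use ord_antisym in blast)+

text \<open>Some leading exponent exists since \<open>f\<close> is nonzero; injectivity of
  \<open>monom_poly\<close> identifies it. This makes the equations in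
  \<open>diagonal_term_order\<close> usable.\<close>

lemma is_leadingI:
  assumes "f \<in> carrier (poly_ring d)" "f \<noteq> 0" "leading_monomial ord f = monom_poly m"
  shows "is_leading ord (f :: (nat, 'k::comm_ring_1) mpol) m"
  using ex_is_leading[OF assms(1,2)] leading_monomial_eq[of f] assms(3) monom_poly_inj by metis

lemma is_leading_mult:
  fixes f g :: "(nat, 'k::idom) mpol"
  assumes "f \<in> carrier (poly_ring d)" "g \<in> carrier (poly_ring d)" "is_leading ord f m" "is_leading ord g n"
  shows "is_leading ord (f * g) (m + n)"
proof -
  have mon: "a \<in> monomials {..d}" if "a \<in> Poly_Mapping.keys f \<union> Poly_Mapping.keys g" for a
    using assms(1,2) that by (auto simp: mem_mpol_ring)
  have m: "m \<in> Poly_Mapping.keys f" "n \<in> Poly_Mapping.keys g"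
    and top: "\<And>a. a \<in> Poly_Mapping.keys f \<Longrightarrow> (a, m) \<in> ord" "\<And>b. b \<in> Poly_Mapping.keys g \<Longrightarrow> (b, n) \<in> ord"
    using assms(3,4) by (auto simp: is_leading_def)
  have le: "(a + b, m + b) \<in> ord" "(m + b, m + n) \<in> ord"
    if "a \<in> Poly_Mapping.keys f" "b \<in> Poly_Mapping.keys g" for a b
    using ord_add[OF top(1)[OF that(1)] mon[of b]] ord_add[OF top(2)[OF that(2)] mon[of m]] that m
    by (auto simp: add.commute)
  have "lookup (f * g) (m + n) = lookup f m * lookup g n"
  proof (rule lookup_mult_unique)
    fix a b assume ab: "lookup f a \<noteq> 0" "lookup g b \<noteq> 0" "a + b = m + n"
    then have k: "a \<in> Poly_Mapping.keys f" "b \<in> Poly_Mapping.keys g" by (auto simp: in_keys_iff)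
    from le[OF k] ab(3) have "m + b = m + n" using ord_antisym by metis
    with ab(3) show "a = m" by simp
  qed
  then have "m + n \<in> Poly_Mapping.keys (f * g)" using m by (simp add: in_keys_iff)
  moreover have "(k, m + n) \<in> ord" if "k \<in> Poly_Mapping.keys (f * g)" for k
    using that Poly_Mapping.keys_mult[of f g] le ord_trans by blast
  ultimately show ?thesis by (simp add: is_leading_def)
qed

text \<open>Antisymmetry turns weak comparisons into strict ones: a variable differs from
  \<open>1\<close>, and \<open>x\<^sub>c\<close> divides only one of the two products in the
  convexity condition.\<close>

lemma diagonal_preorder_of_order:
  assumes conv: "\<And>c i. c < i \<Longrightarrow> i < d \<Longrightarrow>
    (Poly_Mapping.single i 1 + Poly_Mapping.single (Suc c) 1, Poly_Mapping.single c 1 + Poly_Mapping.single (Suc i) 1) \<in> ord"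
  shows "diagonal_preorder d (\<lambda>m n. (restrict_monom d m, restrict_monom d n) \<in> ord)"
proof
  fix m n k :: "nat \<Rightarrow>\<^sub>0 nat"
  note mem = restrict_monom_mem
  show "(restrict_monom d m, restrict_monom d n) \<in> ord \<or> (restrict_monom d n, restrict_monom d m) \<in> ord"
    using ord_total[OF mem mem] .
  show "(restrict_monom d m, restrict_monom d n) \<in> ord \<Longrightarrow> (restrict_monom d n, restrict_monom d k) \<in> ord
    \<Longrightarrow> (restrict_monom d m, restrict_monom d k) \<in> ord" by (rule ord_trans)
  show "((restrict_monom d (m + k), restrict_monom d (n + k)) \<in> ord) = ((restrict_monom d m, restrict_monom d n) \<in> ord)"
    unfolding restrict_monom_add by (rule ord_add_iff[OF mem mem mem])
next
  fix i assume "i \<le> d"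
  then have s: "Poly_Mapping.single i 1 \<in> monomials {..d}" by simp
  have "Poly_Mapping.single i (1 :: nat) \<noteq> 0" by (metis lookup_single_eq lookup_zero one_neq_zero)
  then have "(Poly_Mapping.single i 1, 0) \<notin> ord" using ord_zero[OF s] ord_antisym by blast
  then show "(restrict_monom d (Poly_Mapping.single i 1), restrict_monom d 0) \<notin> ord"
    using restrict_monom_id[OF s] restrict_monom_id[of 0 d] by simp
next
  fix c i assume ci: "c < i" "i < d"
  let ?a = "Poly_Mapping.single c 1 + Poly_Mapping.single (Suc i) 1 :: nat \<Rightarrow>\<^sub>0 nat"
  let ?b = "Poly_Mapping.single i 1 + Poly_Mapping.single (Suc c) 1 :: nat \<Rightarrow>\<^sub>0 nat"
  have mem: "?a \<in> monomials {..d}" "?b \<in> monomials {..d}"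
    using ci by (auto intro!: add_monomials single_monomials)
  have "lookup ?a c \<noteq> lookup ?b c"
    using ci by (simp add: lookup_add lookup_single when_def)
  then have "?a \<noteq> ?b" by metis
  then have "(?a, ?b) \<notin> ord" using conv[OF ci] ord_antisym by blast
  then show "(restrict_monom d ?a, restrict_monom d ?b) \<notin> ord"
    unfolding restrict_monom_id[OF mem(1)] restrict_monom_id[OF mem(2)] .
qed

end

section \<open>Hankel minors\<close>

text \<open>Rows are always the first \<open>t\<close>; only the columns vary. Maximal minors with
  other row sets are brought to this form by transposition.\<close>

definition hankel_minor :: "nat \<Rightarrow> (nat \<Rightarrow> nat) \<Rightarrow> (nat, 'k::comm_ring_1) mpol" where
  "hankel_minor t c = det (mat t t (\<lambda>(a, b). pvar (a + c b)))"

definition diag_monom :: "nat \<Rightarrow> (nat \<Rightarrow> nat) \<Rightarrow> (nat \<Rightarrow>\<^sub>0 nat)" where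
  "diag_monom t c = (\<Sum>a<t. Poly_Mapping.single (a + c a) 1)"

lemma lookup_diag_monom: "lookup (diag_monom t c) k = (\<Sum>a<t. of_bool (a + c a = k))"
  by (simp add: diag_monom_def lookup_sum lookup_single when_def of_bool_def del: One_nat_def)

definition perm_monom :: "nat \<Rightarrow> (nat \<Rightarrow> nat) \<Rightarrow> (nat \<Rightarrow> nat) \<Rightarrow> (nat \<Rightarrow>\<^sub>0 nat)" where
  "perm_monom t c p = (\<Sum>a<t. Poly_Mapping.single (a + c (p a)) 1)"

text \<open>The order on exponent vectors is decided by the smallest index at which they differ. Let
  \<open>i\<close> be the first row moved by \<open>p\<close>: earlier rows agree, and from row
  \<open>i\<close> on all indices chosen by \<open>p\<close> exceed \<open>i + c i\<close>, which
  the diagonal attains.\<close>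

lemma perm_monom_less:
  assumes c: "strict_mono_on {..<t} c" and p: "p permutes {0..<t}" "p \<noteq> id"
  shows "perm_monom t c p < diag_monom t c"
proof -
  define i where "i = (LEAST a. p a \<noteq> a)"
  from p(2) have ex: "\<exists>a. p a \<noteq> a" by (auto simp: fun_eq_iff)
  have i: "p i \<noteq> i" unfolding i_def by (rule LeastI_ex[OF ex])
  have below: "p a = a" if "a < i" for a using not_less_Least[of a] that unfolding i_def by blast
  have it: "i < t" using i p(1) by (metis atLeastLessThan_iff le0 permutes_not_in)
  have above: "p a \<ge> i" if "a \<ge> i" for a
    using below[of "p a"] p(1) that by (metis not_less permutes_inj injD)
  have pt: "p a < t" if "a < t" for a using permutes_in_image[OF p(1), of a] that by simp
  have mono: "c i \<le> c b" if "i \<le> b" "b < t" for b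
    using strict_mono_on_leD[OF c, of i b] that it by simp
  have big: "i + c i < a + c (p a)" if "i \<le> a" "a < t" for a
  proof (cases "a = i")
    case True
    then have "i < p i" using above[of i] i by simp
    then have "c i < c (p i)" using strict_mono_onD[OF c, of i "p i"] it pt by simp
    with True show ?thesis by simp
  next
    case False
    with that mono[OF above[OF that(1)] pt[OF that(2)]] show ?thesis by simp
  qed
  let ?k = "i + c i"
  have lk: "lookup (perm_monom t c p) k = (\<Sum>a<t. of_bool (a + c (p a) = k))" for k
    by (simp add: perm_monom_def lookup_sum lookup_single when_def of_bool_def del: One_nat_def)
  have "lookup (perm_monom t c p) ?k < lookup (diag_monom t c) ?k"
    unfolding lk lookup_diag_monom
  proof (rule sum_strict_mono_ex1)
    show "\<forall>a\<in>{..<t}. of_bool (a + c (p a) = ?k) \<le> (of_bool (a + c a = ?k) :: nat)"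
    proof
      fix a assume "a \<in> {..<t}"
      then show "of_bool (a + c (p a) = ?k) \<le> (of_bool (a + c a = ?k) :: nat)"
        using below[of a] big[of a] by (cases "a < i") auto
    qed
    show "\<exists>a\<in>{..<t}. of_bool (a + c (p a) = ?k) < (of_bool (a + c a = ?k) :: nat)"
      using it big[of i] by (intro bexI[of _ i]) auto
  qed simp
  moreover have "lookup (perm_monom t c p) k = lookup (diag_monom t c) k" if "k < ?k" for k
    unfolding lk lookup_diag_monom
  proof (rule sum.cong)
    fix a assume "a \<in> {..<t}"
    then show "of_bool (a + c (p a) = k) = (of_bool (a + c a = k) :: nat)"
      using below[of a] big[of a] mono[of a] that by (cases "a < i") auto
  qed simp
  ultimately have "less_fun (lookup (perm_monom t c p)) (lookup (diag_monom t c))"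
    unfolding less_fun_def by blast
  then show ?thesis by (simp add: less_poly_mapping.rep_eq)
qed

lemma lookup_hankel_minor:
  "lookup (hankel_minor t c :: (nat, 'k::comm_ring_1) mpol) N =
    (\<Sum>p | p permutes {0..<t}. signof p * (1 when perm_monom t c p = N))"
proof -
  have "hankel_minor t c = (\<Sum>p | p permutes {0..<t}. signof p * (\<Prod>a = 0..<t. pvar (a + c (p a)) :: (nat, 'k) mpol))"
    unfolding hankel_minor_def
  proof (subst det_def'[of _ t], simp, intro sum.cong refl arg_cong2[of _ _ _ _ "(*)"] prod.cong)
    fix p a assume "p \<in> {p. p permutes {0..<t}}" "a \<in> {0..<t}"
    then show "mat t t (\<lambda>(a, b). pvar (a + c b)) $$ (a, p a) = pvar (a + c (p a))"
      using permutes_in_image[of p "{0..<t}" a] by simp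
  qed
  moreover have "signof p * (\<Prod>a = 0..<t. pvar (a + c (p a)) :: (nat, 'k) mpol) = Poly_Mapping.single (perm_monom t c p) (signof p)" for p
    unfolding prod_pvar monom_poly_def perm_monom_def atLeast0LessThan
    by (auto simp: sign_def Poly_Mapping.single_uminus)
  ultimately show ?thesis
    by (simp add: lookup_sum lookup_single mult_when)
qed

lemma hankel_minor_keys:
  "n \<in> Poly_Mapping.keys (hankel_minor t c) \<Longrightarrow> \<exists>p. p permutes {0..<t} \<and> n = perm_monom t c p"
  unfolding in_keys_iff lookup_hankel_minor
  by (erule sum.not_neutral_contains_not_neutral) (auto simp: when_def split: if_splits)

lemma perm_monom_id: "perm_monom t c id = diag_monom t c"
  by (simp add: perm_monom_def diag_monom_def)

text \<open>Different permutations may share a monomial, but only the identity gives the diagonal,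
  so nothing can cancel it.\<close>

lemma hankel_minor_leading:
  assumes c: "strict_mono_on {..<t} c"
  shows "lookup (hankel_minor t c :: (nat, 'k::comm_ring_1) mpol) (diag_monom t c) = 1"
    and "n \<in> Poly_Mapping.keys (hankel_minor t c :: (nat, 'k) mpol) \<Longrightarrow> n \<le> diag_monom t c"
proof -
  have "perm_monom t c p = diag_monom t c \<longleftrightarrow> p = id" if "p permutes {0..<t}" for p
    using perm_monom_less[OF c that] perm_monom_id by (cases "p = id") auto
  then have "(\<Sum>p | p permutes {0..<t}. signof p * (1 when perm_monom t c p = diag_monom t c)) =
      (\<Sum>p | p permutes {0..<t}. if p = id then 1 else (0 :: 'k))"
    by (intro sum.cong) (auto simp: when_def)
  also have "\<dots> = 1"
    using finite_permutations[of "{0..<t}"] permutes_id[of "{0..<t}"] by (simp add: id_def[symmetric])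
  finally show "lookup (hankel_minor t c :: (nat, 'k) mpol) (diag_monom t c) = 1"
    unfolding lookup_hankel_minor .
  assume "n \<in> Poly_Mapping.keys (hankel_minor t c :: (nat, 'k) mpol)"
  from hankel_minor_keys[OF this] show "n \<le> diag_monom t c"
    using perm_monom_less[OF c] perm_monom_id by (metis less_imp_le order_refl)
qed

lemma hankel_minor_nonzero: "strict_mono_on {..<t} c \<Longrightarrow> hankel_minor t c \<noteq> (0 :: (nat, 'k::comm_ring_1) mpol)"
  using hankel_minor_leading(1)[of t c, where ?'k = 'k] by auto

section \<open>Degrees of Hankel minors\<close>

definition monom_degree :: "('v \<Rightarrow>\<^sub>0 nat) \<Rightarrow> nat" where
  "monom_degree m = (\<Sum>v\<in>Poly_Mapping.keys m. lookup m v)"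

lemma monom_degree_add: "monom_degree (m + n) = monom_degree m + monom_degree n"
proof -
  let ?A = "Poly_Mapping.keys m \<union> Poly_Mapping.keys n"
  have "monom_degree k = (\<Sum>v\<in>?A. lookup k v)" if "Poly_Mapping.keys k \<subseteq> ?A" for k
    unfolding monom_degree_def using that by (intro sum.mono_neutral_left) (auto simp: in_keys_iff)
  then show ?thesis
    using Poly_Mapping.keys_add[of m n] by (simp add: lookup_add sum.distrib)
qed

lemma monom_degree_sum_single: "finite A \<Longrightarrow> monom_degree (\<Sum>a\<in>A. Poly_Mapping.single (g a) 1) = card A"
proof (induction A rule: finite_induct)
  case (insert x A)
  then show ?case by (simp add: monom_degree_add) (simp add: monom_degree_def)
qed (simp add: monom_degree_def)

lemma total_degree_homogeneous:
  assumes "f \<noteq> 0" "\<And>m. m \<in> Poly_Mapping.keys f \<Longrightarrow> monom_degree m = t"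
  shows "total_degree f = t"
proof -
  have "(\<lambda>m. \<Sum>v\<in>Poly_Mapping.keys m. lookup m v) ` Poly_Mapping.keys f = {t}"
    using assms by (auto simp: monom_degree_def image_iff simp flip: keys_eq_empty)
  then show ?thesis by (simp add: total_degree_def)
qed

lemma total_degree_hankel_minor:
  assumes "strict_mono_on {..<t} c"
  shows "total_degree (hankel_minor t c :: (nat, 'k::comm_ring_1) mpol) = t"
proof (rule total_degree_homogeneous)
  fix m assume "m \<in> Poly_Mapping.keys (hankel_minor t c :: (nat, 'k) mpol)"
  from hankel_minor_keys[OF this] show "monom_degree m = t"
    by (auto simp: perm_monom_def monom_degree_sum_single simp del: One_nat_def)
qed (rule hankel_minor_nonzero[OF assms])

text \<open>The last row has number \<open>t - 1\<close>, so the bound says that column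
  \<open>c b\<close> does not run past \<open>x\<^sub>d\<close>.\<close>

lemma hankel_minor_mem:
  assumes "\<And>b. b < t \<Longrightarrow> t + c b \<le> Suc d"
  shows "hankel_minor t c \<in> carrier (poly_ring d)"
  unfolding mem_mpol_ring
proof
  fix m assume "m \<in> Poly_Mapping.keys (hankel_minor t c)"
  from hankel_minor_keys[OF this] obtain p where p: "p permutes {0..<t}" "m = perm_monom t c p" by blast
  have "a + c (p a) \<le> d" if "a < t" for a
    using assms[of "p a"] permutes_in_image[OF p(1), of a] that by simp
  then show "m \<in> monomials {..d}"
    unfolding p perm_monom_def by (intro sum_monomials) simp
qed

section \<open>Hankel minors as minors of submatrices\<close>

lemma pick_strict_mono_image:
  assumes "strict_mono_on {..<t} c" "b < t"
  shows "pick (c ` {..<t}) b = c b"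
proof -
  have "{a \<in> c ` {..<t}. a < c b} = c ` {..<b}"
    using assms strict_mono_on_less[OF assms(1)] by auto
  then have "card {a \<in> c ` {..<t}. a < c b} = b"
    using strict_mono_on_imp_inj_on[OF assms(1)] assms(2)
    by (simp add: card_image inj_on_subset[of c "{..<t}" "{..<b}"])
  then show ?thesis using pick_card_in_set[of "c b" "c ` {..<t}"] assms(2) by simp
qed

lemma pick_lessThan: "b < t \<Longrightarrow> pick {..<t} b = b"
  using pick_strict_mono_image[of t "\<lambda>x. x" b] by (simp add: strict_mono_on_def)

lemma submatrix_hankel:
  assumes "\<rho> \<le> d" "I \<subseteq> {..<Suc \<rho>}" "J \<subseteq> {..<Suc (d - \<rho>)}" "card I = t" "card J = t"
  shows "submatrix (hankel d \<rho>) I J = mat t t (\<lambda>(a, b). pvar (pick I a + pick J b))"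
proof -
  have I: "{i. i < dim_row (hankel d \<rho>) \<and> i \<in> I} = I" and J: "{i. i < dim_col (hankel d \<rho>) \<and> i \<in> J} = J"
    using assms by (auto simp: hankel_def)
  have "pick I a < Suc \<rho>" if "a < t" for a using pick_in_set_le[of a I] that assms by auto
  moreover have "pick J a < Suc (d - \<rho>)" if "a < t" for a using pick_in_set_le[of a J] that assms by auto
  ultimately show ?thesis
    unfolding submatrix_def I J assms(4,5) by (intro cong_mat) (auto simp: hankel_def)
qed

text \<open>The columns of a minor of \<open>X\<^sub>\<rho>\<close> with \<open>t\<close> rows: then \<open>t = \<rho> + 1\<close>, as \<open>X\<^sub>\<rho>\<close> has no more rows.\<close>

definition minor_columns :: "nat \<Rightarrow> nat \<Rightarrow> (nat \<Rightarrow> nat) set" where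
  "minor_columns d t = {c. strict_mono_on {..<t} c \<and> (\<forall>b<t. t + c b \<le> Suc d)}"

lemma minors_ge_hankel:
  assumes "\<rho> \<le> d"
  shows "minors_ge (\<rho> + 1) (hankel d \<rho>) = (hankel_minor (Suc \<rho>) ` minor_columns d (Suc \<rho>) :: (nat, 'k::comm_ring_1) mpol set)"
proof (intro Set.set_eqI iffI)
  fix f :: "(nat, 'k) mpol" assume "f \<in> minors_ge (\<rho> + 1) (hankel d \<rho>)"
  then obtain t I J where t: "t \<ge> \<rho> + 1" "f = det (submatrix (hankel d \<rho>) I J)"
      "I \<subseteq> {..<Suc \<rho>}" "J \<subseteq> {..<Suc (d - \<rho>)}" "card I = t" "card J = t"
    by (auto simp: minors_ge_def minors_def square_submatrices_def hankel_def)
  then have tr: "t = Suc \<rho>" using card_mono[OF _ t(3)] by simp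
  then have I: "I = {..<Suc \<rho>}" using card_subset_eq[OF _ t(3)] t(5) by simp
  have col: "pick J b < Suc (d - \<rho>)" if "b < t" for b using pick_in_set_le[of b J] that t by auto
  have "strict_mono_on {..<t} (pick J)"
    using pick_mono_le[of _ J] t(6) by (auto intro!: strict_mono_onI)
  then have "pick J \<in> minor_columns d (Suc \<rho>)"
    using col assms tr by (fastforce simp: minor_columns_def)
  moreover have "f = hankel_minor (Suc \<rho>) (pick J)"
    unfolding t(2) submatrix_hankel[OF assms t(3-6)] hankel_minor_def tr
    by (intro arg_cong[of _ _ det] cong_mat) (auto simp: I pick_lessThan)
  ultimately show "f \<in> hankel_minor (Suc \<rho>) ` minor_columns d (Suc \<rho>)" by blast
next
  fix f :: "(nat, 'k) mpol" assume "f \<in> hankel_minor (Suc \<rho>) ` minor_columns d (Suc \<rho>)"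
  then obtain c where c: "strict_mono_on {..<Suc \<rho>} c" "\<forall>b<Suc \<rho>. Suc \<rho> + c b \<le> Suc d" "f = hankel_minor (Suc \<rho>) c"
    by (auto simp: minor_columns_def)
  let ?J = "c ` {..<Suc \<rho>}"
  have J: "?J \<subseteq> {..<Suc (d - \<rho>)}" using c(2) by auto
  have card: "card ?J = Suc \<rho>" using strict_mono_on_imp_inj_on[OF c(1)] by (simp add: card_image)
  have "f = det (submatrix (hankel d \<rho>) {..<Suc \<rho>} ?J)"
    unfolding c(3) submatrix_hankel[OF assms subset_refl J card_lessThan card] hankel_minor_def
    by (intro arg_cong[of _ _ det] cong_mat) (auto simp: pick_lessThan pick_strict_mono_image[OF c(1)])
  moreover have "submatrix (hankel d \<rho>) {..<Suc \<rho>} ?J \<in> square_submatrices (Suc \<rho>) (hankel d \<rho> :: (nat, 'k) mpol mat)"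
    unfolding square_submatrices_def using J card 
    by (intro CollectI exI[of _ "{..<Suc \<rho>}"] exI[of _ ?J] conjI refl) (auto simp: hankel_def)
  ultimately show "f \<in> minors_ge (\<rho> + 1) (hankel d \<rho>)"
    unfolding minors_ge_def minors_def by auto
qed

text \<open>The blocks are chosen optimally for the monomial \<open>m\<close>; the degree left
  outside them is then the total degree minus the block weight, and it is at least
  \<open>s\<close>.\<close>

lemma (in diagonal_preorder) symbolic_power_leading:
  fixes f :: "(nat, 'k::field) mpol"
  assumes "f \<in> symbolic_power d (secant_kernel d r) s" "m \<in> Poly_Mapping.keys f"
    and "\<And>n. n \<in> Poly_Mapping.keys f \<Longrightarrow> le m n \<Longrightarrow> n = m"
  shows "s + block_weight (lookup m) r (Suc d) \<le> (\<Sum>i\<le>d. lookup m i)"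
proof -
  obtain \<beta> where \<beta>: "separated (Suc d) r \<beta>" "(\<Sum>i\<le>d. lookup m i) = block_weight (lookup m) r (Suc d) +
      (\<Sum>i | i \<le> d \<and> \<not> covered (Suc d) r \<beta> i. lookup m i)"
    by (rule block_weight_blocks)
  interpret secant_blocks d le r \<beta>
    by (intro secant_blocks.intro diagonal_preorder_axioms secant_blocks_axioms.intro \<beta>(1))
  have "f \<in> carrier (poly_ring d)" using assms(1) by (simp add: symbolic_power_def)
  from degree_outside_blocks[OF this assms(2,3) perturb_eval_symbolic_power[OF assms(1)]]
  show ?thesis using \<beta>(2) by simp
qed

text \<open>The order on exponent vectors is lexicographic with \<open>x\<^sub>0\<close> largest. It
  serves as a concrete diagonal order where a statement mentions none.\<close>

definition lex_order :: "nat \<Rightarrow> (nat \<Rightarrow>\<^sub>0 nat) rel" where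
  "lex_order d = {(m, n). m \<in> monomials {..d} \<and> n \<in> monomials {..d} \<and> m \<le> n}"

lemma poly_mapping_nat_nonneg: "(0 :: nat \<Rightarrow>\<^sub>0 nat) \<le> m"
proof (rule ccontr)
  assume "\<not> 0 \<le> m"
  then have "less_fun (lookup m) (lookup 0)"
    by (simp add: not_le less_poly_mapping.rep_eq)
  then show False by (auto simp: less_fun_def)
qed

lemma lex_order_term_order: "term_order d (lex_order d)"
  unfolding term_order_def linear_order_on_def partial_order_on_def preorder_on_def lex_order_def
  by (auto simp: refl_on_def trans_def antisym_def total_on_def poly_mapping_nat_nonneg
      intro: add_monomials add_right_mono)

lemma lex_order_preorder:
  "diagonal_preorder d (\<lambda>m n. (restrict_monom d m, restrict_monom d n) \<in> lex_order d)"
proof (rule diagonal_preorder_of_order[OF lex_order_term_order])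
  fix c i assume ci: "c < i" "i < d"
  let ?a = "Poly_Mapping.single c 1 + Poly_Mapping.single (Suc i) 1 :: nat \<Rightarrow>\<^sub>0 nat"
  let ?b = "Poly_Mapping.single i 1 + Poly_Mapping.single (Suc c) 1 :: nat \<Rightarrow>\<^sub>0 nat"
  have "less_fun (lookup ?b) (lookup ?a)"
    unfolding less_fun_def using ci
    by (intro exI[of _ c]) (auto simp: lookup_add lookup_single when_def)
  then have "?b \<le> ?a" by (simp add: less_poly_mapping.rep_eq less_imp_le del: One_nat_def)
  then show "(?b, ?a) \<in> lex_order d"
    using ci by (auto simp: lex_order_def intro!: add_monomials single_monomials)
qed

text \<open>A monomial of degree at most \<open>r\<close> has at most \<open>r\<close> chain
  elements, so \<open>r\<close> blocks carry its whole degree; the bound for \<open>s = 1\<close>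
  then fails for the leading monomial. This shows that pivot minors of size \<open>r\<close> do not
  vanish on the secant variety.\<close>

lemma secant_eval_low_degree:
  fixes f :: "(nat, 'k::field) mpol"
  assumes f: "f \<in> carrier (poly_ring d)" "f \<noteq> 0"
    and deg: "\<And>m. m \<in> Poly_Mapping.keys f \<Longrightarrow> monom_degree m \<le> r"
  shows "secant_eval r f \<noteq> 0"
proof
  assume "secant_eval r f = 0"
  with f(1) have "f \<in> symbolic_power d (secant_kernel d r) (Suc 0)"
    unfolding symbolic_power_1[OF secant_eval_hom] by (simp add: hom_kernel_def)
  note S = this
  interpret diagonal_preorder d "\<lambda>m n. (restrict_monom d m, restrict_monom d n) \<in> lex_order d"
    by (rule lex_order_preorder)
  from ex_is_leading[OF lex_order_term_order f] obtain m where m: "is_leading (lex_order d) f m" by blast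
  have mon: "n \<in> monomials {..d}" if "n \<in> Poly_Mapping.keys f" for n
    using f(1) that by (auto simp: mem_mpol_ring)
  have mk: "m \<in> Poly_Mapping.keys f" using m by (simp add: is_leading_def)
  have "Suc 0 + block_weight (lookup m) r (Suc d) \<le> (\<Sum>i\<le>d. lookup m i)"
  proof (rule symbolic_power_leading[OF S mk])
    fix n assume n: "n \<in> Poly_Mapping.keys f" "(restrict_monom d m, restrict_monom d n) \<in> lex_order d"
    then have "(m, n) \<in> lex_order d" by (simp add: restrict_monom_id mon mk)
    then show "n = m" using m n(1) ord_antisym[OF lex_order_term_order] by (auto simp: is_leading_def)
  qed
  moreover have "monom_degree m = (\<Sum>i<Suc d. lookup m i)"
    unfolding monom_degree_def using mon[OF mk]
    by (intro sum.mono_neutral_left) (auto simp: monomials_def in_keys_iff less_Suc_eq_le)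
  then have "greedy_count (lookup m) (Suc d) \<le> r"
    using deg[OF mk] sum_greedy_rest[of "lookup m" "Suc d"] by linarith
  then have "(\<Sum>i<Suc d. lookup m i) \<le> block_weight (lookup m) r (Suc d)"
    by (rule block_weight_full)
  ultimately show False by (simp add: lessThan_Suc_atMost)
qed

section \<open>Minors in symbolic powers\<close>

text \<open>Block elimination without division: the multiplier \<open>?L\<close> uses the adjugate
  in place of the inverse, and its determinant is the power of \<open>det A\<close> on the
  left.\<close>

lemma schur_complement_det:
  fixes A B C D :: "'a::idom mat"
  assumes A: "A \<in> carrier_mat r r" and B: "B \<in> carrier_mat r k" and C: "C \<in> carrier_mat k r"
    and D: "D \<in> carrier_mat k k"
  shows "det A ^ k * det (four_block_mat A B C D) = det A * det (det A \<cdot>\<^sub>m D - C * adj_mat A * B)"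
proof -
  let ?L = "four_block_mat (1\<^sub>m r) (0\<^sub>m r k) (- (C * adj_mat A)) (det A \<cdot>\<^sub>m 1\<^sub>m k)"
  note adj = adj_mat[OF A]
  have CA: "C * adj_mat A \<in> carrier_mat k r" using C adj(1) by auto
  have L: "?L \<in> carrier_mat (r + k) (r + k)" using CA by auto
  have M: "four_block_mat A B C D \<in> carrier_mat (r + k) (r + k)" using A B C D by auto
  have "det (?L * four_block_mat A B C D) = det ?L * det (four_block_mat A B C D)"
    by (rule det_mult[OF L M])
  also have "det ?L = det (1\<^sub>m r :: 'a mat) * det (det A \<cdot>\<^sub>m 1\<^sub>m k)"
    by (rule det_four_block_mat_upper_right_zero) (use CA in auto)
  also have "\<dots> = det A ^ k" by (simp add: det_one)
  finally have "det A ^ k * det (four_block_mat A B C D) = det (?L * four_block_mat A B C D)" by simp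
  also have "?L * four_block_mat A B C D = four_block_mat (1\<^sub>m r * A + 0\<^sub>m r k * C) (1\<^sub>m r * B + 0\<^sub>m r k * D)
     (- (C * adj_mat A) * A + (det A \<cdot>\<^sub>m 1\<^sub>m k) * C) (- (C * adj_mat A) * B + (det A \<cdot>\<^sub>m 1\<^sub>m k) * D)"
    using A B C D CA
    by (intro mult_four_block_mat[where ?nr1.0 = r and ?n1.0 = r and ?n2.0 = k and ?nr2.0 = k and ?nc1.0 = r and ?nc2.0 = k]) simp_all
  also have "1\<^sub>m r * A + 0\<^sub>m r k * C = A" using A C by auto
  also have "1\<^sub>m r * B + 0\<^sub>m r k * D = B" using B D by auto
  also have "- (C * adj_mat A) * A + (det A \<cdot>\<^sub>m 1\<^sub>m k) * C = 0\<^sub>m k r"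
  proof -
    have "C * adj_mat A * A = det A \<cdot>\<^sub>m C"
      using A C adj by (simp add: assoc_mult_mat[OF C adj(1) A] mult_smult_distrib[OF C one_carrier_mat])
    then have "- (C * adj_mat A) * A = - (det A \<cdot>\<^sub>m C)"
      using A CA by (metis carrier_matD uminus_mult_left_mat)
    moreover have "(det A \<cdot>\<^sub>m 1\<^sub>m k) * C = det A \<cdot>\<^sub>m C"
      using C by (simp add: mult_smult_assoc_mat[of _ k k])
    ultimately show ?thesis using C by (auto intro!: eq_matI)
  qed
  also have "- (C * adj_mat A) * B + (det A \<cdot>\<^sub>m 1\<^sub>m k) * D = det A \<cdot>\<^sub>m D - C * adj_mat A * B"
  proof -
    have "(det A \<cdot>\<^sub>m 1\<^sub>m k) * D = det A \<cdot>\<^sub>m D"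
      using D by (simp add: mult_smult_assoc_mat[of _ k k])
    moreover have "- (C * adj_mat A) * B = - (C * adj_mat A * B)"
      using B CA by (metis carrier_matD uminus_mult_left_mat)
    ultimately show ?thesis using B CA D by (auto intro!: eq_matI)
  qed
  also have "det (four_block_mat A B (0\<^sub>m k r) (det A \<cdot>\<^sub>m D - C * adj_mat A * B)) =
      det A * det (det A \<cdot>\<^sub>m D - C * adj_mat A * B)"
    by (rule det_four_block_mat_lower_left_zero[OF A B refl]) (use B D CA in \<open>auto intro: minus_carrier_mat\<close>)
  finally show ?thesis .
qed

text \<open>An entry depends on one further row and one further column only. So it is the case
  \<open>k = 1\<close> of the preceding identity, with \<open>det A\<close> cancelled: the minor
  that borders \<open>A\<close> by them.\<close>

lemma schur_complement_entry:
  fixes f :: "nat \<Rightarrow> nat \<Rightarrow> 'a::idom" and r :: nat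
  defines "A \<equiv> mat r r (\<lambda>(a, b). f a b)"
  assumes "det A \<noteq> 0" "i < k" "j < k"
  shows "(det A \<cdot>\<^sub>m mat k k (\<lambda>(a, b). f (r + a) (r + b)) -
      mat k r (\<lambda>(a, b). f (r + a) b) * adj_mat A * mat r k (\<lambda>(a, b). f a (r + b))) $$ (i, j) =
    det (mat (Suc r) (Suc r) (\<lambda>(a, b). f (if a < r then a else r + i) (if b < r then b else r + j)))"
proof -
  have A: "A \<in> carrier_mat r r" by (simp add: A_def)
  note adj = adj_mat(1)[OF A]
  let ?B = "mat r 1 (\<lambda>(a, b). f a (r + j))" and ?C = "mat 1 r (\<lambda>(a, b). f (r + i) b)"
    and ?D = "mat 1 1 (\<lambda>(a, b). f (r + i) (r + j))"
  have "four_block_mat A ?B ?C ?D =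
      mat (Suc r) (Suc r) (\<lambda>(a, b). f (if a < r then a else r + i) (if b < r then b else r + j))"
    by (rule eq_matI) (auto simp: A_def)
  then have "det A * det (mat (Suc r) (Suc r) (\<lambda>(a, b). f (if a < r then a else r + i) (if b < r then b else r + j))) =
      det A * det (det A \<cdot>\<^sub>m ?D - ?C * adj_mat A * ?B)"
    using schur_complement_det[of A r ?B 1 ?C ?D] A by simp
  moreover have "det (det A \<cdot>\<^sub>m ?D - ?C * adj_mat A * ?B) = (det A \<cdot>\<^sub>m ?D - ?C * adj_mat A * ?B) $$ (0, 0)"
    using adj by (intro det_single) auto
  moreover have "(det A \<cdot>\<^sub>m mat k k (\<lambda>(a, b). f (r + a) (r + b)) -
      mat k r (\<lambda>(a, b). f (r + a) b) * adj_mat A * mat r k (\<lambda>(a, b). f a (r + b))) $$ (i, j) =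
      (det A \<cdot>\<^sub>m ?D - ?C * adj_mat A * ?B) $$ (0, 0)"
    using assms(3,4) adj by (auto simp: scalar_prod_def row_def col_def)
  ultimately show ?thesis using assms(2) by simp
qed

text \<open>The matrix factors through \<open>r\<close> columns. Padding the left factor with a zero
  column makes both factors square, and the determinant of the padded one vanishes.\<close>

lemma det_low_rank:
  fixes g h :: "nat \<Rightarrow> nat \<Rightarrow> 'a::comm_ring_1"
  shows "det (mat (Suc r) (Suc r) (\<lambda>(a, b). \<Sum>j<r. g a j * h j b)) = 0"
proof -
  let ?G = "mat (Suc r) (Suc r) (\<lambda>(a, j). if j < r then g a j else 0)"
  let ?H = "mat (Suc r) (Suc r) (\<lambda>(j, b). h j b)"
  have "mat (Suc r) (Suc r) (\<lambda>(a, b). \<Sum>j<r. g a j * h j b) = ?G * ?H"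
    by (rule eq_matI) (auto simp: scalar_prod_def atLeast0LessThan intro!: sum.cong)
  moreover have "det ?G = (\<Sum>i<Suc r. ?G $$ (i, r) * cofactor ?G i r)"
    by (rule laplace_expansion_column) auto
  then have "det ?G = 0" by (simp del: sum.lessThan_Suc)
  ultimately show ?thesis
    by (simp add: det_mult[of ?G "Suc r" ?H])
qed

lemma det_pvar_mem:
  assumes "\<And>a b. a < n \<Longrightarrow> b < n \<Longrightarrow> \<rho> a + \<kappa> b \<in> V"
  shows "det (mat n n (\<lambda>(a, b). pvar (\<rho> a + \<kappa> b))) \<in> carrier (mpol_ring V)"
proof (subst det_def'[of _ n], simp, intro mpol_ring_sum mpol_ring_mult mpol_ring_prod)
  fix p i assume "p \<in> {p. p permutes {0..<n}}" "i \<in> {0..<n}"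
  then show "mat n n (\<lambda>(a, b). pvar (\<rho> a + \<kappa> b)) $$ (i, p i) \<in> carrier (mpol_ring V)"
    using permutes_in_image[of p "{0..<n}" i] assms[of i "p i"] by auto
qed (auto simp: sign_def intro: mpol_ring_uminus)

text \<open>At the secant point the matrix is a sum of \<open>r\<close> matrices of rank one,
  because powers of a node split as
  \<open>u ^ (\<rho> a + \<kappa> b) = u ^ \<rho> a * u ^ \<kappa> b\<close>. Rows are arbitrary
  here since bordered minors skip rows.\<close>

lemma hankel_det_kernel:
  assumes "\<And>a b. a < Suc r \<Longrightarrow> b < Suc r \<Longrightarrow> \<rho> a + \<kappa> b \<le> d"
  shows "det (mat (Suc r) (Suc r) (\<lambda>(a, b). pvar (\<rho> a + \<kappa> b))) \<in> (secant_kernel d r :: (nat, 'k::comm_ring_1) mpol set)"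
proof -
  interpret g: comm_ring_hom "secant_eval r :: (nat, 'k) mpol \<Rightarrow> _" by (rule secant_eval_hom)
  let ?M = "mat (Suc r) (Suc r) (\<lambda>(a, b). pvar (\<rho> a + \<kappa> b)) :: (nat, 'k) mpol mat"
  have "secant_eval r (pvar i :: (nat, 'k) mpol) = secant_point r i" for i
    by (simp add: secant_eval_def subst_poly_eq_eval mpol_eval_pvar[OF comm_ring_hom_single])
  then have "map_mat (secant_eval r) ?M = mat (Suc r) (Suc r) (\<lambda>(a, b). \<Sum>j<r.
      (pvar (3 * j) * pvar (3 * j + 1) ^ \<rho> a) * pvar (3 * j + 1) ^ \<kappa> b)"
    by (intro eq_matI) (auto simp: secant_point_def power_add mult.assoc)
  then have "det (map_mat (secant_eval r) ?M) = 0" by (simp only: det_low_rank)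
  then show ?thesis
    using det_pvar_mem[of "Suc r" \<rho> \<kappa> "{..d}"] assms by (simp add: hom_kernel_def)
qed

text \<open>The pivot \<open>A\<close> is the upper left block of size \<open>r\<close>. The entries
  of its Schur complement are minors of size \<open>r + 1\<close> in the kernel, so the determinant
  lies in the power with exponent \<open>n - r\<close>; the power of \<open>det A\<close> is the
  denominator, nonzero by \<open>secant_eval_low_degree\<close>.\<close>

theorem hankel_minor_symbolic_power:
  assumes c: "c \<in> minor_columns d n" and r: "r \<le> n"
  shows "hankel_minor n c \<in> symbolic_power d (secant_kernel d r :: (nat, 'k::field) mpol set) (n - r)"
proof -
  interpret g: comm_ring_hom "secant_eval r :: (nat, 'k) mpol \<Rightarrow> _" by (rule secant_eval_hom)
  define f where "f a b = (pvar (a + c b) :: (nat, 'k) mpol)" for a b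
  define A where "A = mat r r (\<lambda>(a, b). f a b)"
  let ?k = "n - r"
  have sm: "strict_mono_on {..<r} c" using c r by (auto simp: minor_columns_def strict_mono_on_def)
  have col: "n + c b \<le> Suc d" if "b < n" for b using c that by (auto simp: minor_columns_def)
  have dA: "det A = hankel_minor r c" by (simp add: A_def f_def hankel_minor_def)
  have "det A \<in> carrier (poly_ring d)" unfolding dA using col r
    by (intro hankel_minor_mem) (metis add_le_mono1 le_trans less_le_trans)
  moreover have "secant_eval r (det A) \<noteq> 0"
  proof (rule secant_eval_low_degree)
    show "det A \<noteq> 0" unfolding dA by (rule hankel_minor_nonzero[OF sm])
    fix m assume "m \<in> Poly_Mapping.keys (det A)"
    then show "monom_degree m \<le> r" unfolding dA
      by (auto dest!: hankel_minor_keys simp: perm_monom_def monom_degree_sum_single simp del: One_nat_def)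
  qed fact
  ultimately have u: "det A ^ ?k \<in> carrier (poly_ring d)" "secant_eval r (det A ^ ?k) \<noteq> 0" and nz: "det A \<noteq> 0"
    and Acar: "det A \<in> carrier (poly_ring d)"
    by (auto simp: g.hom_power intro: mpol_ring_power)
  let ?B = "mat r ?k (\<lambda>(a, b). f a (r + b))" and ?C = "mat ?k r (\<lambda>(a, b). f (r + a) b)"
    and ?D = "mat ?k ?k (\<lambda>(a, b). f (r + a) (r + b))"
  let ?S = "det A \<cdot>\<^sub>m ?D - ?C * adj_mat A * ?B"
  note P = ideal_power_ideal[OF ideal_hom_kernel[OF secant_eval_hom], of "{..d}" r ?k]
  have S: "?S \<in> carrier_mat ?k ?k" using adj_mat(1)[of A r] by (auto simp: A_def)
  have entry: "?S $$ (i, j) \<in> secant_kernel d r" if "i < ?k" "j < ?k" for i j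
  proof -
    have "?S $$ (i, j) = det (mat (Suc r) (Suc r) (\<lambda>(a, b). pvar ((if a < r then a else r + i) +
        c (if b < r then b else r + j)) :: (nat, 'k) mpol))"
      using schur_complement_entry[of r f i ?k j] nz that by (simp add: A_def f_def)
    also have "\<dots> \<in> secant_kernel d r"
    proof (rule hankel_det_kernel)
      fix a b assume "a < Suc r" "b < Suc r"
      then have "(if a < r then a else r + i) < n" "(if b < r then b else r + j) < n" using that by auto
      with col[of "if b < r then b else r + j"]
      show "(if a < r then a else r + i) + c (if b < r then b else r + j) \<le> d" by linarith
    qed
    finally show ?thesis .
  qed
  have "det ?S \<in> ideal_power (poly_ring d) (secant_kernel d r) ?k"
    unfolding det_def'[OF S]
  proof (rule mpol_ideal_sum[OF P], rule mpol_idealD(4)[OF P])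
    fix p assume p: "p \<in> {p. p permutes {0..<?k}}"
    have "(\<Prod>i\<in>{0..<?k}. ?S $$ (i, p i)) \<in> ideal_power (poly_ring d) (secant_kernel d r) (card {0..<?k})"
      using p permutes_in_image[of p "{0..<?k}"]
      by (intro ideal_power_prod[OF ideal_hom_kernel[OF secant_eval_hom]] entry) auto
    then show "(\<Prod>i\<in>{0..<?k}. ?S $$ (i, p i)) \<in> ideal_power (poly_ring d) (secant_kernel d r) ?k" by simp
    show "signof p \<in> carrier (poly_ring d :: (nat, 'k) mpol ring)"
      by (auto simp: sign_def intro: mpol_ring_uminus)
  qed
  then have "det A * det ?S \<in> ideal_power (poly_ring d) (secant_kernel d r) ?k"
    by (rule mpol_idealD(4)[OF P _ Acar])
  also have "det A * det ?S = det A ^ ?k * det (four_block_mat A ?B ?C ?D)"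
    by (rule schur_complement_det[symmetric]) (auto simp: A_def)
  also have "four_block_mat A ?B ?C ?D = mat n n (\<lambda>(a, b). f a b)"
    using r by (intro eq_matI) (auto simp: A_def)
  also have "det (mat n n (\<lambda>(a, b). f a b)) = hankel_minor n c" by (simp add: hankel_minor_def f_def)
  finally have "det A ^ ?k * hankel_minor n c \<in> ideal_power (poly_ring d) (secant_kernel d r) ?k" .
  moreover have "hankel_minor n c \<in> carrier (poly_ring d :: (nat, 'k) mpol ring)"
    using col by (intro hankel_minor_mem) auto
  ultimately show ?thesis
    unfolding symbolic_power_kernel[OF secant_eval_hom] using u by blast
qed

section \<open>Products of maximal minors\<close>

text \<open>The \<open>k\<close>-th diagonal entry of a minor is the variable with index
  \<open>k + c k\<close>; this choice of \<open>c\<close> makes it the \<open>k\<close>-th element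
  of \<open>C\<close>. For chains \<open>k \<le> pick C k\<close>, so the subtraction is
  exact.\<close>

definition chain_columns :: "nat set \<Rightarrow> nat \<Rightarrow> nat" where
  "chain_columns C k = pick C k - k"

lemma chain_pick:
  assumes "is_chain d C" "j \<le> k" "k < card C"
  shows "pick C j + 2 * (k - j) \<le> pick C k"
  using assms(2,3)
proof (induction k rule: dec_induct)
  case (step k)
  have fin: "finite C" using assms(1) finite_subset by (auto simp: is_chain_def)
  have "pick C k < pick C (Suc k)" using pick_mono_le[of "Suc k" C k] step by simp
  moreover have "pick C k \<in> C" "pick C (Suc k) \<in> C" using step by (intro pick_in_set_le; simp)+
  then have "pick C (Suc k) \<noteq> Suc (pick C k)" using assms(1) by (auto simp: is_chain_def)
  ultimately show ?case using step by simp
qed simp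

text \<open>Gaps of at least 2 in the chain remain gaps of at least 1 after subtracting the row
  numbers. Counted down from the largest element, they also keep every column inside the
  matrix.\<close>

lemma chain_columns_mem:
  assumes "is_chain d C"
  shows "chain_columns C \<in> minor_columns d (card C)"
proof -
  have ge: "k \<le> pick C k" if "k < card C" for k
    using chain_pick[OF assms _ that, of 0] by simp
  have "chain_columns C j < chain_columns C k" if "j < k" "k < card C" for j k
    using chain_pick[OF assms less_imp_le[OF that(1)] that(2)] ge[of j] that by (simp add: chain_columns_def)
  then have "strict_mono_on {..<card C} (chain_columns C)" by (auto intro: strict_mono_onI)
  moreover have "card C + chain_columns C b \<le> Suc d" if b: "b < card C" for b
  proof -
    have "pick C (card C - 1) \<le> d"
      using pick_in_set_le[of "card C - 1" C] b assms by (auto simp: is_chain_def)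
    moreover have "pick C b + 2 * (card C - 1 - b) \<le> pick C (card C - 1)"
      using chain_pick[OF assms, of b "card C - 1"] b by simp
    ultimately show ?thesis
      using ge[OF b] b unfolding chain_columns_def by linarith
  qed
  ultimately show ?thesis by (simp add: minor_columns_def)
qed

lemma chain_diag_monom:
  assumes "is_chain d C"
  shows "diag_monom (card C) (chain_columns C) = (\<Sum>i\<in>C. Poly_Mapping.single i 1)"
proof -
  have fin: "finite C" using assms finite_subset by (auto simp: is_chain_def)
  have inj: "inj_on (pick C) {..<card C}"
    using pick_mono_le[of _ C] by (intro inj_onI) (metis lessThan_iff less_irrefl nat_neq_iff)
  moreover have "pick C ` {..<card C} = C"
    by (rule card_subset_eq[OF fin]) (use pick_in_set_le[of _ C] card_image[OF inj] in auto)
  moreover have "a + chain_columns C a = pick C a" if "a < card C" for a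
    using chain_pick[OF assms _ that, of 0] by (simp add: chain_columns_def)
  ultimately show ?thesis
    unfolding diag_monom_def by (intro sum.reindex_cong[symmetric, of "pick C"]) auto
qed

text \<open>Strictly increasing columns satisfy \<open>k \<le> c k\<close>, whence
  \<open>2 * n - 1 \<le> d + 1\<close>. So \<open>n\<close> is the size of the maximal minors of the
  matrix with \<open>n\<close> rows.\<close>

lemma minor_columns_size:
  assumes "c \<in> minor_columns d n" "n \<ge> 1"
  shows "n \<le> Suc d" "n \<le> d - (n - 1) + 1"
proof -
  have "k \<le> c k" if "k < n" for k
    using that
  proof (induction k)
    case (Suc k)
    then have "c k < c (Suc k)" using assms(1) by (auto simp: minor_columns_def strict_mono_on_def)
    with Suc show ?case by simp
  qed simp
  from this[of "n - 1"] assms(2) have "n - 1 \<le> c (n - 1)" by simp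
  moreover have "n + c (n - 1) \<le> Suc d" using assms by (simp add: minor_columns_def)
  ultimately have "n + (n - 1) \<le> Suc d" by linarith
  then show "n \<le> Suc d" "n \<le> d - (n - 1) + 1" using assms(2) by auto
qed

lemma hankel_minor_carrier: "c \<in> minor_columns d n \<Longrightarrow> hankel_minor n c \<in> carrier (poly_ring d)"
  by (rule hankel_minor_mem) (auto simp: minor_columns_def)

text \<open>For \<open>n \<ge> 2\<close> the minor is a maximal minor of
  \<open>hankel d (n - 1)\<close>, whose index is at least 1, so the diagonal condition applies to
  it.\<close>

lemma diagonal_leading:
  fixes ord
  assumes diag: "diagonal_term_order TYPE('k::field) d ord"
    and c: "c \<in> minor_columns d n" and n: "n \<ge> 2"
  shows "is_leading ord (hankel_minor n c :: (nat, 'k) mpol) (diag_monom n c)"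
proof -
  have ord: "term_order d ord" using diag by (simp add: diagonal_term_order_def)
  note size = minor_columns_size[OF c]
  define \<rho> where "\<rho> = n - 1"
  have \<rho>: "n = Suc \<rho>" "\<rho> \<in> {1..d}" "min (\<rho> + 1) (d - \<rho> + 1) = n"
    using size n by (auto simp: \<rho>_def)
  have sm: "strict_mono_on {..<n} c" using c by (simp add: minor_columns_def)
  let ?J = "c ` {..<n}"
  let ?S = "submatrix (hankel d \<rho> :: (nat, 'k) mpol mat) {..<n} ?J"
  have J: "?J \<subseteq> {..<Suc (d - \<rho>)}" using c \<rho> by (auto simp: minor_columns_def)
  have card: "card ?J = n" using strict_mono_on_imp_inj_on[OF sm] by (simp add: card_image)
  have S: "?S = mat n n (\<lambda>(a, b). pvar (a + c b))"
  proof -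
    have "?S = mat n n (\<lambda>(a, b). pvar (pick {..<n} a + pick ?J b))"
      by (rule submatrix_hankel) (use \<rho> J card in auto)
    also have "\<dots> = mat n n (\<lambda>(a, b). pvar (a + c b))"
      by (rule cong_mat) (auto simp: pick_lessThan pick_strict_mono_image[OF sm])
    finally show ?thesis .
  qed
  have "?S \<in> square_submatrices n (hankel d \<rho>)"
    unfolding square_submatrices_def using J card \<rho>(1)
    by (intro CollectI exI[of _ "{..<n}"] exI[of _ ?J] conjI refl) (auto simp: hankel_def)
  then have "?S \<in> square_submatrices (min (\<rho> + 1) (d - \<rho> + 1)) (hankel d \<rho>)" using \<rho>(3) by simp
  then have "leading_monomial ord (det ?S) = (\<Prod>i<dim_row ?S. ?S $$ (i, i))"
    using diag \<rho>(2) unfolding diagonal_term_order_def by blast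
  also have "\<dots> = (\<Prod>i<n. pvar (i + c i))" unfolding S by simp
  also have "\<dots> = monom_poly (diag_monom n c)" unfolding prod_pvar diag_monom_def ..
  finally have "leading_monomial ord (hankel_minor n c :: (nat, 'k) mpol) = monom_poly (diag_monom n c)"
    unfolding S hankel_minor_def .
  then show ?thesis
    by (intro is_leadingI[OF ord hankel_minor_carrier[OF c] hankel_minor_nonzero[OF sm]])
qed

lemma hankel_minor_2: "hankel_minor 2 k = (pvar (k 0) * pvar (Suc (k 1)) - pvar (k 1) * pvar (Suc (k 0)) :: (nat, 'k::comm_ring_1) mpol)"
proof -
  let ?A = "mat 2 2 (\<lambda>(a, b). pvar (a + k b)) :: (nat, 'k) mpol mat"
  have "det ?A = (\<Sum>j<2. ?A $$ (0, j) * cofactor ?A 0 j)"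
    by (rule laplace_expansion_row) auto
  also have "\<dots> = ?A $$ (0, 0) * cofactor ?A 0 0 + ?A $$ (0, 1) * cofactor ?A 0 1"
    by (simp only: numeral_2_eq_2 sum.lessThan_Suc lessThan_0 sum.empty add_0 One_nat_def)
  also have "cofactor ?A 0 0 = pvar (Suc (k 1))"
    unfolding cofactor_def by (subst det_single) (auto simp: mat_delete_def)
  also have "cofactor ?A 0 1 = - pvar (Suc (k 0))"
    unfolding cofactor_def by (subst det_single) (auto simp: mat_delete_def)
  finally show ?thesis unfolding hankel_minor_def by simp
qed

text \<open>The minor of \<open>hankel d 1\<close> with columns \<open>c\<close> and
  \<open>i\<close> has just two terms; that its diagonal is leading is the convexity
  condition.\<close>

lemma diagonal_order_preorder:
  assumes diag: "diagonal_term_order TYPE('k::field) d ord"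
  shows "diagonal_preorder d (\<lambda>m n. (restrict_monom d m, restrict_monom d n) \<in> ord)"
proof (rule diagonal_preorder_of_order)
  show "term_order d ord" using diag by (simp add: diagonal_term_order_def)
  fix c i assume ci: "c < i" "i < d"
  let ?a = "Poly_Mapping.single c 1 + Poly_Mapping.single (Suc i) 1 :: nat \<Rightarrow>\<^sub>0 nat"
  let ?b = "Poly_Mapping.single i 1 + Poly_Mapping.single (Suc c) 1 :: nat \<Rightarrow>\<^sub>0 nat"
  define k where "k b = (if b = 0 then c else i)" for b :: nat
  have "k \<in> minor_columns d 2"
    using ci by (auto simp: minor_columns_def strict_mono_on_def k_def)
  from diagonal_leading[OF diag this] have lead: "is_leading ord (hankel_minor 2 k :: (nat, 'k) mpol) (diag_monom 2 k)" by simp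
  have "diag_monom 2 k = ?a" by (simp add: diag_monom_def k_def eval_nat_numeral)
  moreover have "hankel_minor 2 k = (pvar c * pvar (Suc i) - pvar i * pvar (Suc c) :: (nat, 'k) mpol)"
    unfolding hankel_minor_2 by (simp add: k_def)
  then have "hankel_minor 2 k = (Poly_Mapping.single ?a 1 - Poly_Mapping.single ?b 1 :: (nat, 'k) mpol)"
    by (simp add: pvar_def mult_single)
  moreover have "lookup ?a c \<noteq> lookup ?b c"
    using ci by (simp add: lookup_add lookup_single when_def)
  then have "?a \<noteq> ?b" by metis
  ultimately have "?b \<in> Poly_Mapping.keys (hankel_minor 2 k :: (nat, 'k) mpol)" "diag_monom 2 k = ?a"
    by (simp_all add: in_keys_iff lookup_minus lookup_single del: One_nat_def)
  with lead show "(?b, ?a) \<in> ord" by (auto simp: is_leading_def)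
qed

lemma lex_order_hankel_minor:
  assumes c: "c \<in> minor_columns d n"
  shows "is_leading (lex_order d) (hankel_minor n c :: (nat, 'k::comm_ring_1) mpol) (diag_monom n c)"
proof -
  have sm: "strict_mono_on {..<n} c" using c by (simp add: minor_columns_def)
  have mon: "m \<in> monomials {..d}" if "m \<in> Poly_Mapping.keys (hankel_minor n c :: (nat, 'k) mpol)" for m
    using hankel_minor_carrier[OF c, where ?'a = 'k] that by (auto simp: mem_mpol_ring)
  have "diag_monom n c \<in> Poly_Mapping.keys (hankel_minor n c :: (nat, 'k) mpol)"
    by (simp add: in_keys_iff hankel_minor_leading(1)[OF sm])
  with mon hankel_minor_leading(2)[OF sm, where ?'k = 'k] show ?thesis
    by (auto simp: is_leading_def lex_order_def)
qed

text \<open>A maximal minor uses all rows or all columns. In the second case its transpose is a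
  Hankel minor whose columns are the chosen rows, with the same diagonal.\<close>

lemma lex_order_diagonal: "diagonal_term_order TYPE('k::field) d (lex_order d)"
  unfolding diagonal_term_order_def
proof (intro conjI ballI lex_order_term_order)
  fix \<rho> and S :: "(nat, 'k) mpol mat"
  assume \<rho>: "\<rho> \<in> {1..d}" and S: "S \<in> square_submatrices (min (\<rho> + 1) (d - \<rho> + 1)) (hankel d \<rho>)"
  define t where "t = min (\<rho> + 1) (d - \<rho> + 1)"
  from S obtain I J where IJ: "S = submatrix (hankel d \<rho>) I J" "I \<subseteq> {..<Suc \<rho>}" "J \<subseteq> {..<Suc (d - \<rho>)}"
      "card I = t" "card J = t"
    by (auto simp: square_submatrices_def hankel_def t_def)
  have S_eq: "S = mat t t (\<lambda>(a, b). pvar (pick I a + pick J b))"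
    unfolding IJ(1) by (rule submatrix_hankel) (use IJ \<rho> in auto)
  have sm: "strict_mono_on {..<t} (pick K)" if "card K = t" for K
    using pick_mono_le[of _ K] that by (auto intro: strict_mono_onI)
  have "\<exists>c \<in> minor_columns d t. det S = hankel_minor t c \<and> (\<forall>i<t. S $$ (i, i) = pvar (i + c i))"
  proof (cases "t = Suc \<rho>")
    case True
    then have I: "I = {..<t}" using card_subset_eq[OF _ IJ(2)] IJ(4) by simp
    have "pick J b \<le> d - \<rho>" if "b < t" for b using pick_in_set_le[of b J] IJ(3,5) that by auto
    with sm[OF IJ(5)] True \<rho> have "pick J \<in> minor_columns d t" by (fastforce simp: minor_columns_def)
    moreover have "S = mat t t (\<lambda>(a, b). pvar (a + pick J b))"
      unfolding S_eq I by (rule cong_mat) (auto simp: pick_lessThan)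
    ultimately show ?thesis by (intro bexI[of _ "pick J"]) (auto simp: hankel_minor_def)
  next
    case False
    then have t: "t = Suc (d - \<rho>)" by (simp add: t_def min_def split: if_splits)
    then have J: "J = {..<t}" using card_subset_eq[OF _ IJ(3)] IJ(5) by simp
    have "pick I b \<le> \<rho>" if "b < t" for b using pick_in_set_le[of b I] IJ(2,4) that by auto
    with sm[OF IJ(4)] t \<rho> have "pick I \<in> minor_columns d t" by (fastforce simp: minor_columns_def)
    moreover have S': "S = transpose_mat (mat t t (\<lambda>(a, b). pvar (a + pick I b)))"
      unfolding S_eq J by (rule eq_matI) (auto simp: pick_lessThan add.commute)
    moreover have "det S = hankel_minor t (pick I)"
      unfolding S' hankel_minor_def by (rule det_transpose) auto
    ultimately show ?thesis by (intro bexI[of _ "pick I"]) auto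
  qed
  then obtain c where c: "c \<in> minor_columns d t" "det S = hankel_minor t c" "\<And>i. i < t \<Longrightarrow> S $$ (i, i) = pvar (i + c i)"
    by blast
  have "leading_monomial (lex_order d) (det S) = monom_poly (diag_monom t c)"
    unfolding c(2) by (rule leading_monomial_eq[OF lex_order_term_order lex_order_hankel_minor[OF c(1)]])
  also have "\<dots> = (\<Prod>i<dim_row S. S $$ (i, i))"
    using c(3) by (simp add: diag_monom_def S_eq flip: prod_pvar del: One_nat_def)
  finally show "leading_monomial (lex_order d) (det S) = (\<Prod>i<dim_row S. S $$ (i, i))" .
qed

section \<open>Groebner bases of symbolic powers\<close>

definition minor_product :: "(nat \<times> (nat \<Rightarrow> nat)) list \<Rightarrow> (nat, 'k::comm_ring_1) mpol" where
  "minor_product xs = prod_list (map (\<lambda>(n, c). hankel_minor n c) xs)"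

text \<open>Index set for \<open>minor_products\<close>: a factor is given by its size and its
  columns. As the size is one more than the upper index, \<open>r \<le> \<rho>\<close> becomes
  \<open>r < n\<close>, and the surplus is a natural number.\<close>

definition minor_lists :: "nat \<Rightarrow> nat \<Rightarrow> nat \<Rightarrow> (nat \<times> (nat \<Rightarrow> nat)) list set" where
  "minor_lists d r s = {xs. xs \<noteq> [] \<and> (\<forall>(n, c)\<in>set xs. r < n \<and> c \<in> minor_columns d n) \<and>
     (\<Sum>(n, c)\<leftarrow>xs. n - r) = s}"

text \<open>Every factor has degree \<open>\<rho> + 1 > r\<close>, so integer and natural
  differences agree. Conversely, \<open>minor_columns_size\<close> gives
  \<open>\<rho> \<le> d\<close>, and \<open>r \<ge> 1\<close> gives
  \<open>1 \<le> \<rho>\<close>.\<close>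

lemma minor_products_eq:
  assumes r: "r \<ge> 1"
  shows "minor_products d r s = (minor_product ` minor_lists d r s :: (nat, 'k::field) mpol set)"
proof (intro Set.set_eqI iffI)
  fix g :: "(nat, 'k) mpol" assume "g \<in> minor_products d r s"
  then obtain l :: nat and f \<rho> where g: "g = (\<Prod>i\<in>{1..l}. f i)" "l \<ge> 1"
      "\<forall>i\<in>{1..l}. r \<le> \<rho> i \<and> 1 \<le> \<rho> i \<and> \<rho> i \<le> d \<and> f i \<in> minors_ge (\<rho> i + 1) (hankel d (\<rho> i))"
      "(\<Sum>i\<in>{1..l}. int (total_degree (f i)) - int r) = int s"
    unfolding minor_products_def mem_Collect_eq by blast
  have "\<exists>c. c \<in> minor_columns d (Suc (\<rho> i)) \<and> f i = hankel_minor (Suc (\<rho> i)) c" if "i \<in> {1..l}" for i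
    using g(3) that minors_ge_hankel[of "\<rho> i" d, where ?'k = 'k] by auto
  then obtain c where c: "\<And>i. i \<in> {1..l} \<Longrightarrow> c i \<in> minor_columns d (Suc (\<rho> i)) \<and> f i = hankel_minor (Suc (\<rho> i)) (c i)"
    by metis
  \<comment> \<open>Products run over \<open>1..l\<close> but lists over \<open>0..<l\<close>, hence
    the inner successor; the outer one turns \<open>\<rho>\<close> into the size of the
    minor.\<close>
  define xs where "xs = map (\<lambda>i. (Suc (\<rho> (Suc i)), c (Suc i))) [0..<l]"
  have "minor_product xs = (\<Prod>i = 0..<l. f (Suc i))"
    unfolding minor_product_def xs_def map_map prod.list_conv_set_nth
    by (auto intro!: prod.cong simp: c)
  also have "\<dots> = g" unfolding g(1) by (simp add: prod.atLeast1_atMost_eq atLeast0LessThan)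
  finally have "g = minor_product xs" by simp
  moreover have "(\<Sum>(n, c)\<leftarrow>xs. n - r) = s"
  proof -
    have "int (\<Sum>(n, c)\<leftarrow>xs. n - r) = (\<Sum>i<l. int (Suc (\<rho> (Suc i)) - r))"
      unfolding xs_def map_map sum_list_sum_nth by (auto simp: atLeast0LessThan intro!: sum.cong)
    also have "\<dots> = (\<Sum>i<l. int (total_degree (f (Suc i))) - int r)"
    proof (rule sum.cong)
      fix i assume "i \<in> {..<l}"
      then have i: "Suc i \<in> {1..l}" by simp
      from c[OF i] have "total_degree (f (Suc i)) = Suc (\<rho> (Suc i))"
        by (simp add: minor_columns_def total_degree_hankel_minor)
      moreover have "r \<le> \<rho> (Suc i)" using g(3) i by blast
      ultimately show "int (Suc (\<rho> (Suc i)) - r) = int (total_degree (f (Suc i))) - int r"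
        by (simp add: of_nat_diff)
    qed simp
    also have "\<dots> = int s" using g(4) by (simp add: sum.atLeast1_atMost_eq)
    finally show ?thesis by simp
  qed
  moreover have "xs \<noteq> []" using g(2) by (simp add: xs_def)
  moreover have "\<forall>(n, c)\<in>set xs. r < n \<and> c \<in> minor_columns d n"
    using c g(3) by (auto simp: xs_def less_Suc_eq_le)
  ultimately show "g \<in> minor_product ` minor_lists d r s" by (auto simp: minor_lists_def)
next
  fix g :: "(nat, 'k) mpol" assume "g \<in> minor_product ` minor_lists d r s"
  then obtain xs where xs: "g = minor_product xs" "xs \<noteq> []" "\<And>n c. (n, c) \<in> set xs \<Longrightarrow> r < n \<and> c \<in> minor_columns d n"
      "(\<Sum>(n, c)\<leftarrow>xs. n - r) = s"
    by (auto simp: minor_lists_def)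
  define l where "l = length xs"
  define f where "f i = (hankel_minor (fst (xs ! (i - 1))) (snd (xs ! (i - 1))) :: (nat, 'k) mpol)" for i
  define \<rho> where "\<rho> i = fst (xs ! (i - 1)) - 1" for i
  have mem: "r < fst (xs ! i) \<and> snd (xs ! i) \<in> minor_columns d (fst (xs ! i))" if "i < l" for i
    using xs(3)[of "fst (xs ! i)" "snd (xs ! i)"] that by (simp add: l_def)
  have "g = (\<Prod>i<l. f (Suc i))"
    unfolding xs(1) minor_product_def prod.list_conv_set_nth f_def l_def
    by (auto intro!: prod.cong simp: split_def atLeast0LessThan)
  then have g: "g = (\<Prod>i\<in>{1..l}. f i)" by (simp add: prod.atLeast1_atMost_eq)
  have "int s = (\<Sum>i<l. int (fst (xs ! i) - r))"
    unfolding xs(4)[symmetric] sum_list_sum_nth l_def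
    by (auto intro!: sum.cong simp: split_def atLeast0LessThan)
  also have "\<dots> = (\<Sum>i<l. int (total_degree (f (Suc i))) - int r)"
  proof (rule sum.cong)
    fix i assume "i \<in> {..<l}"
    with mem[of i] show "int (fst (xs ! i) - r) = int (total_degree (f (Suc i))) - int r"
      by (simp add: f_def minor_columns_def total_degree_hankel_minor)
  qed simp
  finally have sum: "(\<Sum>i\<in>{1..l}. int (total_degree (f i)) - int r) = int s" by (simp add: sum.atLeast1_atMost_eq)
  have "r \<le> \<rho> i \<and> 1 \<le> \<rho> i \<and> \<rho> i \<le> d \<and> f i \<in> minors_ge (\<rho> i + 1) (hankel d (\<rho> i))" if "i \<in> {1..l}" for i
  proof -
    from that have m: "r < fst (xs ! (i - 1))" "snd (xs ! (i - 1)) \<in> minor_columns d (fst (xs ! (i - 1)))"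
      using mem[of "i - 1"] by auto
    then have n: "fst (xs ! (i - 1)) = Suc (\<rho> i)" by (simp add: \<rho>_def)
    have "\<rho> i \<le> d" using minor_columns_size(1)[OF m(2)] n by simp
    moreover have "f i \<in> hankel_minor (Suc (\<rho> i)) ` minor_columns d (Suc (\<rho> i))"
      using m(2) unfolding f_def n by blast
    ultimately show ?thesis using m(1) n r minors_ge_hankel[of "\<rho> i" d, where ?'k = 'k] by auto
  qed
  then show "g \<in> minor_products d r s"
    unfolding minor_products_def using g sum xs(2)
    by (intro CollectI exI[of _ l] exI[of _ f] exI[of _ \<rho>]) (auto simp: l_def Suc_le_eq)
qed

section \<open>Membership, finiteness and leading monomials of products of minors\<close>

lemma minor_product_Cons: "minor_product ((n, c) # xs) = hankel_minor n c * minor_product xs"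
  by (simp add: minor_product_def)

lemma minor_product_carrier:
  "\<forall>(n, c)\<in>set xs. r < n \<and> c \<in> minor_columns d n \<Longrightarrow> minor_product xs \<in> carrier (poly_ring d)"
  by (induction xs) (auto simp: minor_product_Cons hankel_minor_carrier minor_product_def intro!: mpol_ring_mult)

lemma minor_product_symbolic_power:
  assumes "\<forall>(n, c)\<in>set xs. r < n \<and> c \<in> minor_columns d n"
  shows "minor_product xs \<in> symbolic_power d (secant_kernel d r :: (nat, 'k::field) mpol set) (\<Sum>(n, c)\<leftarrow>xs. n - r)"
  using assms
proof (induction xs)
  case Nil
  interpret g: comm_ring_hom "secant_eval r :: (nat, 'k) mpol \<Rightarrow> _" by (rule secant_eval_hom)
  show ?case
    unfolding symbolic_power_kernel[OF secant_eval_hom] by (auto simp: minor_product_def intro!: bexI[of _ 1])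
next
  case (Cons x xs)
  obtain n c where x: "x = (n, c)" by (cases x)
  with Cons show ?case
    using symbolic_power_mult[OF secant_eval_hom hankel_minor_symbolic_power[of c d n r] Cons.IH]
    by (simp add: minor_product_Cons)
qed

corollary minor_products_subset:
  "r \<ge> 1 \<Longrightarrow> minor_products d r s \<subseteq> symbolic_power d (secant_kernel d r :: (nat, 'k::field) mpol set) s"
  using minor_product_symbolic_power by (auto simp: minor_products_eq minor_lists_def)

text \<open>There are finitely many minors, and each factor contributes at least 1 to the total, so
  there are at most \<open>s\<close> factors.\<close>

lemma finite_minor_products:
  assumes "r \<ge> 1"
  shows "finite (minor_products d r s :: (nat, 'k::field) mpol set)"
proof -
  let ?A = "(\<Union>n\<in>{..Suc d}. (\<lambda>c. hankel_minor n c) ` minor_columns d n) :: (nat, 'k) mpol set"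
  have "finite ((\<lambda>c. hankel_minor n c :: (nat, 'k) mpol) ` minor_columns d n)" for n
  proof -
    \<comment> \<open>A column function matters only on \<open>{..<n}\<close>; restricting it leaves
      finitely many candidates.\<close>
    have "hankel_minor n c \<in> hankel_minor n ` ({..<n} \<rightarrow>\<^sub>E {..Suc d})" if c: "c \<in> minor_columns d n" for c
    proof
      show "restrict c {..<n} \<in> {..<n} \<rightarrow>\<^sub>E {..Suc d}"
        using c unfolding restrict_PiE_iff by (fastforce simp: minor_columns_def)
      show "hankel_minor n c = hankel_minor n (restrict c {..<n})"
        unfolding hankel_minor_def by (intro arg_cong[of _ _ det] cong_mat) auto
    qed
    then have "(\<lambda>c. hankel_minor n c :: (nat, 'k) mpol) ` minor_columns d n \<subseteq> hankel_minor n ` ({..<n} \<rightarrow>\<^sub>E {..Suc d})"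
      by blast
    moreover have "finite (hankel_minor n ` ({..<n} \<rightarrow>\<^sub>E {..Suc d}) :: (nat, 'k) mpol set)"
      by (intro finite_imageI finite_PiE) auto
    ultimately show ?thesis by (rule finite_subset)
  qed
  then have fin: "finite ?A" by blast
  have "minor_product xs \<in> prod_list ` {ys. set ys \<subseteq> ?A \<and> length ys \<le> s}" if "xs \<in> minor_lists d r s" for xs
  proof
    show "minor_product xs = prod_list (map (\<lambda>(n, c). hankel_minor n c) xs)" by (simp add: minor_product_def)
    have "(n, c) \<in> set xs \<Longrightarrow> hankel_minor n c \<in> ?A" for n c
      using that minor_columns_size(1)[of c d n] by (fastforce simp: minor_lists_def)
    then have "set (map (\<lambda>(n, c). hankel_minor n c) xs) \<subseteq> ?A" by auto
    moreover have "length xs \<le> (\<Sum>(n, c)\<leftarrow>xs. n - r)" if "\<forall>(n, c)\<in>set xs. r < n" for xs :: "(nat \<times> (nat \<Rightarrow> nat)) list"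
      using that by (induction xs) auto
    then have "length xs \<le> s" using that by (fastforce simp: minor_lists_def)
    ultimately show "map (\<lambda>(n, c). hankel_minor n c) xs \<in> {ys. set ys \<subseteq> ?A \<and> length ys \<le> s}" by simp
  qed
  then have "minor_products d r s \<subseteq> prod_list ` {ys. set ys \<subseteq> ?A \<and> length ys \<le> s}"
    unfolding minor_products_eq[OF assms] by blast
  then show ?thesis
    by (rule finite_subset) (intro finite_imageI finite_lists_length_le fin)
qed

lemma minor_product_leading:
  assumes diag: "diagonal_term_order TYPE('k::field) d ord"
    and "\<forall>C\<in>set Cs. is_chain d C \<and> 2 \<le> card C"
  shows "is_leading ord (minor_product (map (\<lambda>C. (card C, chain_columns C)) Cs) :: (nat, 'k) mpol)
    (\<Sum>C\<leftarrow>Cs. \<Sum>i\<in>C. Poly_Mapping.single i 1)"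
  using assms(2)
proof (induction Cs)
  case Nil
  have "term_order d ord" using diag by (simp add: diagonal_term_order_def)
  from ord_zero[OF this, of 0] show ?case by (simp add: is_leading_def minor_product_def)
next
  case (Cons C Cs)
  have ord: "term_order d ord" using diag by (simp add: diagonal_term_order_def)
  have "is_leading ord (hankel_minor (card C) (chain_columns C) :: (nat, 'k) mpol) (\<Sum>i\<in>C. Poly_Mapping.single i 1)"
    using diagonal_leading[OF diag chain_columns_mem[of d C]] Cons.prems chain_diag_monom[of d C] by simp
  moreover have "minor_product (map (\<lambda>C. (card C, chain_columns C)) Cs) \<in> carrier (poly_ring d :: (nat, 'k) mpol ring)"
    using Cons.prems by (intro minor_product_carrier[of _ 1]) (auto intro: chain_columns_mem)
  ultimately show ?case
    using is_leading_mult[OF ord hankel_minor_carrier[OF chain_columns_mem[of d C]]] Cons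
    by (simp add: minor_product_Cons)
qed

text \<open>The degree bound lets the leading monomial be decomposed into chains of total surplus
  \<open>s\<close>. Each chain is the diagonal of a minor, so the product of these minors has a
  leading monomial that divides \<open>m\<close>.\<close>

theorem leading_monomials_divisible:
  assumes diag: "diagonal_term_order TYPE('k::field) d ord" and rs: "r \<ge> 1" "s \<ge> 1"
    and f: "f \<in> symbolic_power d (secant_kernel d r :: (nat, 'k) mpol set) s" "is_leading ord f m"
  shows "\<exists>g\<in>minor_products d r s. \<exists>m' k. is_leading ord (g :: (nat, 'k) mpol) m' \<and> k \<in> monomials {..d} \<and> m = m' + k"
proof -
  have ord: "term_order d ord" using diag by (simp add: diagonal_term_order_def)
  interpret diagonal_preorder d "\<lambda>m n. (restrict_monom d m, restrict_monom d n) \<in> ord"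
    by (rule diagonal_order_preorder[OF diag])
  have mon: "n \<in> monomials {..d}" if "n \<in> Poly_Mapping.keys f" for n
    using f(1) that by (auto simp: symbolic_power_def mem_mpol_ring)
  have mk: "m \<in> Poly_Mapping.keys f" using f(2) by (simp add: is_leading_def)
  have "s + block_weight (lookup m) r (Suc d) \<le> (\<Sum>i\<le>d. lookup m i)"
  proof (rule symbolic_power_leading[OF f(1) mk])
    fix n assume n: "n \<in> Poly_Mapping.keys f" "(restrict_monom d m, restrict_monom d n) \<in> ord"
    then have "(m, n) \<in> ord" by (simp add: restrict_monom_id mon mk)
    then show "n = m" using f(2) n(1) ord_antisym[OF ord] by (auto simp: is_leading_def)
  qed
  from chain_decomposition[OF this] obtain Cs where Cs: "\<forall>C\<in>set Cs. is_chain d C \<and> r < card C"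
    "(\<Sum>C\<leftarrow>Cs. card C - r) = s" "\<forall>i. (\<Sum>C\<leftarrow>Cs. of_bool (i \<in> C)) \<le> lookup m i" by blast
  let ?xs = "map (\<lambda>C. (card C, chain_columns C)) Cs"
  let ?m = "\<Sum>C\<leftarrow>Cs. \<Sum>i\<in>C. Poly_Mapping.single i 1 :: nat \<Rightarrow>\<^sub>0 nat"
  have "?xs \<in> minor_lists d r s"
    using Cs(1,2) rs(2) by (auto simp: minor_lists_def o_def intro: chain_columns_mem)
  then have "minor_product ?xs \<in> (minor_products d r s :: (nat, 'k) mpol set)"
    unfolding minor_products_eq[OF rs(1)] by blast
  moreover have "is_leading ord (minor_product ?xs :: (nat, 'k) mpol) ?m"
    using Cs(1) rs(1) by (intro minor_product_leading[OF diag]) auto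
  moreover have "lookup ?m i \<le> lookup m i" for i
  proof -
    have "finite C \<Longrightarrow> lookup (\<Sum>i\<in>C. Poly_Mapping.single i 1 :: nat \<Rightarrow>\<^sub>0 nat) i = of_bool (i \<in> C)" for C :: "nat set"
      by (simp add: lookup_sum lookup_single when_def)
    moreover have "finite C" if "C \<in> set Cs" for C using Cs(1) that finite_subset by (auto simp: is_chain_def)
    ultimately have "lookup ?m i = (\<Sum>C\<leftarrow>Cs. of_bool (i \<in> C))"
      by (induction Cs) (simp_all add: lookup_add)
    then show ?thesis using Cs(3) by simp
  qed
  then have "m = ?m + (m - ?m)"
    by (intro poly_mapping_eqI) (simp add: lookup_add lookup_minus)
  moreover have "m - ?m \<in> monomials {..d}"
    using mon[OF mk] by (auto simp: monomials_def subset_iff in_keys_iff lookup_minus)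
  ultimately show ?thesis by blast
qed

text \<open>In finitely many variables the order embeds into the well-founded lexicographic order on
  exponent lists of length \<open>d + 1\<close>.\<close>

lemma wf_lex: "wf {(m, n). m \<in> monomials {..d :: nat} \<and> n \<in> monomials {..d} \<and> m < n}"
proof (rule wf_subset[OF wf_inv_image[OF wf_lexn[OF wf_less_than, of "Suc d"]]])
  show "{(m, n). m \<in> monomials {..d} \<and> n \<in> monomials {..d} \<and> m < n}
    \<subseteq> inv_image (lexn less_than (Suc d)) (\<lambda>m. map (lookup m) [0..<Suc d])"
  proof clarify
    fix m n :: "nat \<Rightarrow>\<^sub>0 nat" assume "n \<in> monomials {..d}" "m < n"
    then obtain k where k: "lookup m k < lookup n k"
        "\<forall>k'<k. lookup m k' = lookup n k'"
      by (auto simp: less_poly_mapping.rep_eq less_fun_def)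
    then have "k \<in> Poly_Mapping.keys n" by (auto simp: in_keys_iff)
    then have kd: "k < Suc d" using \<open>n \<in> monomials {..d}\<close> by (auto simp: monomials_def less_Suc_eq_le)
    have split: "map (lookup p) [0..<Suc d] = map (lookup p) [0..<k] @
        lookup p k # map (lookup p) [Suc k..<Suc d]" for p :: "nat \<Rightarrow>\<^sub>0 nat"
    proof -
      have "[0..<Suc d] = [0..<k] @ k # [Suc k..<Suc d]"
        using kd upt_add_eq_append[of 0 k "Suc d - k"] upt_conv_Cons[OF kd] by simp
      then show ?thesis by (simp only: map_append list.map)
    qed
    have "map (lookup m) [0..<k] = map (lookup n) [0..<k]"
      using k(2) by simp
    then show "(m, n) \<in> inv_image (lexn less_than (Suc d)) (\<lambda>m. map (lookup m) [0..<Suc d])"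
      unfolding inv_image_def lexn_conv using k(1) split[of m] split[of n]
      by (auto simp del: upt_Suc intro!: exI[of _ "map (lookup n) [0..<k]"])
  qed
qed

text \<open>Division: subtracting a multiple of an element of \<open>G\<close> cancels the leading
  term and leaves a smaller one, which terminates by \<open>wf_lex\<close>. Generation does not
  refer to an order, so the lexicographic one suffices.\<close>

lemma generated_by_leading_monomials:
  fixes I :: "(nat, 'k::field) mpol set"
  assumes I: "ideal I (poly_ring d)" and G: "G \<subseteq> I"
    and div: "\<And>f m. f \<in> I \<Longrightarrow> is_leading (lex_order d) f m \<Longrightarrow>
      \<exists>g\<in>G. \<exists>m' k. is_leading (lex_order d) g m' \<and> k \<in> monomials {..d} \<and> m = m' + k"
  shows "I \<subseteq> genideal (poly_ring d) G"
proof -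
  let ?J = "genideal (poly_ring d) G"
  have car: "I \<subseteq> carrier (poly_ring d)" by (rule mpol_idealD(1)[OF I])
  then have Gcar: "G \<subseteq> carrier (poly_ring d)" using G by blast
  note J = genideal_mpol(1)[OF Gcar] and GJ = genideal_mpol(2)[OF Gcar]
  have main: "f \<in> ?J" if "f \<in> I" "is_leading (lex_order d) f m" for f m
    using that
  proof (induction m arbitrary: f rule: wf_induct_rule[OF wf_lex[of d]])
    case (1 m)
    from div[OF 1(2,3)] obtain g m' k where g: "g \<in> G" "is_leading (lex_order d) g m'" "k \<in> monomials {..d}" "m = m' + k"
      by blast
    \<comment> \<open>The ratio of the leading coefficients, so that the terms at \<open>m\<close>
      cancel in \<open>f - h\<close>.\<close>
    define a where "a = lookup f m / lookup g m'"
    define h where "h = Poly_Mapping.single k a * g"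
    have h: "h \<in> ?J" "h \<in> I"
      unfolding h_def using g GJ G by (auto intro!: mpol_idealD(4)[OF J] mpol_idealD(4)[OF I])
    have f': "f - h \<in> I" using mpol_ideal_diff[OF I 1(2) h(2)] .
    have keys_f: "n \<le> m" if "n \<in> Poly_Mapping.keys f" for n
      using 1(3) that by (auto simp: is_leading_def lex_order_def)
    have keys_g: "n \<le> m'" if "n \<in> Poly_Mapping.keys g" for n
      using g(2) that by (auto simp: is_leading_def lex_order_def)
    have keys_h: "n \<le> m" if "n \<in> Poly_Mapping.keys h" for n
    proof -
      from that obtain b where "b \<in> Poly_Mapping.keys g" "n = k + b"
        using Poly_Mapping.keys_mult[of "Poly_Mapping.single k a" g] unfolding h_def
        by (auto split: if_splits)
      then show ?thesis using add_left_mono[OF keys_g, of b k] g(4) by (simp add: add.commute)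
    qed
    have "lookup h (k + m') = lookup (Poly_Mapping.single k a) k * lookup g m'"
      unfolding h_def by (rule lookup_mult_unique) (auto simp: lookup_single when_def split: if_splits)
    moreover have "lookup g m' \<noteq> 0" using g(2) by (simp add: is_leading_def in_keys_iff)
    ultimately have lk: "lookup (f - h) m = 0"
      using g(4) by (simp add: lookup_minus a_def add.commute)
    have "f - h \<in> ?J"
    proof (cases "f - h = 0")
      case True
      then show ?thesis using mpol_idealD(2)[OF J] by simp
    next
      case False
      then obtain m'' where m'': "is_leading (lex_order d) (f - h) m''"
        using ex_is_leading[OF lex_order_term_order, of "f - h"] f' car by blast
      then have mk: "m'' \<in> Poly_Mapping.keys (f - h)" by (simp add: is_leading_def)
      then have "m'' \<noteq> m" using lk by auto
      moreover have "m'' \<le> m"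
        using mk keys_f keys_h by (auto simp: in_keys_iff lookup_minus) (metis diff_0_right)
      moreover have "m'' \<in> monomials {..d}" "m \<in> monomials {..d}"
        using mk 1(3) subsetD[OF car f'] subsetD[OF car 1(2)] by (auto simp: is_leading_def mem_mpol_ring)
      ultimately show ?thesis using 1(1)[OF _ f' m''] by auto
    qed
    from mpol_idealD(3)[OF J this h(1)] show ?case by simp
  qed
  show ?thesis
  proof
    fix f assume f: "f \<in> I"
    show "f \<in> ?J"
    proof (cases "f = 0")
      case True
      then show ?thesis using mpol_idealD(2)[OF J] by simp
    next
      case False
      then show ?thesis using ex_is_leading[OF lex_order_term_order, of f] f car main by blast
    qed
  qed
qed

lemma symbolic_power_generated:
  assumes "r \<ge> 1" "s \<ge> 1"
  shows "symbolic_power d (secant_kernel d r :: (nat, 'k::field) mpol set) s =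
    genideal (poly_ring d) (minor_products d r s)"
proof (rule antisym)
  note I = symbolic_power_ideal[OF secant_eval_hom, of d r s, where ?'k = 'k]
  note G = minor_products_subset[OF assms(1), of d s, where ?'k = 'k]
  show "symbolic_power d (secant_kernel d r :: (nat, 'k) mpol set) s \<subseteq> genideal (poly_ring d) (minor_products d r s)"
    by (rule generated_by_leading_monomials[OF I G])
      (rule leading_monomials_divisible[OF lex_order_diagonal assms])
  show "genideal (poly_ring d) (minor_products d r s) \<subseteq> symbolic_power d (secant_kernel d r :: (nat, 'k) mpol set) s"
    by (rule genideal_mpol(3)[OF _ I G]) (use G mpol_idealD(1)[OF I] in blast)
qed

text \<open>Every leading monomial of the symbolic power is a monomial multiple of one from the
  products; the opposite inclusion of initial ideals follows from that of the sets.\<close>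

theorem minor_products_groebner:
  assumes diag: "diagonal_term_order TYPE('k::field) d ord" and "r \<ge> 1" "s \<ge> 1"
  shows "groebner_basis d ord (minor_products d r s) (symbolic_power d (secant_kernel d r :: (nat, 'k) mpol set) s)"
proof -
  have ord: "term_order d ord" using diag by (simp add: diagonal_term_order_def)
  let ?G = "minor_products d r s :: (nat, 'k) mpol set" and ?I = "symbolic_power d (secant_kernel d r :: (nat, 'k) mpol set) s"
  note G = minor_products_subset[OF assms(2), of d s, where ?'k = 'k]
  have car: "?I \<subseteq> carrier (poly_ring d)" by (auto simp: symbolic_power_def)
  have mon: "m \<in> monomials {..d}" if "is_leading ord f m" "f \<in> ?I" for f m
  proof -
    have "f \<in> carrier (poly_ring d)" using that(2) car by blast
    with that(1) show ?thesis by (auto simp: is_leading_def mem_mpol_ring)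
  qed
  have lmcar: "leading_monomial ord ` (?I - {0}) \<subseteq> carrier (poly_ring d)"
  proof (intro image_subsetI)
    fix f assume "f \<in> ?I - {0}"
    then have f: "f \<in> ?I" "f \<noteq> 0" by auto
    then obtain m where m: "is_leading ord f m" using ex_is_leading[OF ord, of f] car by blast
    with leading_monomial_eq[OF ord m] mon[OF m f(1)] show "leading_monomial ord f \<in> carrier (poly_ring d)" by auto
  qed
  then have lmcar': "leading_monomial ord ` (?G - {0}) \<subseteq> carrier (poly_ring d)" using G by blast
  note J = genideal_mpol(1)[OF lmcar'] and GJ = genideal_mpol(2)[OF lmcar']
  have "leading_monomial ord ` (?I - {0}) \<subseteq> genideal (poly_ring d) (leading_monomial ord ` (?G - {0}))"
  proof (intro image_subsetI)
    fix f assume "f \<in> ?I - {0}"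
    then have f: "f \<in> ?I" "f \<noteq> 0" by auto
    then obtain m where m: "is_leading ord f m" using ex_is_leading[OF ord, of f] car by blast
    from leading_monomials_divisible[OF diag assms(2,3) f(1) m] obtain g m' k
      where g: "g \<in> ?G" "is_leading ord g m'" "k \<in> monomials {..d}" "m = m' + k" by blast
    have "g \<noteq> 0" using g(2) by (auto simp: is_leading_def)
    then have "monom_poly m' \<in> genideal (poly_ring d) (leading_monomial ord ` (?G - {0}))"
      using GJ g(1) leading_monomial_eq[OF ord g(2)] by force
    then have "monom_poly k * monom_poly m' \<in> genideal (poly_ring d) (leading_monomial ord ` (?G - {0}))"
      using g(3) by (intro mpol_idealD(4)[OF J]) auto
    then show "leading_monomial ord f \<in> genideal (poly_ring d) (leading_monomial ord ` (?G - {0}))"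
      using leading_monomial_eq[OF ord m] g(4) by (simp add: monom_poly_add mult.commute)
  qed
  then have "genideal (poly_ring d) (leading_monomial ord ` (?I - {0})) \<subseteq> genideal (poly_ring d) (leading_monomial ord ` (?G - {0}))"
    by (rule genideal_mpol(3)[OF lmcar J])
  moreover have "genideal (poly_ring d) (leading_monomial ord ` (?G - {0})) \<subseteq> genideal (poly_ring d) (leading_monomial ord ` (?I - {0}))"
    by (rule genideal_mpol(3)[OF lmcar' genideal_mpol(1)[OF lmcar]]) (use genideal_mpol(2)[OF lmcar] G in blast)
  ultimately show ?thesis
    using finite_minor_products[OF assms(2)] G by (simp add: groebner_basis_def)
qed

section \<open>Secant ideals\<close>

text \<open>Repeated Laplace expansion along rows that can be spared reduces the determinant to
  minors of size \<open>k\<close> whose rows all satisfy \<open>q\<close>.\<close>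

lemma det_rows_mem:
  fixes f :: "nat \<Rightarrow> nat \<Rightarrow> ('v, 'k::comm_ring_1) mpol"
  assumes J: "ideal J (mpol_ring V)"
    and car: "\<And>a b. a < N \<Longrightarrow> b < N \<Longrightarrow> f a b \<in> carrier (mpol_ring V)"
    and minors: "\<And>\<rho> \<kappa>. (\<And>a. a < k \<Longrightarrow> \<rho> a < N \<and> q (\<rho> a) \<and> \<kappa> a < N) \<Longrightarrow>
      det (mat k k (\<lambda>(a, b). f (\<rho> a) (\<kappa> b))) \<in> J"
    and "\<And>a. a < n \<Longrightarrow> \<rho> a < N \<and> \<kappa> a < N" "k \<le> card {a. a < n \<and> q (\<rho> a)}"
  shows "det (mat n n (\<lambda>(a, b). f (\<rho> a) (\<kappa> b))) \<in> J"
  using assms(4,5)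
proof (induction n arbitrary: \<rho> \<kappa>)
  case 0
  then show ?case using minors[of \<rho> \<kappa>] by simp
next
  case (Suc n)
  have sub: "{a. a < Suc n \<and> q (\<rho> a)} \<subseteq> {..<Suc n}" by auto
  show ?case
  proof (cases "k = Suc n")
    case True
    then have "{a. a < Suc n \<and> q (\<rho> a)} = {..<Suc n}"
      using card_subset_eq[OF _ sub] card_mono[OF _ sub] Suc.prems(2) by simp
    then have "q (\<rho> a)" if "a < Suc n" for a using that by blast
    then show ?thesis using minors[of \<rho> \<kappa>] Suc.prems(1) True by simp
  next
    case False
    \<comment> \<open>A row without \<open>q\<close> can be spared; if all rows have
      \<open>q\<close>, there are more than \<open>k\<close> of them and any one can be.\<close>
    have "\<exists>i<Suc n. k \<le> card ({a. a < Suc n \<and> q (\<rho> a)} - {i})"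
    proof (cases "\<forall>a<Suc n. q (\<rho> a)")
      case True
      then have "{a. a < Suc n \<and> q (\<rho> a)} = {..<Suc n}" by auto
      then show ?thesis using False Suc.prems(2) by (intro exI[of _ 0]) simp
    next
      case False
      then obtain i where "i < Suc n" "\<not> q (\<rho> i)" by blast
      then show ?thesis using Suc.prems(2) by (intro exI[of _ i]) simp
    qed
    then obtain i where i: "i < Suc n" "k \<le> card ({a. a < Suc n \<and> q (\<rho> a)} - {i})" by blast
    define skip where "skip i a = (if a < i then a else Suc a)" for i a :: nat
    have skip: "skip j a < Suc n" if "a < n" for j a using that by (simp add: skip_def)
    let ?M = "mat (Suc n) (Suc n) (\<lambda>(a, b). f (\<rho> a) (\<kappa> b))"
    have "{a. a < Suc n \<and> q (\<rho> a)} - {i} \<subseteq> skip i ` {a. a < n \<and> q (\<rho> (skip i a))}"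
    proof
      fix a assume a: "a \<in> {a. a < Suc n \<and> q (\<rho> a)} - {i}"
      then have "a = skip i (if a < i then a else a - 1)" by (auto simp: skip_def)
      moreover have "(if a < i then a else a - 1) < n" using a i by auto
      ultimately show "a \<in> skip i ` {a. a < n \<and> q (\<rho> (skip i a))}" using a by auto
    qed
    then have "card ({a. a < Suc n \<and> q (\<rho> a)} - {i}) \<le> card {a. a < n \<and> q (\<rho> (skip i a))}"
      by (rule surj_card_le[rotated]) simp
    then have k: "k \<le> card {a. a < n \<and> q (\<rho> (skip i a))}" using i(2) by linarith
    have minor: "cofactor ?M i j \<in> J" if j: "j < Suc n" for j
    proof -
      have "mat_delete ?M i j = mat n n (\<lambda>(a, b). f (\<rho> (skip i a)) (\<kappa> (skip j b)))"
        unfolding mat_delete_def by (rule eq_matI) (auto simp: skip_def)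
      moreover have "det (mat n n (\<lambda>(a, b). f (\<rho> (skip i a)) (\<kappa> (skip j b)))) \<in> J"
        by (rule Suc.IH[of "\<lambda>a. \<rho> (skip i a)" "\<lambda>b. \<kappa> (skip j b)"]) (use k skip Suc.prems(1) in auto)
      moreover have "(- 1) ^ (i + j) \<in> carrier (mpol_ring V :: ('v, 'k) mpol ring)"
        by (intro mpol_ring_intros mpol_ring_closed)
      ultimately show ?thesis unfolding cofactor_def by (simp add: mpol_idealD(4)[OF J])
    qed
    have "det ?M = (\<Sum>j<Suc n. ?M $$ (i, j) * cofactor ?M i j)"
      by (rule laplace_expansion_row) (use i in auto)
    also have "\<dots> \<in> J"
      using i Suc.prems(1) minor
      by (intro mpol_ideal_sum[OF J] mpol_idealD(4)[OF J]) (auto intro!: car)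
    finally show ?thesis .
  qed
qed

text \<open>Multilinearity in the rows, with \<open>S\<close> the set of rows taken from
  \<open>A\<close>. It is obtained by expanding each product of sums in the Leibniz formula.\<close>

lemma det_add:
  fixes A B :: "nat \<Rightarrow> nat \<Rightarrow> 'a::comm_ring_1"
  shows "det (mat n n (\<lambda>(a, b). A a b + B a b)) =
    (\<Sum>S\<in>Pow {0..<n}. det (mat n n (\<lambda>(a, b). if a \<in> S then A a b else B a b)))"
proof -
  have leibniz: "det (mat n n (\<lambda>(a, b). F a b)) = (\<Sum>p | p permutes {0..<n}. signof p * (\<Prod>i = 0..<n. F i (p i)))"
    for F :: "nat \<Rightarrow> nat \<Rightarrow> 'a"
  proof (subst det_def'[of _ n], simp, intro sum.cong refl arg_cong2[of _ _ _ _ "(*)"] prod.cong)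
    fix p i assume "p \<in> {p. p permutes {0..<n}}" "i \<in> {0..<n}"
    then show "mat n n (\<lambda>(a, b). F a b) $$ (i, p i) = F i (p i)"
      using permutes_in_image[of p "{0..<n}" i] by simp
  qed
  have split: "(\<Prod>i = 0..<n. if i \<in> S then A i (p i) else B i (p i)) = (\<Prod>i\<in>S. A i (p i)) * (\<Prod>i\<in>{0..<n} - S. B i (p i))"
    if "S \<in> Pow {0..<n}" for S p
  proof -
    have "{0..<n} \<inter> S = S" "{0..<n} \<inter> - S = {0..<n} - S" using that by auto
    then show ?thesis by (simp add: prod.If_cases)
  qed
  have "det (mat n n (\<lambda>(a, b). A a b + B a b)) = (\<Sum>p | p permutes {0..<n}. \<Sum>S\<in>Pow {0..<n}.
      signof p * (\<Prod>i = 0..<n. if i \<in> S then A i (p i) else B i (p i)))"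
    unfolding leibniz by (intro sum.cong refl) (simp add: prod_add split sum_distrib_left)
  also have "\<dots> = (\<Sum>S\<in>Pow {0..<n}. \<Sum>p | p permutes {0..<n}.
      signof p * (\<Prod>i = 0..<n. if i \<in> S then A i (p i) else B i (p i)))"
    by (rule sum.swap)
  finally show ?thesis unfolding leibniz .
qed

text \<open>Congruence modulo \<open>J\<close> passes to products by replacing one factor at a time;
  \<open>det_diff_mem\<close> carries it over to determinants.\<close>

lemma prod_diff_mem:
  fixes x y :: "'i \<Rightarrow> ('v, 'k::comm_ring_1) mpol"
  assumes J: "ideal J (mpol_ring V)" and "finite A"
    and "\<And>i. i \<in> A \<Longrightarrow> x i \<in> carrier (mpol_ring V) \<and> y i \<in> carrier (mpol_ring V) \<and> x i - y i \<in> J"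
  shows "prod x A - prod y A \<in> J"
  using assms(2,3)
proof (induction A rule: finite_induct)
  case empty
  then show ?case using mpol_idealD(2)[OF J] by simp
next
  case (insert i A)
  have "prod y A \<in> carrier (mpol_ring V)" using insert.prems by (intro mpol_ring_prod) auto
  then have "x i * (prod x A - prod y A) + prod y A * (x i - y i) \<in> J"
    using insert by (intro mpol_idealD(3)[OF J] mpol_idealD(4)[OF J]) auto
  moreover have "x i * (prod x A - prod y A) + prod y A * (x i - y i) = prod x (insert i A) - prod y (insert i A)"
    using insert.hyps by (simp add: algebra_simps)
  ultimately show ?case by simp
qed

lemma det_diff_mem:
  fixes x y :: "nat \<Rightarrow> nat \<Rightarrow> ('v, 'k::comm_ring_1) mpol"
  assumes J: "ideal J (mpol_ring V)"
    and xy: "\<And>a b. a < n \<Longrightarrow> b < n \<Longrightarrow> x a b \<in> carrier (mpol_ring V) \<and> y a b \<in> carrier (mpol_ring V) \<and> x a b - y a b \<in> J"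
  shows "det (mat n n (\<lambda>(a, b). x a b)) - det (mat n n (\<lambda>(a, b). y a b)) \<in> J"
proof -
  let ?x = "mat n n (\<lambda>(a, b). x a b)" and ?y = "mat n n (\<lambda>(a, b). y a b)"
  have "det ?x - det ?y = (\<Sum>p | p permutes {0..<n}. signof p * ((\<Prod>i = 0..<n. ?x $$ (i, p i)) - (\<Prod>i = 0..<n. ?y $$ (i, p i))))"
    by (simp add: det_def'[of _ n] sum_subtractf right_diff_distrib)
  also have "\<dots> \<in> J"
  proof (intro mpol_ideal_sum[OF J] mpol_idealD(4)[OF J] prod_diff_mem[OF J])
    fix p i assume "p \<in> {p. p permutes {0..<n}}" "i \<in> {0..<n}"
    then show "?x $$ (i, p i) \<in> carrier (mpol_ring V) \<and> ?y $$ (i, p i) \<in> carrier (mpol_ring V) \<and> ?x $$ (i, p i) - ?y $$ (i, p i) \<in> J"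
      using permutes_in_image[of p "{0..<n}" i] xy[of i "p i"] by simp
  qed (auto simp: sign_def intro: mpol_ring_uminus)
  finally show ?thesis .
qed

text \<open>Every factor contributes at least 1, so a total of 1 leaves room for a single minor, of
  size \<open>r + 1\<close>.\<close>

lemma minor_lists_1: "minor_lists d r 1 = (\<lambda>c. [(Suc r, c)]) ` minor_columns d (Suc r)"
proof (intro Set.set_eqI iffI)
  fix xs assume xs: "xs \<in> minor_lists d r 1"
  then obtain n c ys where eq: "xs = (n, c) # ys" by (cases xs) (auto simp: minor_lists_def)
  have ys: "ys = []"
  proof (cases ys)
    case (Cons y zs)
    then show ?thesis using xs eq by (cases y) (auto simp: minor_lists_def)
  qed
  with xs eq have "n = Suc r" by (auto simp: minor_lists_def)
  with ys show "xs \<in> (\<lambda>c. [(Suc r, c)]) ` minor_columns d (Suc r)"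
    using xs eq by (auto simp: minor_lists_def)
qed (auto simp: minor_lists_def)

lemma secant_kernel_generated:
  assumes "r \<ge> 1"
  shows "(secant_kernel d r :: (nat, 'k::field) mpol set) = genideal (poly_ring d) (hankel_minor (Suc r) ` minor_columns d (Suc r))"
proof -
  have "secant_kernel d r = genideal (poly_ring d) (minor_products d r 1 :: (nat, 'k) mpol set)"
    using symbolic_power_generated[OF assms, of 1 d, where ?'k = 'k] symbolic_power_1[OF secant_eval_hom, of d r, where ?'k = 'k] by simp
  also have "minor_products d r 1 = (hankel_minor (Suc r) ` minor_columns d (Suc r) :: (nat, 'k) mpol set)"
    unfolding minor_products_eq[OF assms] minor_lists_1 by (simp add: image_image minor_product_def)
  finally show ?thesis .
qed

text \<open>\<open>hankel d 1\<close> has two rows and hence no larger minors, so its minors of size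
  2 are the generators of the kernel for \<open>r = 1\<close>.\<close>

lemma hankel_ideal_eq:
  assumes "d \<ge> 1"
  shows "hankel_ideal d = (secant_kernel d 1 :: (nat, 'k::field) mpol set)"
proof -
  have "minors t (hankel d 1 :: (nat, 'k) mpol mat) = {}" if "t > 2" for t
  proof -
    have "\<not> (I \<subseteq> {..<2} \<and> card I = t)" for I :: "nat set"
      using card_mono[of "{..<2::nat}" I] that by auto
    then show ?thesis by (auto simp: minors_def square_submatrices_def hankel_def numeral_2_eq_2)
  qed
  then have "minors_ge 2 (hankel d 1 :: (nat, 'k) mpol mat) = minors 2 (hankel d 1)"
    unfolding minors_ge_def by (auto simp: le_eq_less_or_eq)
  then have "minors 2 (hankel d 1) = (hankel_minor (Suc 1) ` minor_columns d (Suc 1) :: (nat, 'k) mpol set)"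
    using minors_ge_hankel[of 1 d, where ?'k = 'k] assms by (simp add: numeral_2_eq_2)
  then show ?thesis
    unfolding hankel_ideal_def secant_kernel_generated[OF order_refl] by simp
qed

section \<open>Joins of secant kernels\<close>

lemma subst_poly_hom: "comm_ring_hom (subst_poly h)"
  unfolding subst_poly_eq_eval by (rule mpol_eval_hom[OF comm_ring_hom_single])

lemma subst_poly_pvar [simp]: "subst_poly h (pvar v) = h v"
  unfolding subst_poly_eq_eval by (rule mpol_eval_pvar[OF comm_ring_hom_single])

lemma subst_poly_comp:
  assumes "comm_ring_hom g"
  shows "g (subst_poly h p) = mpol_eval (\<lambda>a. g (Poly_Mapping.single 0 a)) (\<lambda>v. g (h v)) p"
  unfolding subst_poly_eq_eval by (rule mpol_eval_comp[OF comm_ring_hom_single assms])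

lemma subst_poly_det:
  "subst_poly h (det (mat n n (\<lambda>(a, b). pvar (F a b)))) = det (mat n n (\<lambda>(a, b). h (F a b)))"
proof -
  interpret g: comm_ring_hom "subst_poly h" by (rule subst_poly_hom)
  have "map_mat (subst_poly h) (mat n n (\<lambda>(a, b). pvar (F a b))) = mat n n (\<lambda>(a, b). h (F a b))"
    by (rule eq_matI) auto
  then show ?thesis using g.hom_det[of "mat n n (\<lambda>(a, b). pvar (F a b))"] by simp
qed

definition join_gens :: "nat \<Rightarrow> (nat, 'k::field) mpol set \<Rightarrow> (nat, 'k) mpol set \<Rightarrow> (xyz, 'k) mpol set" where
  "join_gens d I J = subst_poly (\<lambda>i. pvar (Y i)) ` I \<union> subst_poly (\<lambda>i. pvar (Z i)) ` J \<union>
     {pvar (X i) - pvar (Y i) - pvar (Z i) | i. i \<le> d}"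

lemma join_gens_carrier:
  assumes "I \<subseteq> carrier (poly_ring d)" "J \<subseteq> carrier (poly_ring d)"
  shows "join_gens d I J \<subseteq> carrier (xyz_ring d :: (xyz, 'k::field) mpol ring)"
proof -
  have "subst_poly (\<lambda>i. pvar (Y i)) f \<in> carrier (xyz_ring d)" if "f \<in> I" for f
    unfolding xyz_ring_def by (rule subst_poly_mem[of _ "{..d}"]) (use assms(1) that in auto)
  moreover have "subst_poly (\<lambda>i. pvar (Z i)) f \<in> carrier (xyz_ring d)" if "f \<in> J" for f
    unfolding xyz_ring_def by (rule subst_poly_mem[of _ "{..d}"]) (use assms(2) that in auto)
  moreover have "pvar (X i) - pvar (Y i) - pvar (Z i) \<in> carrier (xyz_ring d :: (xyz, 'k) mpol ring)" if "i \<le> d" for i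
    unfolding xyz_ring_def using that by (intro mpol_ring_diff mpol_ring_closed) auto
  ultimately show ?thesis by (auto simp: join_gens_def)
qed

lemma join_ideal_eq:
  "join_ideal d I J = {f \<in> carrier (poly_ring d). subst_poly (\<lambda>i. pvar (X i)) f \<in> genideal (xyz_ring d) (join_gens d I J)}"
  by (simp add: join_ideal_def join_gens_def)

text \<open>One inclusion evaluates at a general point of the larger secant variety, written as a
  sum of a curve point and a point of the smaller one. The other uses that the kernel is generated
  by minors and expands each minor of a sum of matrices by rows.\<close>

theorem join_secant_kernel:
  assumes r: "r \<ge> 1"
  shows "join_ideal d (secant_kernel d 1) (secant_kernel d r) = (secant_kernel d (Suc r) :: (nat, 'k::field) mpol set)"
proof -
  let ?I = "secant_kernel d 1 :: (nat, 'k) mpol set" and ?K = "secant_kernel d r :: (nat, 'k) mpol set"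
  have car: "?I \<subseteq> carrier (poly_ring d)" "?K \<subseteq> carrier (poly_ring d)" by (auto simp: hom_kernel_def)
  let ?V = "X ` {..d} \<union> Y ` {..d} \<union> Z ` {..d}"
  let ?J = "genideal (xyz_ring d) (join_gens d ?I ?K)"
  have gens: "join_gens d ?I ?K \<subseteq> carrier (mpol_ring ?V)"
    using join_gens_carrier[OF car] by (simp add: xyz_ring_def)
  have J: "ideal ?J (mpol_ring ?V)" "join_gens d ?I ?K \<subseteq> ?J"
    using genideal_mpol(1,2)[OF gens] by (simp_all add: xyz_ring_def)
  show ?thesis
  proof (rule antisym)
    \<comment> \<open>The last summand of \<open>secant_point (Suc r)\<close>; its weight and node
      do not occur in \<open>secant_point r\<close>.\<close>
    define q :: "nat \<Rightarrow> (nat, 'k) mpol" where "q i = pvar (3 * r) * pvar (3 * r + 1) ^ i" for i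
    define \<psi> where "\<psi> v = (case v of X i \<Rightarrow> secant_point (Suc r) i | Y i \<Rightarrow> q i | Z i \<Rightarrow> secant_point r i)" for v
    interpret g: comm_ring_hom "subst_poly \<psi> :: (xyz, 'k) mpol \<Rightarrow> (nat, 'k) mpol" by (rule subst_poly_hom)
    have single: "subst_poly \<psi> (Poly_Mapping.single 0 a) = Poly_Mapping.single 0 a" for a :: 'k
      by (simp add: subst_poly_def)
    have comp: "subst_poly \<psi> (subst_poly (\<lambda>i. pvar (v i)) f) = subst_poly (\<lambda>i. \<psi> (v i)) f" for v and f :: "(nat, 'k) mpol"
      unfolding subst_poly_comp[OF g.comm_ring_hom_axioms] single subst_poly_pvar
      by (simp add: subst_poly_eq_eval)
    have I: "subst_poly q f = 0" if "f \<in> ?I" for f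
    proof -
      \<comment> \<open>It is enough to test the generators: at a single curve point the matrix has
        rank one, so its 2-minors vanish.\<close>
      have "hankel_minor (Suc 1) ` minor_columns d (Suc 1) \<subseteq> hom_kernel {..d} (subst_poly q)"
      proof (intro image_subsetI)
        fix c assume c: "c \<in> minor_columns d (Suc 1)"
        have "subst_poly q (hankel_minor (Suc 1) c) = det (mat (Suc 1) (Suc 1) (\<lambda>(a, b). q (a + c b)))"
          unfolding hankel_minor_def by (rule subst_poly_det)
        also have "mat (Suc 1) (Suc 1) (\<lambda>(a, b). q (a + c b)) = mat (Suc 1) (Suc 1) (\<lambda>(a, b). \<Sum>j<(1::nat).
            (pvar (3 * r) * pvar (3 * r + 1) ^ a) * pvar (3 * r + 1) ^ c b)"
          by (rule cong_mat) (auto simp: q_def power_add mult.assoc)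
        also have "det \<dots> = 0" by (rule det_low_rank)
        finally show "hankel_minor (Suc 1) c \<in> hom_kernel {..d} (subst_poly q)"
          using hankel_minor_carrier[OF c] by (simp add: hom_kernel_def)
      qed
      then have "?I \<subseteq> hom_kernel {..d} (subst_poly q)"
        unfolding secant_kernel_generated[OF order_refl]
        by (intro genideal_mpol(3) ideal_hom_kernel subst_poly_hom) (auto simp: hankel_minor_carrier)
      then show ?thesis using that by (auto simp: hom_kernel_def)
    qed
    have "join_gens d ?I ?K \<subseteq> hom_kernel ?V (subst_poly \<psi>)"
    proof
      fix x assume x: "x \<in> join_gens d ?I ?K"
      then have "subst_poly \<psi> x = 0"
        unfolding join_gens_def
      proof (elim UnE imageE CollectE exE conjE)
        fix f assume "x = subst_poly (\<lambda>i. pvar (Y i)) f" "f \<in> ?I"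
        then show ?thesis using I by (simp add: comp) (simp add: \<psi>_def)
      next
        fix f assume "x = subst_poly (\<lambda>i. pvar (Z i)) f" "f \<in> ?K"
        then show ?thesis by (simp add: comp) (simp add: \<psi>_def hom_kernel_def secant_eval_def)
      next
        fix i assume "x = pvar (X i) - pvar (Y i) - pvar (Z i)"
        then show ?thesis by (simp add: g.hom_minus \<psi>_def q_def secant_point_def)
      qed
      then show "x \<in> hom_kernel ?V (subst_poly \<psi>)" using x gens by (auto simp: hom_kernel_def)
    qed
    then have J\<psi>: "?J \<subseteq> hom_kernel ?V (subst_poly \<psi>)"
      unfolding xyz_ring_def by (intro genideal_mpol(3)[OF gens] ideal_hom_kernel subst_poly_hom)
    show "join_ideal d ?I ?K \<subseteq> secant_kernel d (Suc r)"
    proof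
      fix f assume f: "f \<in> join_ideal d ?I ?K"
      then have "subst_poly \<psi> (subst_poly (\<lambda>i. pvar (X i)) f) = 0"
        using J\<psi> by (auto simp: join_ideal_eq hom_kernel_def)
      then have "secant_eval (Suc r) f = 0" unfolding comp by (simp add: \<psi>_def secant_eval_def)
      then show "f \<in> secant_kernel d (Suc r)" using f by (simp add: join_ideal_eq hom_kernel_def)
    qed
  next
    let ?x = "subst_poly (\<lambda>i. pvar (X i)) :: (nat, 'k) mpol \<Rightarrow> _"
    interpret x: comm_ring_hom ?x by (rule subst_poly_hom)
    have xcar: "?x f \<in> carrier (mpol_ring ?V)" if "f \<in> carrier (poly_ring d)" for f
      by (rule subst_poly_mem[OF that]) auto
    have join: "ideal (join_ideal d ?I ?K) (poly_ring d)"
    proof (rule mpol_idealI)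
      show "join_ideal d ?I ?K \<subseteq> carrier (poly_ring d)" by (auto simp: join_ideal_eq)
      show "0 \<in> join_ideal d ?I ?K" using mpol_idealD(2)[OF J(1)] by (simp add: join_ideal_eq)
    next
      fix a b assume "a \<in> join_ideal d ?I ?K" "b \<in> join_ideal d ?I ?K"
      then show "a + b \<in> join_ideal d ?I ?K"
        using mpol_idealD(3)[OF J(1)] by (auto simp: join_ideal_eq x.hom_add intro: mpol_ring_add)
    next
      fix a b :: "(nat, 'k) mpol"
      assume "a \<in> join_ideal d ?I ?K" "b \<in> carrier (poly_ring d)"
      then show "b * a \<in> join_ideal d ?I ?K"
        using mpol_idealD(4)[OF J(1)] xcar by (auto simp: join_ideal_eq x.hom_mult intro: mpol_ring_mult)
    qed
    have "hankel_minor (Suc (Suc r)) c \<in> join_ideal d ?I ?K" if c: "c \<in> minor_columns d (Suc (Suc r))" for c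
    proof -
      let ?n = "Suc (Suc r)"
      have bound: "a + c b \<le> d" if "a < ?n" "b < ?n" for a b
        using c that by (fastforce simp: minor_columns_def)
      define y z :: "nat \<Rightarrow> nat \<Rightarrow> (xyz, 'k) mpol"
        where "y a b = pvar (Y (a + c b))" and "z a b = pvar (Z (a + c b))" for a b
      have yz: "y a b \<in> carrier (mpol_ring ?V)" "z a b \<in> carrier (mpol_ring ?V)" if "a < ?n" "b < ?n" for a b
        using bound[OF that] by (auto simp: y_def z_def)
      have X: "?x (hankel_minor ?n c) = det (mat ?n ?n (\<lambda>(a, b). pvar (X (a + c b))))"
        unfolding hankel_minor_def by (rule subst_poly_det)
      have "det (mat ?n ?n (\<lambda>(a, b). pvar (X (a + c b)))) - det (mat ?n ?n (\<lambda>(a, b). y a b + z a b)) \<in> ?J"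
      proof (rule det_diff_mem[OF J(1)], intro conjI)
        fix a b assume ab: "a < ?n" "b < ?n"
        show "pvar (X (a + c b)) \<in> carrier (mpol_ring ?V)" using bound[OF ab] by auto
        show "y a b + z a b \<in> carrier (mpol_ring ?V)" using yz[OF ab] by (rule mpol_ring_add)
        have "pvar (X (a + c b)) - y a b - z a b \<in> join_gens d ?I ?K"
          using bound[OF ab] by (auto simp: join_gens_def y_def z_def)
        then show "pvar (X (a + c b)) - (y a b + z a b) \<in> ?J" using J(2) by (auto simp: diff_diff_eq)
      qed
      moreover have "det (mat ?n ?n (\<lambda>(a, b). y a b + z a b)) \<in> ?J"
        unfolding det_add
      proof (rule mpol_ideal_sum[OF J(1)])
        fix S assume S: "S \<in> Pow {0..<?n}"
        let ?f = "\<lambda>a b. if a \<in> S then y a b else z a b"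
        have fcar: "?f a b \<in> carrier (mpol_ring ?V)" if "a < ?n" "b < ?n" for a b
          using yz[OF that] by auto
        have "{0..<?n} = {a. a < ?n \<and> a \<in> S} \<union> {a. a < ?n \<and> a \<notin> S}" by auto
        then have "?n \<le> card {a. a < ?n \<and> a \<in> S} + card {a. a < ?n \<and> a \<notin> S}"
          using card_Un_le[of "{a. a < ?n \<and> a \<in> S}" "{a. a < ?n \<and> a \<notin> S}"] by (metis card_atLeastLessThan minus_nat.diff_0)
        \<comment> \<open>Among \<open>r + 2\<close> rows, at least two come from \<open>y\<close>
          or at least \<open>r + 1\<close> from \<open>z\<close>; these produce minors in the first
          or the second ideal of the join.\<close>
        then consider "Suc 1 \<le> card {a. a < ?n \<and> a \<in> S}" | "Suc r \<le> card {a. a < ?n \<and> a \<notin> S}"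
          by linarith
        then show "det (mat ?n ?n (\<lambda>(a, b). ?f a b)) \<in> ?J"
        proof cases
          case 1
          show ?thesis
          proof (rule det_rows_mem[OF J(1) fcar, where k = "Suc 1" and q = "\<lambda>a. a \<in> S" and \<rho> = "\<lambda>a. a" and \<kappa> = "\<lambda>a. a"])
            fix \<rho> \<kappa> assume \<rho>: "\<And>a. a < Suc 1 \<Longrightarrow> \<rho> a < ?n \<and> \<rho> a \<in> S \<and> \<kappa> a < ?n"
            have "det (mat (Suc 1) (Suc 1) (\<lambda>(a, b). ?f (\<rho> a) (\<kappa> b))) =
                subst_poly (\<lambda>i. pvar (Y i)) (det (mat (Suc 1) (Suc 1) (\<lambda>(a, b). pvar (\<rho> a + c (\<kappa> b)))))"
              unfolding subst_poly_det by (intro arg_cong[of _ _ det] cong_mat) (use \<rho> in \<open>auto simp: y_def\<close>)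
            moreover have "det (mat (Suc 1) (Suc 1) (\<lambda>(a, b). pvar (\<rho> a + c (\<kappa> b)))) \<in> ?I"
              by (rule hankel_det_kernel[of 1 \<rho> "\<lambda>b. c (\<kappa> b)"]) (use bound \<rho> in blast)
            ultimately show "det (mat (Suc 1) (Suc 1) (\<lambda>(a, b). ?f (\<rho> a) (\<kappa> b))) \<in> ?J"
              using J(2) by (auto simp: join_gens_def)
          qed (use 1 in auto)
        next
          case 2
          show ?thesis
          proof (rule det_rows_mem[OF J(1) fcar, where k = "Suc r" and q = "\<lambda>a. a \<notin> S" and \<rho> = "\<lambda>a. a" and \<kappa> = "\<lambda>a. a"])
            fix \<rho> \<kappa> assume \<rho>: "\<And>a. a < Suc r \<Longrightarrow> \<rho> a < ?n \<and> \<rho> a \<notin> S \<and> \<kappa> a < ?n"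
            have "det (mat (Suc r) (Suc r) (\<lambda>(a, b). ?f (\<rho> a) (\<kappa> b))) =
                subst_poly (\<lambda>i. pvar (Z i)) (det (mat (Suc r) (Suc r) (\<lambda>(a, b). pvar (\<rho> a + c (\<kappa> b)))))"
              unfolding subst_poly_det by (intro arg_cong[of _ _ det] cong_mat) (use \<rho> in \<open>auto simp: z_def\<close>)
            moreover have "det (mat (Suc r) (Suc r) (\<lambda>(a, b). pvar (\<rho> a + c (\<kappa> b)))) \<in> ?K"
              by (rule hankel_det_kernel[of r \<rho> "\<lambda>b. c (\<kappa> b)"]) (use bound \<rho> in blast)
            ultimately show "det (mat (Suc r) (Suc r) (\<lambda>(a, b). ?f (\<rho> a) (\<kappa> b))) \<in> ?J"
              using J(2) by (auto simp: join_gens_def)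
          qed (use 2 in auto)
        qed
      qed
      ultimately have "?x (hankel_minor ?n c) \<in> ?J"
        unfolding X using mpol_idealD(3)[OF J(1)] by fastforce
      then show ?thesis using hankel_minor_carrier[OF c] by (simp add: join_ideal_eq)
    qed
    then have "hankel_minor (Suc (Suc r)) ` minor_columns d (Suc (Suc r)) \<subseteq> join_ideal d ?I ?K" by blast
    then show "secant_kernel d (Suc r) \<subseteq> join_ideal d ?I ?K"
      using secant_kernel_generated[of "Suc r" d, where ?'k = 'k] genideal_mpol(3)[OF _ join]
      by (auto simp: hankel_minor_carrier image_subset_iff)
  qed
qed

corollary secant_ideal_hankel:
  assumes "d \<ge> 1" "r \<ge> 1"
  shows "secant_ideal d (hankel_ideal d) r = (secant_kernel d r :: (nat, 'k::field) mpol set)"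
proof -
  have "(join_ideal d (hankel_ideal d) ^^ n) (hankel_ideal d) = (secant_kernel d (Suc n) :: (nat, 'k) mpol set)" for n
  proof (induction n)
    case (Suc n)
    then show ?case
      using join_secant_kernel[of "Suc n" d, where ?'k = 'k] hankel_ideal_eq[OF assms(1), where ?'k = 'k] by simp
  qed (use hankel_ideal_eq[OF assms(1)] in simp)
  from this[of "r - 1"] show ?thesis using assms(2) by (simp add: secant_ideal_def)
qed

section \<open>Differential perfection\<close>

lemma set_add_mpol: "I <+>\<^bsub>mpol_ring V\<^esub> J = {a + b | a b. a \<in> I \<and> b \<in> J}"
  by (auto simp: AbelCoset.set_add_def')

text \<open>The sum in the semiring of ideals is the least ideal above all summands. With the empty
  sum equal to the zero ideal, this also covers \<open>s = 1\<close> in differential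
  perfection.\<close>

lemma ideal_finsum:
  fixes F :: "'i \<Rightarrow> ('v, 'k::comm_ring_1) mpol set"
  assumes "finite A" "\<And>i. i \<in> A \<Longrightarrow> ideal (F i) (mpol_ring V)"
  shows "ideal (\<Oplus>\<^bsub>ideals_set (mpol_ring V)\<^esub>i\<in>A. F i) (mpol_ring V) \<and>
    (\<forall>i\<in>A. F i \<subseteq> (\<Oplus>\<^bsub>ideals_set (mpol_ring V)\<^esub>i\<in>A. F i)) \<and>
    (\<forall>K. ideal K (mpol_ring V) \<longrightarrow> (\<forall>i\<in>A. F i \<subseteq> K) \<longrightarrow> (\<Oplus>\<^bsub>ideals_set (mpol_ring V)\<^esub>i\<in>A. F i) \<subseteq> K)"
proof -
  interpret S: Ring.semiring "ideals_set (mpol_ring V :: ('v, 'k) mpol ring)"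
    by (rule cring.ideals_set_is_semiring[OF cring_mpol_ring])
  interpret R: cring "mpol_ring V :: ('v, 'k) mpol ring" by (rule cring_mpol_ring)
  from assms show ?thesis
  proof (induction A rule: finite_induct)
    case empty
    have "ideal {0} (mpol_ring V :: ('v, 'k) mpol ring)" using R.zeroideal by simp
    then show ?case using mpol_idealD(2) by auto
  next
    case (insert i A)
    let ?s = "\<Oplus>\<^bsub>ideals_set (mpol_ring V)\<^esub>i\<in>A. F i"
    have IH: "ideal ?s (mpol_ring V)" "\<And>i. i \<in> A \<Longrightarrow> F i \<subseteq> ?s"
        "\<And>K. ideal K (mpol_ring V) \<Longrightarrow> (\<And>i. i \<in> A \<Longrightarrow> F i \<subseteq> K) \<Longrightarrow> ?s \<subseteq> K"
      using insert by auto
    have i: "ideal (F i) (mpol_ring V)" using insert.prems by simp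
    have eq: "(\<Oplus>\<^bsub>ideals_set (mpol_ring V)\<^esub>i\<in>insert i A. F i) = {a + b | a b. a \<in> F i \<and> b \<in> ?s}"
      using S.finsum_insert[OF insert.hyps, of F] insert.prems by (simp add: set_add_mpol Pi_def)
    have sub: "F i \<subseteq> {a + b | a b. a \<in> F i \<and> b \<in> ?s}" "?s \<subseteq> {a + b | a b. a \<in> F i \<and> b \<in> ?s}"
      using mpol_idealD(2)[OF i] mpol_idealD(2)[OF IH(1)] by force+
    have "ideal {a + b | a b. a \<in> F i \<and> b \<in> ?s} (mpol_ring V)"
      using R.add_ideals[OF i IH(1)] by (simp add: set_add_mpol)
    moreover have "{a + b | a b. a \<in> F i \<and> b \<in> ?s} \<subseteq> K"
      if K: "ideal K (mpol_ring V)" "\<forall>j\<in>insert i A. F j \<subseteq> K" for K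
    proof -
      have "F i \<subseteq> K" "?s \<subseteq> K" using K IH(3)[OF K(1)] by auto
      then show ?thesis using mpol_idealD(3)[OF K(1)] by blast
    qed
    moreover have "F j \<subseteq> {a + b | a b. a \<in> F i \<and> b \<in> ?s}" if "j \<in> insert i A" for j
      using that
    proof
      assume "j \<in> A"
      from subset_trans[OF IH(2)[OF this] sub(2)] show ?thesis .
    qed (simp only: sub(1))
    ultimately show ?case unfolding eq by simp
  qed
qed

text \<open>Tested on generators: a product of at least two minors splits into elements of lower
  symbolic powers, while a single minor has size \<open>r + s\<close> and lies in the kernel for
  \<open>r + s - 1\<close>. Conversely, these larger minors generate that kernel and lie in
  \<open>Q s\<close>.\<close>

theorem secant_kernel_differentially_perfect:
  fixes d r s :: nat
  assumes r: "r \<ge> 1" and s: "s \<ge> 1"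
  defines "Q \<equiv> symbolic_power d (secant_kernel d r :: (nat, 'k::field) mpol set)"
  shows "Q s = secant_kernel d (r + s - 1) <+>\<^bsub>poly_ring d\<^esub>
    (\<Oplus>\<^bsub>ideals_set (poly_ring d)\<^esub>i\<in>{1..s - 1}. ideal_prod (poly_ring d) (Q i) (Q (s - i)))"
proof -
  interpret R: cring "poly_ring d :: (nat, 'k) mpol ring" by (rule cring_mpol_ring)
  let ?P = "secant_kernel d (r + s - 1) :: (nat, 'k) mpol set"
  let ?S = "\<Oplus>\<^bsub>ideals_set (poly_ring d)\<^esub>i\<in>{1..s - 1}. ideal_prod (poly_ring d) (Q i) (Q (s - i))"
  have Q: "ideal (Q i) (poly_ring d)" for i
    unfolding Q_def by (rule symbolic_power_ideal[OF secant_eval_hom])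
  have P: "ideal ?P (poly_ring d)" by (rule ideal_hom_kernel[OF secant_eval_hom])
  have S: "ideal ?S (poly_ring d)"
    "\<And>i. i \<in> {1..s - 1} \<Longrightarrow> ideal_prod (poly_ring d) (Q i) (Q (s - i)) \<subseteq> ?S"
    "\<And>K. ideal K (poly_ring d) \<Longrightarrow> (\<And>i. i \<in> {1..s - 1} \<Longrightarrow> ideal_prod (poly_ring d) (Q i) (Q (s - i)) \<subseteq> K) \<Longrightarrow> ?S \<subseteq> K"
    using ideal_finsum[of "{1..s - 1}" "\<lambda>i. ideal_prod (poly_ring d) (Q i) (Q (s - i))" "{..d}"]
      R.ideal_prod_is_ideal[OF Q Q] by auto
  have sum: "ideal (?P <+>\<^bsub>poly_ring d\<^esub> ?S) (poly_ring d)" by (rule R.add_ideals[OF P S(1)])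
  have sub: "?P \<subseteq> ?P <+>\<^bsub>poly_ring d\<^esub> ?S" "?S \<subseteq> ?P <+>\<^bsub>poly_ring d\<^esub> ?S"
    unfolding set_add_mpol using mpol_idealD(2)[OF P] mpol_idealD(2)[OF S(1)] by force+
  show ?thesis
  proof (rule antisym)
    have "minor_product xs \<in> ?P <+>\<^bsub>poly_ring d\<^esub> ?S" if xs: "xs \<in> minor_lists d r s" for xs
    proof -
      from xs obtain n c ys where eq: "xs = (n, c) # ys" by (cases xs) (auto simp: minor_lists_def)
      with xs have n: "r < n" "c \<in> minor_columns d n" and ys: "\<forall>(n, c)\<in>set ys. r < n \<and> c \<in> minor_columns d n"
        and tot: "n - r + (\<Sum>(n, c)\<leftarrow>ys. n - r) = s"
        by (auto simp: minor_lists_def)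
      show ?thesis
      proof (cases ys)
        case Nil
        with n tot have "n = r + s" by simp
        then have "hankel_minor n c \<in> symbolic_power d ?P (Suc 0)"
          using hankel_minor_symbolic_power[OF n(2), of "r + s - 1", where ?'k = 'k] s by simp
        then have "hankel_minor n c \<in> ?P" unfolding symbolic_power_1[OF secant_eval_hom] .
        then show ?thesis using sub(1) eq Nil by (auto simp: minor_product_def)
      next
        case (Cons y zs)
        \<comment> \<open>Positivity of the rest makes \<open>n - r\<close> smaller than
          \<open>s\<close>, as the index range of the sum requires.\<close>
        have pos: "(\<Sum>(n, c)\<leftarrow>ys. n - r) \<ge> 1" using ys Cons by (cases y) auto
        have "minor_product xs \<in> ideal_prod (poly_ring d) (Q (n - r)) (Q (s - (n - r)))"
        proof -
          have "hankel_minor n c \<in> Q (n - r)"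
            unfolding Q_def by (rule hankel_minor_symbolic_power[OF n(2)]) (use n(1) in simp)
          moreover have "minor_product ys \<in> Q (s - (n - r))"
            using minor_product_symbolic_power[OF ys, where ?'k = 'k] tot by (simp add: Q_def flip: tot)
          ultimately show ?thesis
            using ideal_prod.prod[of _ "Q (n - r)" _ "Q (s - (n - r))" "poly_ring d"] by (simp add: eq minor_product_Cons)
        qed
        moreover have "n - r \<in> {1..s - 1}" using n(1) tot pos by auto
        ultimately show ?thesis using S(2) sub(2) by blast
      qed
    qed
    then have G: "minor_products d r s \<subseteq> ?P <+>\<^bsub>poly_ring d\<^esub> ?S"
      unfolding minor_products_eq[OF r] by blast
    have "Q s = genideal (poly_ring d) (minor_products d r s)"
      unfolding Q_def by (rule symbolic_power_generated[OF r s])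
    also have "\<dots> \<subseteq> ?P <+>\<^bsub>poly_ring d\<^esub> ?S"
      by (rule genideal_mpol(3)[OF _ sum G]) (use G mpol_idealD(1)[OF sum] in blast)
    finally show "Q s \<subseteq> ?P <+>\<^bsub>poly_ring d\<^esub> ?S" .
    have "hankel_minor (Suc (r + s - 1)) c \<in> Q s" if "c \<in> minor_columns d (Suc (r + s - 1))" for c
      using hankel_minor_symbolic_power[OF that, of r, where ?'k = 'k] s by (simp add: Q_def)
    then have "?P \<subseteq> Q s"
      using secant_kernel_generated[of "r + s - 1" d, where ?'k = 'k] r s genideal_mpol(3)[OF _ Q]
      by (auto simp: hankel_minor_carrier image_subset_iff)
    moreover have "?S \<subseteq> Q s"
    proof (rule S(3)[OF Q], rule subsetI)
      fix i f assume i: "i \<in> {1..s - 1}" and "f \<in> ideal_prod (poly_ring d) (Q i) (Q (s - i))"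
      from this(2) show "f \<in> Q s"
      proof induction
        case (prod a b)
        then have "a * b \<in> Q (i + (s - i))" unfolding Q_def by (rule symbolic_power_mult[OF secant_eval_hom])
        moreover have "i + (s - i) = s" using i by auto
        ultimately show ?case by simp
      next
        case (sum a b)
        then show ?case using mpol_idealD(3)[OF Q] by simp
      qed
    qed
    ultimately show "?P <+>\<^bsub>poly_ring d\<^esub> ?S \<subseteq> Q s"
      unfolding set_add_mpol using mpol_idealD(3)[OF Q] by blast
  qed
qed

theorem corollary6p3:
  fixes d :: nat
  assumes "d \<ge> 1"
  shows "differentially_perfect d (hankel_ideal d :: (nat, 'k::alg_closed_field) mpol set) \<and>
    (\<forall>r s ord. r \<ge> 1 \<longrightarrow> s \<ge> 1 \<longrightarrow> diagonal_term_order TYPE('k) d ord \<longrightarrow>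
       groebner_basis d ord (minor_products d r s)
         (symbolic_power d (secant_ideal d (hankel_ideal d :: (nat, 'k) mpol set) r) s))"
proof (intro conjI allI impI)
  note secant = secant_ideal_hankel[OF assms, where ?'k = 'k]
  show "differentially_perfect d (hankel_ideal d :: (nat, 'k) mpol set)"
    unfolding differentially_perfect_def r_differentially_perfect_def
  proof (intro allI impI)
    fix r s :: nat assume rs: "r \<ge> 1" "s \<ge> 1"
    \<comment> \<open>The identification of secant ideals with kernels is available from index 1
      on.\<close>
    then have "r + s - 1 \<ge> 1" by simp
    from secant_kernel_differentially_perfect[OF rs]
    show "symbolic_power d (secant_ideal d (hankel_ideal d :: (nat, 'k) mpol set) r) s =
       secant_ideal d (hankel_ideal d) (r + s - 1) <+>\<^bsub>poly_ring d\<^esub>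
       (\<Oplus>\<^bsub>ideals_set (poly_ring d)\<^esub> i \<in> {1..s - 1}.
          ideal_prod (poly_ring d) (symbolic_power d (secant_ideal d (hankel_ideal d) r) i)
            (symbolic_power d (secant_ideal d (hankel_ideal d) r) (s - i)))"
      unfolding secant[OF rs(1)] secant[OF \<open>r + s - 1 \<ge> 1\<close>] .
  qed
  fix r s :: nat and ord
  assume "r \<ge> 1" "s \<ge> 1" "diagonal_term_order TYPE('k) d ord"
  then show "groebner_basis d ord (minor_products d r s)
      (symbolic_power d (secant_ideal d (hankel_ideal d :: (nat, 'k) mpol set) r) s)"
    unfolding secant[OF \<open>r \<ge> 1\<close>] by (intro minor_products_groebner)
qed

end
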